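(* Let $\alpha\in(0,n)$, $p\in[\frac n{n+\alpha},1]$ and $\frac1q=\frac1p-\frac\alpha n$. For some $r\in(\frac n{n-\alpha},\infty)$, if the weight $\omega$ satisfies $\omega^{\frac{nr}{nr-n-r\alpha}}\in A^{\mathrm{loc}}_1(\mathbb{R}^n)$ and $\int_{\mathbb{R}^n}[\omega(x)]^p\,dx=\infty$, then there exists a positive constant $C$ such that for all $f\in h^p_{\omega^p}(\mathbb{R}^n)$, $$\|I^{\mathrm{loc}}_\alpha(f)\|_{L^q_{\omega^q}(\mathbb{R}^n)}\le C\|f\|_{h^p_{\omega^p}(\mathbb{R}^n)}.$$
   Context: Cubes are closed with sides parallel to the axes; $Q(x,t)$ is the cube with center $x$ and sidelength $t$; $v(E)=\int_Ev\,dx$; $\mathbb{Z}_+=\{0,1,2,\dots\}$; $\lfloor r\rfloor$ is the largest integer not exceeding $r$. A weight is a locally integrable function positive a.e. Local fractional integral. Fix $\phi_0\in\mathcal{D}(\mathbb{R}^n)$ with $\phi_0\equiv1$ on $Q(0,1)$ and $\mathrm{supp}\,\phi_0\subset Q(0,2)$. $I^{\mathrm{loc}}_\alpha(f)(x)=\int_{\mathbb{R}^n}\frac{\phi_0(y)}{|y|^{n-\alpha}}f(x-y)\,dy$ for Schwartz $f$, i.e. convolution with the compactly supported integrable kernel $\phi_0(y)|y|^{\alpha-n}$, which is meaningful for $f\in\mathcal{D}'(\mathbb{R}^n)$. Weights. For $u\in(1,\infty)$, $A^{\mathrm{loc}}_u(\mathbb{R}^n)$ is the set of nonnegative locally integrable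 $v$ with $\sup_{|Q|\le1}|Q|^{-u}\int_Qv\,dx\,(\int_Qv^{-u'/u}dx)^{u/u'}<\infty$ ($1/u+1/u'=1$); $A^{\mathrm{loc}}_1$: $\sup_{|Q|\le1}|Q|^{-1}\int_Qv\,dx\cdot\mathrm{ess\,sup}_Q\,v^{-1}<\infty$; $A^{\mathrm{loc}}_\infty=\bigcup_{1\le u<\infty}A^{\mathrm{loc}}_u$. $q_v=\inf\{u\in[1,\infty):v\in A^{\mathrm{loc}}_u\}$. $\|g\|_{L^u_v}=(\int|g|^uv\,dx)^{1/u}$ for $0<u<\infty$. Weighted local Hardy spaces. Let $p\in(0,1]$, $v\in A^{\mathrm{loc}}_\infty$. $\mathcal{D}=C_c^\infty(\mathbb{R}^n)$, $\mathcal{D}'$ its dual; $\psi_t(x)=t^{-n}\psi(x/t)$. $\mathcal{G}_N(f)(x)=\sup|\psi_t*f(x)|$ over $t\in(0,1)$ and $\psi\in\mathcal{D}$ with $\mathrm{supp}\,\psi\subset B(0,2^{3(10+n)})$ and $\sup_x\sup_{|\beta|\le N}|\partial^\beta\psi(x)|\le1$. $h^p_v(\mathbb{R}^n)=\{f\in\mathcal{D}':\mathcal{G}_N(f)\in L^p_v\}$ with $\|f\|_{h^p_v}=\|\mathcal{G}_N(f)\|_{L^p_v}$, for any integer $N\ge N_{p,v}$ (different such $N$ give the same space with equivalent quasi-norms). Here $h^p_{\omega^p}$ is $h^p_v$ with $v=\omega^p$. The integer $N_{p,v}$. Fix $\psi_0\in\mathcal{D}$ with $\int\psi_0\neq0$;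 $(\psi_0)_j(x)=2^{jn}\psi_0(2^jx)$ ($j\in\mathbb{Z}_+$), $m_{j,A,B}(y)=(1+2^j|y|)^A2^{B|y|}$, $M^{\mathrm{loc}}g(x)=\sup_{Q\ni x,|Q|\le1}|Q|^{-1}\int_Q|g|$, $K_Bg(x)=\int|g(y)|2^{-B|x-y|}dy$. $A_0$ is a positive constant depending only on $\mathrm{supp}\,\psi_0$ (such a constant exists) such that for every $u>0$, $A>\max\{A_0,n/u\}$, $B\ge0$ there is $C=C(n,u,\psi_0,A,B)$ with $[\sup_y|(\psi_0)_j*f(x-y)|/m_{j,A,B}(y)]^u\le C\sum_{k\ge j}2^{(j-k)(Au-n)}\{M^{\mathrm{loc}}(|(\psi_0)_k*f|^u)(x)+K_{Bu}(|(\psi_0)_k*f|^u)(x)\}$ for all $f\in\mathcal{D}'$, $x\in\mathbb{R}^n$, $j\in\mathbb{Z}_+$. $N_{p,v}=\max\{\lfloor n(q_v/p-1)\rfloor+2,\ \lfloor2\max\{A_0,nq_v/p\}\rfloor+1\}$. *)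

theory Defs
  imports "HOL-Analysis.Analysis" "HOL-Probability.Essential_Supremum"
begin

text \<open>\<open>\<real>\<^sup>n\<close> is \<^typ>\<open>real^'n\<close>, so \<open>n = CARD('n)\<close>. Test functions and distributions are
  complex-valued. Norms, suprema and integrals of nonnegative quantities that may be infinite
  are taken in \<^typ>\<open>ennreal\<close>.\<close>

text \<open>Real powers of extended nonnegative reals, with \<open>0\<^sup>s = \<infinity>\<close> and \<open>\<infinity>\<^sup>s = 0\<close> for \<open>s < 0\<close>.\<close>

definition epowr :: "ennreal \<Rightarrow> real \<Rightarrow> ennreal" where
  "epowr a s =
     (if s = 0 then 1
      else if a = 0 then (if s > 0 then 0 else \<infinity>)
      else if a = \<infinity> then (if s > 0 then \<infinity> else 0)
      else ennreal (enn2real a powr s))"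

definition cube :: "real^'n \<Rightarrow> real \<Rightarrow> (real^'n) set" where
  "cube x t = {y. \<forall>i. \<bar>y $ i - x $ i\<bar> \<le> t / 2}"

definition small_cubes :: "(real^'n) set set" where
  "small_cubes = {cube x t | x t. t > 0 \<and> measure lebesgue (cube x t) \<le> 1}"

definition locally_integrable :: "('a::euclidean_space \<Rightarrow> 'b::euclidean_space) \<Rightarrow> bool" where
  "locally_integrable g \<longleftrightarrow> (\<forall>K. compact K \<longrightarrow> g absolutely_integrable_on K)"

definition weight :: "(real^'n \<Rightarrow> real) \<Rightarrow> bool" where
  "weight w \<longleftrightarrow> locally_integrable w \<and> (AE x in lebesgue. w x > 0)"

definition conj_exponent :: "real \<Rightarrow> real" where
  "conj_exponent u = u / (u - 1)"

definition A1_loc :: "(real^'n \<Rightarrow> real) set" where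
  "A1_loc = {v. (\<forall>x. v x \<ge> 0) \<and> locally_integrable v \<and>
     (SUP Q\<in>small_cubes. ennreal (1 / measure lebesgue Q) * (\<integral>\<^sup>+x\<in>Q. ennreal (v x) \<partial>lebesgue)
        * esssup (restrict_space lebesgue Q) (\<lambda>x. inverse (ennreal (v x)))) < \<infinity>}"

definition A_loc :: "real \<Rightarrow> (real^'n \<Rightarrow> real) set" where
  "A_loc u = (if u = 1 then A1_loc else
     {v. (\<forall>x. v x \<ge> 0) \<and> locally_integrable v \<and>
       (SUP Q\<in>small_cubes. ennreal (measure lebesgue Q powr (- u))
          * (\<integral>\<^sup>+x\<in>Q. ennreal (v x) \<partial>lebesgue)
          * epowr (\<integral>\<^sup>+x\<in>Q. epowr (ennreal (v x)) (- conj_exponent u / u) \<partial>lebesgue)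
              (u / conj_exponent u)) < \<infinity>})"

definition q_index :: "(real^'n \<Rightarrow> real) \<Rightarrow> real" where
  "q_index v = Inf {u. u \<ge> 1 \<and> v \<in> A_loc u}"

definition Lw_norm :: "real \<Rightarrow> (real^'n \<Rightarrow> real) \<Rightarrow> (real^'n \<Rightarrow> ennreal) \<Rightarrow> ennreal" where
  "Lw_norm u v g = epowr (\<integral>\<^sup>+x. epowr (g x) u * ennreal (v x) \<partial>lebesgue) (1 / u)"

definition partial_deriv :: "'n \<Rightarrow> (real^'n \<Rightarrow> complex) \<Rightarrow> real^'n \<Rightarrow> complex" where
  "partial_deriv i f x = vector_derivative (\<lambda>t. f (x + t *\<^sub>R axis i 1)) (at 0)"

text \<open>A list of coordinates of length \<open>k\<close> stands for a multi-index \<open>\<beta>\<close> with \<open>\<bar>\<beta>\<bar> = k\<close>; on smooth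
  functions the order of the list does not matter.\<close>

definition partial_derivs :: "'n list \<Rightarrow> (real^'n \<Rightarrow> complex) \<Rightarrow> real^'n \<Rightarrow> complex" where
  "partial_derivs is f = foldr partial_deriv is f"

definition smooth :: "(real^'n \<Rightarrow> complex) \<Rightarrow> bool" where
  "smooth f \<longleftrightarrow> (\<forall>is. partial_derivs is f differentiable_on UNIV)"

definition supp :: "(real^'n \<Rightarrow> complex) \<Rightarrow> (real^'n) set" where
  "supp f = closure {x. f x \<noteq> 0}"

definition test_functions :: "(real^'n \<Rightarrow> complex) set" where
  "test_functions = {\<phi>. smooth \<phi> \<and> compact (supp \<phi>)}"

definition C_norm :: "nat \<Rightarrow> (real^'n \<Rightarrow> complex) \<Rightarrow> real" where
  "C_norm N \<phi> = (SUP (is, x) \<in> {is. length is \<le> N} \<times> UNIV. norm (partial_derivs is \<phi> x))"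

text \<open>A distribution is a functional that is linear on test functions and continuous on the test
  functions supported in each compact set; its values outside \<^const>\<open>test_functions\<close> are
  irrelevant.\<close>

definition distributions :: "((real^'n \<Rightarrow> complex) \<Rightarrow> complex) set" where
  "distributions = {f.
     (\<forall>\<phi>\<in>test_functions. \<forall>\<psi>\<in>test_functions. \<forall>a b.
        f (\<lambda>x. a * \<phi> x + b * \<psi> x) = a * f \<phi> + b * f \<psi>) \<and>
     (\<forall>K. compact K \<longrightarrow> (\<exists>C N. \<forall>\<phi>\<in>test_functions. supp \<phi> \<subseteq> K \<longrightarrow>
        norm (f \<phi>) \<le> C * C_norm N \<phi>))}"

definition represents ::
    "(real^'n \<Rightarrow> complex) \<Rightarrow> ((real^'n \<Rightarrow> complex) \<Rightarrow> complex) \<Rightarrow> bool" where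
  "represents g f \<longleftrightarrow> locally_integrable g \<and>
     (\<forall>\<phi>\<in>test_functions. f \<phi> = (LINT x|lebesgue. g x * \<phi> x))"

definition conv :: "(real^'n \<Rightarrow> complex) \<Rightarrow> ((real^'n \<Rightarrow> complex) \<Rightarrow> complex) \<Rightarrow> real^'n \<Rightarrow> complex"
  where "conv \<psi> f x = f (\<lambda>y. \<psi> (x - y))"

definition cutoff :: "(real^'n \<Rightarrow> complex) \<Rightarrow> bool" where
  "cutoff \<phi>\<^sub>0 \<longleftrightarrow> \<phi>\<^sub>0 \<in> test_functions \<and> (\<forall>x\<in>cube 0 1. \<phi>\<^sub>0 x = 1) \<and> supp \<phi>\<^sub>0 \<subseteq> cube 0 2"

definition I_kernel :: "(real^'n \<Rightarrow> complex) \<Rightarrow> real \<Rightarrow> real^'n \<Rightarrow> complex" where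
  "I_kernel \<phi>\<^sub>0 \<alpha> y = \<phi>\<^sub>0 y / of_real (norm y powr (real CARD('n) - \<alpha>))"

text \<open>Convolution of a distribution \<open>f\<close> with the kernel \<open>k\<close>, defined by duality:
  \<open>\<langle>k * f, \<phi>\<rangle> = \<langle>f, \<integral> k(y) \<phi>(\<cdot> + y) dy\<rangle>\<close>.\<close>

definition I_loc :: "(real^'n \<Rightarrow> complex) \<Rightarrow> real \<Rightarrow>
    ((real^'n \<Rightarrow> complex) \<Rightarrow> complex) \<Rightarrow> (real^'n \<Rightarrow> complex) \<Rightarrow> complex" where
  "I_loc \<phi>\<^sub>0 \<alpha> f \<phi> = f (\<lambda>x. LINT y|lebesgue. I_kernel \<phi>\<^sub>0 \<alpha> y * \<phi> (x + y))"

definition dilate :: "real \<Rightarrow> (real^'n \<Rightarrow> complex) \<Rightarrow> real^'n \<Rightarrow> complex" where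
  "dilate t \<psi> x = (1 / t ^ CARD('n)) *\<^sub>R \<psi> (x /\<^sub>R t)"

definition grand_max ::
    "nat \<Rightarrow> ((real^'n \<Rightarrow> complex) \<Rightarrow> complex) \<Rightarrow> real^'n \<Rightarrow> ennreal" where
  "grand_max N f x =
     (SUP (t, \<psi>) \<in> {0<..<1} \<times> {\<psi> \<in> test_functions.
          supp \<psi> \<subseteq> ball 0 (2 ^ (3 * (10 + CARD('n)))) \<and> C_norm N \<psi> \<le> 1}.
        ennreal (norm (conv (dilate t \<psi>) f x)))"

definition hardy_norm ::
    "nat \<Rightarrow> real \<Rightarrow> (real^'n \<Rightarrow> real) \<Rightarrow> ((real^'n \<Rightarrow> complex) \<Rightarrow> complex) \<Rightarrow> ennreal" where
  "hardy_norm N p v f = Lw_norm p v (grand_max N f)"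

definition hardy_space ::
    "nat \<Rightarrow> real \<Rightarrow> (real^'n \<Rightarrow> real) \<Rightarrow> ((real^'n \<Rightarrow> complex) \<Rightarrow> complex) set" where
  "hardy_space N p v = {f \<in> distributions. hardy_norm N p v f < \<infinity>}"

definition dyadic_dilate :: "nat \<Rightarrow> (real^'n \<Rightarrow> complex) \<Rightarrow> real^'n \<Rightarrow> complex" where
  "dyadic_dilate j \<psi> x = (2 ^ (j * CARD('n))) *\<^sub>R \<psi> (2 ^ j *\<^sub>R x)"

definition peetre_weight :: "nat \<Rightarrow> real \<Rightarrow> real \<Rightarrow> real^'n \<Rightarrow> real" where
  "peetre_weight j A B y = (1 + 2 ^ j * norm y) powr A * 2 powr (B * norm y)"

definition M_loc :: "(real^'n \<Rightarrow> real) \<Rightarrow> real^'n \<Rightarrow> ennreal" where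
  "M_loc g x = (SUP Q\<in>{Q \<in> small_cubes. x \<in> Q}.
     ennreal (1 / measure lebesgue Q) * (\<integral>\<^sup>+y\<in>Q. ennreal \<bar>g y\<bar> \<partial>lebesgue))"

definition K_op :: "real \<Rightarrow> (real^'n \<Rightarrow> real) \<Rightarrow> real^'n \<Rightarrow> ennreal" where
  "K_op B g x = (\<integral>\<^sup>+y. ennreal (\<bar>g y\<bar> * 2 powr (- B * norm (x - y))) \<partial>lebesgue)"

text \<open>The property that defines the threshold \<open>A\<^sub>0\<close> attached to \<open>\<psi>\<^sub>0\<close>. It is imposed for the given
  \<open>\<psi>\<^sub>0\<close> only; a threshold that depends only on the support of \<open>\<psi>\<^sub>0\<close> is a special case.\<close>

definition peetre_threshold :: "(real^'n \<Rightarrow> complex) \<Rightarrow> real \<Rightarrow> bool" where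
  "peetre_threshold \<psi>\<^sub>0 A\<^sub>0 \<longleftrightarrow> A\<^sub>0 > 0 \<and>
     (\<forall>u A B. u > 0 \<and> A > max A\<^sub>0 (real CARD('n) / u) \<and> B \<ge> 0 \<longrightarrow>
       (\<exists>C::real. \<forall>f\<in>distributions. \<forall>x. \<forall>j.
          epowr (SUP y. ennreal (norm (conv (dyadic_dilate j \<psi>\<^sub>0) f (x - y))
                                  / peetre_weight j A B y)) u
          \<le> ennreal C * (\<Sum>\<^sub>\<infinity>k\<in>{j..}.
               ennreal (2 powr ((real j - real k) * (A * u - real CARD('n)))) *
               (M_loc (\<lambda>y. norm (conv (dyadic_dilate k \<psi>\<^sub>0) f y) powr u) x
                + K_op (B * u) (\<lambda>y. norm (conv (dyadic_dilate k \<psi>\<^sub>0) f y) powr u) x))))"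

definition N_index :: "real \<Rightarrow> real \<Rightarrow> (real^'n \<Rightarrow> real) \<Rightarrow> int" where
  "N_index A\<^sub>0 p v =
     max (\<lfloor>real CARD('n) * (q_index v / p - 1)\<rfloor> + 2)
         (\<lfloor>2 * max A\<^sub>0 (real CARD('n) * q_index v / p)\<rfloor> + 1)"

end

theory Submission
  imports Defs
begin

text \<open>The theorem follows from a pointwise domination of \<open>I\<^sub>\<alpha> f\<close> by a dyadic potential of the
  grand maximal function \<open>G = G\<^sub>N f\<close>, and a weighted estimate for that potential that uses no
  atomic decomposition.

  Domination. Since \<open>\<phi>\<^sub>0\<close> is \<open>1\<close> near the origin, telescoping \<open>\<phi>\<^sub>0(2\<^sup>j y) - \<phi>\<^sub>0(2\<^bsup>j+1\<^esup> y)\<close> writes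
  the kernel as a sum of pieces \<open>2\<^bsup>j(n-\<alpha>)\<^esup> \<kappa>(2\<^sup>j y)\<close> with one test function \<open>\<kappa>\<close>, which vanishes near
  the singularity (\<open>test_kernel_piece_0\<close>). The \<open>j\<close>-th piece is \<open>2\<^bsup>-j\<alpha>\<^esup>\<close> times a dilate of \<open>\<kappa>\<close> to scale
  \<open>2\<^bsup>-j\<^esup>\<close>. The test functions in the definition of \<open>G\<close> may have large supports, so that a translation
  by the scale of the dilate is harmless, and the convolution of \<open>f\<close> with the \<open>j\<close>-th piece at \<open>x\<close> is at
  most a constant times \<open>2\<^bsup>-j\<alpha>\<^esup> G(y)\<close> for all \<open>y\<close> in the dyadic cube \<open>Q\<^sub>j(x)\<close> of side \<open>2\<^bsup>-j\<^esup>\<close> around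
  \<open>x\<close> (\<open>conv_kernel_piece_le\<close>). Hence \<open>I\<^sub>\<alpha> f\<close> is dominated by \<open>T = \<Sum>\<^sub>j 2\<^bsup>-j\<alpha>\<^esup> inf\<^bsub>Q\<^sub>j\<^esub> G\<close>.

  Weights. On every small cube \<open>Q\<close>, the condition \<open>A\<^sub>1\<close> for \<open>\<omega>\<^sup>s\<close> and \<open>p \<le> q \<le> s\<close> make \<open>\<omega>\<^sup>p\<close> and \<open>\<omega>\<^sup>q\<close>
  comparable on average to powers of one number, a lower bound of \<open>\<omega>\<close> on \<open>Q\<close>; thus \<open>\<integral>\<^sub>Q \<omega>\<^sup>q\<close> is at most
  \<open>C |Q|\<^bsup>1-q/p\<^esup> (\<integral>\<^sub>Q \<omega>\<^sup>p)\<^bsup>q/p\<^esup>\<close> (\<open>A1_loc_power_comparison\<close>).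

  Estimate. Let \<open>a\<^sub>j = (inf\<^bsub>Q\<^sub>j\<^esub> G)\<^sup>p\<close>, which increases with \<open>j\<close>, let \<open>e\<^sub>j \<ge> 0\<close> be its increments,
  \<open>W\<^sub>j = \<integral>\<^bsub>Q\<^sub>j\<^esub> \<omega>\<^sup>p\<close> and \<open>H = \<integral> G\<^sup>p \<omega>\<^sup>p\<close>. Because \<open>p \<le> 1\<close>, \<open>T\<^sup>p \<le> \<Sum> 2\<^bsup>-j\<alpha>p\<^esup> a\<^sub>j\<close>, which is at most a
  multiple of \<open>\<Sum> 2\<^bsup>-j\<alpha>p\<^esup> e\<^sub>j\<close> by summation by parts. Telescoping gives \<open>\<Sum> e\<^sub>j W\<^sub>j \<le> H\<close> at every point, so Jensen's
  inequality with the weights \<open>e\<^sub>j W\<^sub>j\<close> bounds \<open>T\<^sup>q\<close> by a multiple of \<open>H\<^bsup>q/p-1\<^esup> \<Sum> e\<^sub>j W\<^sub>j\<^bsup>1-q/p\<^esup> 2\<^bsup>-j\<alpha>q\<^esup>\<close>.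
  Integrated against \<open>\<omega>\<^sup>q\<close> cube by cube, the comparison of weights and \<open>1/q = 1/p - \<alpha>/n\<close> turn the
  \<open>j\<close>-th term into \<open>\<integral> e\<^sub>j \<omega>\<^sup>p\<close>, and these telescope again to at most \<open>H\<close>
  (\<open>dyadic_fractional_inequality\<close>). So \<open>\<integral> T\<^sup>q \<omega>\<^sup>q \<le> C H\<^bsup>q/p\<^esup>\<close>, which is the claim.

  That the sum of the convolutions represents the distribution \<open>I\<^sub>\<alpha> f\<close> comes from interchanging \<open>f\<close>
  with integrals (\<open>distribution_corr\<close>) and dominated convergence: \<open>T\<close> is locally integrable, since
  \<open>q \<ge> 1\<close> and \<open>\<omega>\<close> is bounded below on small cubes.\<close>

section \<open>Calculus of smooth functions and test functions\<close>

lemma partial_deriv_eq: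
  assumes "(f has_derivative D) (at x)"
  shows "partial_deriv i f x = D (axis i 1)"
proof -
  interpret D: bounded_linear D using assms by (rule has_derivative_bounded_linear)
  have "((\<lambda>t. f (x + t *\<^sub>R axis i 1)) has_derivative (\<lambda>t. D (t *\<^sub>R axis i 1))) (at 0)"
  proof -
    have 1: "((\<lambda>t::real. x + t *\<^sub>R axis i 1) has_derivative (\<lambda>t. t *\<^sub>R axis i 1)) (at 0)"
      by (auto intro!: derivative_eq_intros)
    have 2: "(f has_derivative D) (at (x + 0 *\<^sub>R axis i 1))" using assms by simp
    show ?thesis using diff_chain_at[OF 1 2] by (simp add: o_def)
  qed
  hence "((\<lambda>t. f (x + t *\<^sub>R axis i 1)) has_vector_derivative D (axis i 1)) (at 0)"
    by (simp add: has_vector_derivative_def D.scaleR)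
  thus ?thesis unfolding partial_deriv_def by (rule vector_derivative_at)
qed

lemma has_derivative_partials:
  assumes "f differentiable (at x)"
  shows "(f has_derivative (\<lambda>h. \<Sum>i\<in>UNIV. (h $ i) *\<^sub>R partial_deriv i f x)) (at x)"
proof -
  obtain D where D: "(f has_derivative D) (at x)" using assms by (auto simp: differentiable_def)
  interpret D: bounded_linear D using D by (rule has_derivative_bounded_linear)
  have "D h = (\<Sum>i\<in>UNIV. (h $ i) *\<^sub>R partial_deriv i f x)" for h
  proof -
    have "D h = D (\<Sum>i\<in>UNIV. (h $ i) *\<^sub>R axis i 1)"
      using basis_expansion[of h] by (simp add: scalar_mult_eq_scaleR)
    thus ?thesis by (simp add: D.sum D.scaleR partial_deriv_eq[OF D])
  qed
  hence "D = (\<lambda>h. \<Sum>i\<in>UNIV. (h $ i) *\<^sub>R partial_deriv i f x)" by (rule ext)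
  thus ?thesis using D by simp
qed

lemma partial_deriv_cong_open:
  assumes "open U" "x \<in> U" "\<And>y. y \<in> U \<Longrightarrow> f y = g y"
  shows "partial_deriv i f x = partial_deriv i g x"
  unfolding partial_deriv_def
proof (rule vector_derivative_cong_eq)
  have "((\<lambda>t. x + t *\<^sub>R axis i (1::real)) \<longlongrightarrow> x + 0 *\<^sub>R axis i 1) (nhds (0::real))"
    by (intro tendsto_intros filterlim_ident)
  hence "\<forall>\<^sub>F t in nhds (0::real). x + t *\<^sub>R axis i 1 \<in> U"
    using assms(1,2) by (intro topological_tendstoD) auto
  thus "\<forall>\<^sub>F t in nhds (0::real). t \<in> UNIV \<longrightarrow> f (x + t *\<^sub>R axis i 1) = g (x + t *\<^sub>R axis i 1)"
    by eventually_elim (auto intro: assms)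
qed auto

lemma partial_derivs_Nil [simp]: "partial_derivs [] f = f"
  and partial_derivs_Cons [simp]: "partial_derivs (i # is) f = partial_deriv i (partial_derivs is f)"
  and partial_derivs_append: "partial_derivs (is @ js) f = partial_derivs is (partial_derivs js f)"
  by (simp_all add: partial_derivs_def)

text \<open>Smoothness is proved by exhibiting a class of differentiable functions that is stable under
  partial derivatives. Membership is required only up to equality on an open set, so that functions
  with a singularity outside that set are covered.\<close>

lemma partial_derivs_coinduct:
  assumes U: "open U" and X: "X f"
    and diff: "\<And>f. X f \<Longrightarrow> f differentiable_on U"
    and closed: "\<And>f i. X f \<Longrightarrow> \<exists>g. X g \<and> (\<forall>x\<in>U. partial_deriv i f x = g x)"
  shows "partial_derivs is f differentiable_on U"
proof -
  have "\<exists>g. X g \<and> (\<forall>x\<in>U. partial_derivs is f x = g x)"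
  proof (induction "is")
    case Nil show ?case using X by (intro exI[of _ f]) simp
  next
    case (Cons i js)
    then obtain g where g: "X g" "\<forall>x\<in>U. partial_derivs js f x = g x" by auto
    obtain g' where "X g'" "\<forall>x\<in>U. partial_deriv i g x = g' x" using closed[OF g(1)] by blast
    moreover have "partial_deriv i (partial_derivs js f) x = partial_deriv i g x" if "x \<in> U" for x
      by (rule partial_deriv_cong_open[OF U that]) (use g(2) in blast)
    ultimately show ?case by (intro exI[of _ g']) simp
  qed
  then obtain g where g: "X g" "\<forall>x\<in>U. partial_derivs is f x = g x" by auto
  show ?thesis unfolding differentiable_on_def
  proof
    fix x assume x: "x \<in> U"
    obtain D where D: "(g has_derivative D) (at x within U)"
      using diff[OF g(1)] x unfolding differentiable_on_def differentiable_def by blast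
    have "(partial_derivs is f has_derivative D) (at x within U)"
      by (rule has_derivative_transform[OF x _ D]) (use g(2) in blast)
    thus "partial_derivs is f differentiable (at x within U)" unfolding differentiable_def by blast
  qed
qed

lemma partial_derivs_cong_open:
  assumes U: "open U" and eq: "\<And>x. x \<in> U \<Longrightarrow> f x = g x" and "x \<in> U"
  shows "partial_derivs is f x = partial_derivs is g x"
  using \<open>x \<in> U\<close>
proof (induction "is" arbitrary: x)
  case Nil thus ?case by (simp add: eq)
next
  case (Cons i js)
  show ?case unfolding partial_derivs_Cons by (rule partial_deriv_cong_open[OF U Cons.prems Cons.IH])
qed

lemma smooth_partial_derivs: "smooth f \<Longrightarrow> smooth (partial_derivs is f)"
  unfolding smooth_def by (simp flip: partial_derivs_append)

lemma smooth_partial_deriv: "smooth f \<Longrightarrow> smooth (partial_deriv i f)"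
  using smooth_partial_derivs[of f "[i]"] by simp

lemma smooth_differentiable: "smooth f \<Longrightarrow> f differentiable (at x)"
  unfolding smooth_def differentiable_on_def by (drule spec[of _ "[]"]) simp

lemmas smooth_has_derivative = has_derivative_partials[OF smooth_differentiable]

lemma smooth_continuous_on: "smooth f \<Longrightarrow> continuous_on S f"
  by (intro continuous_at_imp_continuous_on ballI differentiable_imp_continuous_within
      smooth_differentiable)

lemma partial_deriv_zero: "partial_deriv i (\<lambda>x. 0) = (\<lambda>x. 0)"
proof
  fix x show "partial_deriv i (\<lambda>x. 0) x = 0"
    using partial_deriv_eq[of "\<lambda>x. 0" "\<lambda>h. 0" x i] by simp
qed

lemma partial_derivs_zero: "partial_derivs is (\<lambda>x. 0) = (\<lambda>x. 0)"
  by (induction "is") (auto simp: partial_deriv_zero)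

lemma partial_derivs_affine:
  assumes "smooth f"
  shows "partial_derivs is (\<lambda>x. f (c *\<^sub>R x + b)) = (\<lambda>x. c ^ length is *\<^sub>R partial_derivs is f (c *\<^sub>R x + b))"
proof (induction "is")
  case Nil show ?case by simp
next
  case (Cons i js)
  let ?F = "partial_derivs js f"
  have "partial_deriv i (\<lambda>x. c ^ length js *\<^sub>R ?F (c *\<^sub>R x + b)) x =
        c ^ length (i # js) *\<^sub>R partial_deriv i ?F (c *\<^sub>R x + b)" for x
  proof -
    note F = smooth_has_derivative[OF smooth_partial_derivs[OF assms]]
    have 1: "((\<lambda>x. c *\<^sub>R x + b) has_derivative (\<lambda>h. c *\<^sub>R h)) (at x)"
      by (auto intro!: derivative_eq_intros)
    have 2: "((\<lambda>x. ?F (c *\<^sub>R x + b)) has_derivative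
       (\<lambda>h. \<Sum>k\<in>UNIV. ((c *\<^sub>R h) $ k) *\<^sub>R partial_deriv k ?F (c *\<^sub>R x + b))) (at x)"
      using diff_chain_at[OF 1 F] by (simp add: o_def)
    have "partial_deriv i (\<lambda>x. c ^ length js *\<^sub>R ?F (c *\<^sub>R x + b)) x =
       c ^ length js *\<^sub>R (\<Sum>k\<in>UNIV. ((c *\<^sub>R axis i 1) $ k) *\<^sub>R partial_deriv k ?F (c *\<^sub>R x + b))"
      by (rule partial_deriv_eq[OF has_derivative_scaleR_right[OF 2]])
    also have "(\<Sum>k\<in>UNIV. ((c *\<^sub>R axis i 1) $ k) *\<^sub>R partial_deriv k ?F (c *\<^sub>R x + b)) =
       (\<Sum>k\<in>UNIV. if k = i then c *\<^sub>R partial_deriv k ?F (c *\<^sub>R x + b) else 0)"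
      by (intro sum.cong) (auto simp: axis_def)
    finally show ?thesis by (simp add: mult.commute)
  qed
  thus ?case by (auto simp: Cons)
qed

lemma smooth_affine: 
  assumes "smooth f" shows "smooth (\<lambda>x. f (c *\<^sub>R x + b))"
proof -
  have "(\<lambda>x. c ^ k *\<^sub>R F (c *\<^sub>R x + b)) differentiable (at x)" if "smooth F" for F k and x :: "real^'a"
  proof -
    have 1: "(\<lambda>x. c *\<^sub>R x + b) differentiable (at x)" by simp
    have "F \<circ> (\<lambda>x. c *\<^sub>R x + b) differentiable (at x)"
      by (rule differentiable_chain_at[OF 1 smooth_differentiable[OF that]])
    thus ?thesis by (simp add: o_def differentiable_scaleR)
  qed
  from this[OF smooth_partial_derivs[OF assms]] show ?thesis
    unfolding smooth_def[of "\<lambda>x. f (c *\<^sub>R x + b)"] partial_derivs_affine[OF assms]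
    by (simp add: differentiable_on_def)
qed

lemma partial_derivs_linear:
  assumes "smooth f" "smooth g"
  shows "partial_derivs is (\<lambda>x. a * f x + b * g x) =
     (\<lambda>x. a * partial_derivs is f x + b * partial_derivs is g x)"
proof (induction "is")
  case Nil show ?case by simp
next
  case (Cons i js)
  let ?F = "partial_derivs js f" let ?G = "partial_derivs js g"
  have "partial_deriv i (\<lambda>x. a * ?F x + b * ?G x) x = a * partial_deriv i ?F x + b * partial_deriv i ?G x" for x
  proof -
    obtain D where D: "(?F has_derivative D) (at x)"
      using smooth_differentiable[OF smooth_partial_derivs[OF assms(1)]] by (auto simp: differentiable_def)
    obtain E where E: "(?G has_derivative E) (at x)"
      using smooth_differentiable[OF smooth_partial_derivs[OF assms(2)]] by (auto simp: differentiable_def)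
    have "((\<lambda>x. a * ?F x + b * ?G x) has_derivative (\<lambda>h. a * D h + b * E h)) (at x)"
      by (intro has_derivative_add has_derivative_mult_right D E)
    from partial_deriv_eq[OF this] show ?thesis by (simp add: partial_deriv_eq[OF D] partial_deriv_eq[OF E])
  qed
  thus ?case by (auto simp: Cons)
qed

lemma smooth_linear:
  assumes "smooth f" "smooth g" shows "smooth (\<lambda>x. a * f x + b * g x)"
  unfolding smooth_def partial_derivs_linear[OF assms] differentiable_on_def
  using smooth_differentiable[OF smooth_partial_derivs[OF assms(1)]]
    smooth_differentiable[OF smooth_partial_derivs[OF assms(2)]] by (auto intro!: derivative_intros)

lemma test_functions_iff: "\<phi> \<in> test_functions \<longleftrightarrow> smooth \<phi> \<and> bounded {x. \<phi> x \<noteq> 0}"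
  by (simp add: test_functions_def supp_def compact_closure)

lemma test_smooth: "\<phi> \<in> test_functions \<Longrightarrow> smooth \<phi>"
  by (simp add: test_functions_iff)

lemma supp_subset: "closed S \<Longrightarrow> (\<And>x. \<phi> x \<noteq> 0 \<Longrightarrow> x \<in> S) \<Longrightarrow> supp \<phi> \<subseteq> S"
  unfolding supp_def by (rule closure_minimal) auto

lemma test_support_ball:
  assumes "\<phi> \<in> test_functions"
  obtains R where "R > 0" "\<And>x. norm x > R \<Longrightarrow> \<phi> x = 0"
proof -
  have "bounded {x. \<phi> x \<noteq> 0}" using assms by (simp add: test_functions_iff)
  then obtain R where "R > 0" "\<forall>x\<in>{x. \<phi> x \<noteq> 0}. norm x \<le> R" using bounded_pos by blast
  thus ?thesis using that[of R] by force
qed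

lemma test_functionsI_ball:
  assumes "smooth \<phi>" "\<And>x. norm x > R \<Longrightarrow> \<phi> x = 0"
  shows "\<phi> \<in> test_functions"
proof -
  have "bounded {x. \<phi> x \<noteq> 0}" unfolding bounded_iff using assms(2) by (intro exI[of _ R]) force
  thus ?thesis by (simp add: test_functions_iff assms)
qed

lemma partial_derivs_vanish:
  assumes "\<And>x. norm x > R \<Longrightarrow> \<phi> x = 0" "norm x > R"
  shows "partial_derivs is \<phi> x = 0"
proof -
  have "open {x::real^'a. norm x > R}" by (intro open_Collect_less continuous_intros)
  from partial_derivs_cong_open[OF this, of \<phi> "\<lambda>x. 0" x "is"] assms
  show ?thesis by (simp add: partial_derivs_zero)
qed

lemma test_partial_derivs: 
  assumes "\<phi> \<in> test_functions" shows "partial_derivs is \<phi> \<in> test_functions"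
proof -
  obtain R where R: "\<And>x. norm x > R \<Longrightarrow> \<phi> x = 0" using test_support_ball[OF assms] by blast
  show ?thesis
    by (rule test_functionsI_ball[where R = R])
       (use assms R partial_derivs_vanish[of R \<phi>] in \<open>auto simp: test_smooth smooth_partial_derivs\<close>)
qed

lemma test_partial_deriv: "\<phi> \<in> test_functions \<Longrightarrow> partial_deriv i \<phi> \<in> test_functions"
  using test_partial_derivs[of \<phi> "[i]"] by simp

lemma test_linear:
  assumes "f \<in> test_functions" "g \<in> test_functions"
  shows "(\<lambda>x. a * f x + b * g x) \<in> test_functions"
proof -
  have "bounded ({x. f x \<noteq> 0} \<union> {x. g x \<noteq> 0})" using assms by (simp add: test_functions_iff)
  hence "bounded {x. a * f x + b * g x \<noteq> 0}" by (rule bounded_subset) auto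
  thus ?thesis using assms by (simp add: test_functions_iff smooth_linear)
qed

lemma test_zero: "(\<lambda>x. 0) \<in> test_functions"
  by (simp add: test_functions_iff smooth_def partial_derivs_zero)

lemma test_cmult: "f \<in> test_functions \<Longrightarrow> (\<lambda>x. a * f x) \<in> test_functions"
  using test_linear[of f "\<lambda>x. 0" a 0] by (simp add: test_zero)

lemma test_affine:
  assumes "\<phi> \<in> test_functions" "c \<noteq> 0"
  shows "(\<lambda>x. \<phi> (c *\<^sub>R x + b)) \<in> test_functions"
proof -
  obtain R where R: "R > 0" "\<And>x. norm x > R \<Longrightarrow> \<phi> x = 0" using test_support_ball[OF assms(1)] by blast
  show ?thesis
  proof (rule test_functionsI_ball[where R = "(R + norm b) / \<bar>c\<bar>"])
    show "smooth (\<lambda>x. \<phi> (c *\<^sub>R x + b))" using assms by (simp add: test_smooth smooth_affine)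
    fix x :: "real^'a" assume "(R + norm b) / \<bar>c\<bar> < norm x"
    hence "R + norm b < norm (c *\<^sub>R x)" using assms(2) by (simp add: field_simps)
    also have "\<dots> \<le> norm (c *\<^sub>R x + b) + norm b" by (metis add_diff_cancel norm_triangle_ineq4)
    finally show "\<phi> (c *\<^sub>R x + b) = 0" using R(2) by simp
  qed
qed

lemma test_bounded:
  assumes "\<phi> \<in> test_functions"
  obtains B where "B > 0" "\<And>x. norm (\<phi> x) \<le> B"
proof -
  obtain R where R: "R > 0" "\<And>x. norm x > R \<Longrightarrow> \<phi> x = 0" using test_support_ball[OF assms] by blast
  have "compact (\<phi> ` cball 0 R)"
    using assms by (intro compact_continuous_image smooth_continuous_on test_smooth) auto
  hence "bounded (\<phi> ` cball 0 R)" by (rule compact_imp_bounded)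
  then obtain B where B: "B > 0" "\<And>x. x \<in> cball 0 R \<Longrightarrow> norm (\<phi> x) \<le> B"
    unfolding bounded_pos by blast
  have "norm (\<phi> x) \<le> B" for x
    using B(1) B(2)[of x] R(2)[of x] by (cases "norm x > R") auto
  thus ?thesis using that B(1) by blast
qed

lemma test_Lipschitz:
  assumes "\<phi> \<in> test_functions"
  obtains L where "L > 0" "\<And>x y. norm (\<phi> x - \<phi> y) \<le> L * norm (x - y)"
proof -
  have "\<exists>B. \<forall>i. 0 < B i \<and> (\<forall>x. norm (partial_deriv i \<phi> x) \<le> B i)"
    by (intro choice allI) (rule test_bounded[OF test_partial_deriv[OF assms]], blast)
  then obtain B where B: "\<And>i. 0 < B i" "\<And>i x. norm (partial_deriv i \<phi> x) \<le> B i" by blast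
  have der: "(\<phi> has_derivative (\<lambda>h. \<Sum>i\<in>UNIV. (h $ i) *\<^sub>R partial_deriv i \<phi> x)) (at x)" for x
    by (rule smooth_has_derivative[OF test_smooth[OF assms]])
  have "norm (\<phi> x - \<phi> y) \<le> (\<Sum>i\<in>UNIV. B i) * norm (x - y)" for x y
  proof (rule differentiable_bound[of UNIV \<phi> "\<lambda>x h. \<Sum>i\<in>UNIV. (h $ i) *\<^sub>R partial_deriv i \<phi> x"])
    fix x
    show "(\<phi> has_derivative (\<lambda>h. \<Sum>i\<in>UNIV. (h $ i) *\<^sub>R partial_deriv i \<phi> x)) (at x within UNIV)"
      by (rule der)
    show "onorm (\<lambda>h. \<Sum>i\<in>UNIV. (h $ i) *\<^sub>R partial_deriv i \<phi> x) \<le> (\<Sum>i\<in>UNIV. B i)"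
    proof (rule onorm_le)
      fix h :: "real^'a"
      have "norm (\<Sum>i\<in>UNIV. (h $ i) *\<^sub>R partial_deriv i \<phi> x) \<le> (\<Sum>i\<in>UNIV. norm h * B i)"
        using B(2) by (intro sum_norm_le) (auto intro!: mult_mono simp: component_le_norm_cart)
      thus "norm (\<Sum>i\<in>UNIV. (h $ i) *\<^sub>R partial_deriv i \<phi> x) \<le> (\<Sum>i\<in>UNIV. B i) * norm h"
        by (simp add: sum_distrib_left mult.commute)
    qed
  qed auto
  moreover have "(\<Sum>i\<in>UNIV. B i) > 0" using B(1) by (intro sum_pos) auto
  ultimately show ?thesis using that by blast
qed

text \<open>The remainder is quadratic uniformly in \<open>x\<close>. This uniformity is what permits differentiation
  under an integral against a function that is merely integrable (\<open>corr_has_derivative\<close>).\<close>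

lemma test_Taylor:
  assumes "\<phi> \<in> test_functions"
  obtains M where "M > 0"
    "\<And>x h. norm (\<phi> (x + h) - \<phi> x - (\<Sum>i\<in>UNIV. (h $ i) *\<^sub>R partial_deriv i \<phi> x)) \<le> M * (norm h)\<^sup>2"
proof -
  have "\<exists>L. \<forall>i. 0 < L i \<and> (\<forall>x y. norm (partial_deriv i \<phi> x - partial_deriv i \<phi> y) \<le> L i * norm (x - y))"
    by (intro choice allI) (rule test_Lipschitz[OF test_partial_deriv[OF assms]], blast)
  then obtain L where L: "\<And>i. 0 < L i" 
    "\<And>i x y. norm (partial_deriv i \<phi> x - partial_deriv i \<phi> y) \<le> L i * norm (x - y)" by blast
  have der: "(\<phi> has_derivative (\<lambda>h. \<Sum>i\<in>UNIV. (h $ i) *\<^sub>R partial_deriv i \<phi> x)) (at x)" for x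
    by (rule smooth_has_derivative[OF test_smooth[OF assms]])
  have "norm (\<phi> (x + h) - \<phi> x - (\<Sum>i\<in>UNIV. (h $ i) *\<^sub>R partial_deriv i \<phi> x)) \<le> (\<Sum>i\<in>UNIV. L i) * (norm h)\<^sup>2" for x h
  proof -
    let ?g = "\<lambda>y. \<phi> (x + y) - (\<Sum>i\<in>UNIV. (y $ i) *\<^sub>R partial_deriv i \<phi> x)"
    let ?g' = "\<lambda>y k. (\<Sum>i\<in>UNIV. (k $ i) *\<^sub>R partial_deriv i \<phi> (x + y)) - (\<Sum>i\<in>UNIV. (k $ i) *\<^sub>R partial_deriv i \<phi> x)"
    have "norm (?g h - ?g 0) \<le> ((\<Sum>i\<in>UNIV. L i) * norm h) * norm (h - 0)"
    proof (rule differentiable_bound[of "cball 0 (norm h)" ?g ?g'])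
      fix y :: "real^'a" assume y: "y \<in> cball 0 (norm h)"
      have 1: "((\<lambda>y. x + y) has_derivative (\<lambda>k. k)) (at y)" by (auto intro!: derivative_eq_intros)
      have 2: "((\<lambda>y. \<phi> (x + y)) has_derivative (\<lambda>k. \<Sum>i\<in>UNIV. (k $ i) *\<^sub>R partial_deriv i \<phi> (x + y))) (at y)"
        using diff_chain_at[OF 1 der[of "x + y"]] by (simp add: o_def)
      have 3: "((\<lambda>y::real^'a. \<Sum>i\<in>UNIV. (y $ i) *\<^sub>R partial_deriv i \<phi> x) has_derivative 
           (\<lambda>k. \<Sum>i\<in>UNIV. (k $ i) *\<^sub>R partial_deriv i \<phi> x)) (at y)"
        by (rule has_derivative_sum)
           (rule has_derivative_scaleR_left[OF bounded_linear_imp_has_derivative[OF bounded_linear_vec_nth]])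
      show "(?g has_derivative ?g' y) (at y within cball 0 (norm h))"
        by (rule has_derivative_at_withinI[OF has_derivative_diff[OF 2 3]])
      show "onorm (?g' y) \<le> (\<Sum>i\<in>UNIV. L i) * norm h"
      proof (rule onorm_le)
        fix k :: "real^'a"
        have "norm (?g' y k) = norm (\<Sum>i\<in>UNIV. (k $ i) *\<^sub>R (partial_deriv i \<phi> (x + y) - partial_deriv i \<phi> x))"
          by (simp add: sum_subtractf scaleR_diff_right)
        also have "\<dots> \<le> (\<Sum>i\<in>UNIV. norm k * (L i * norm h))"
        proof (rule sum_norm_le)
          fix i
          have "norm (partial_deriv i \<phi> (x + y) - partial_deriv i \<phi> x) \<le> L i * norm h"
            using L(2)[of i "x+y" x] y L(1)[of i] by (auto elim!: order_trans intro!: mult_left_mono)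
          thus "norm ((k $ i) *\<^sub>R (partial_deriv i \<phi> (x + y) - partial_deriv i \<phi> x)) \<le> norm k * (L i * norm h)"
            using component_le_norm_cart[of k i] by (auto intro!: mult_mono)
        qed
        also have "\<dots> = ((\<Sum>i\<in>UNIV. L i) * norm h) * norm k"
          by (simp add: sum_distrib_left sum_distrib_right algebra_simps)
        finally show "norm (?g' y k) \<le> (\<Sum>i\<in>UNIV. L i) * norm h * norm k" .
      qed
    qed auto
    thus ?thesis by (simp add: algebra_simps power2_eq_square)
  qed
  moreover have "(\<Sum>i\<in>UNIV. L i) > 0" using L(1) by (intro sum_pos) auto
  ultimately show ?thesis using that by blast
qed

text \<open>A real supremum says nothing unless it is bounded. Here only finitely many derivatives occur,
  each of them continuous with compact support.\<close>

lemma C_norm_bdd: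
  fixes \<phi> :: "real^'n \<Rightarrow> complex"
  assumes "\<phi> \<in> test_functions"
  shows "bdd_above ((\<lambda>(is, x). norm (partial_derivs is \<phi> x)) ` ({is. length is \<le> N} \<times> UNIV))"
proof -
  have "\<exists>B. \<forall>is. \<forall>x. norm (partial_derivs is \<phi> x) \<le> B is"
    by (intro choice allI) (rule test_bounded[OF test_partial_derivs[OF assms]], blast)
  then obtain B where B: "\<And>is x. norm (partial_derivs is \<phi> x) \<le> B is" by blast
  have fin: "finite {is :: 'n list. length is \<le> N}" 
    using finite_lists_length_le[of "UNIV :: 'n set" N] by simp
  show ?thesis
  proof (rule bdd_aboveI2)
    fix z :: "'n list \<times> (real^'n)" assume z: "z \<in> {is. length is \<le> N} \<times> UNIV"
    hence "norm (partial_derivs (fst z) \<phi> (snd z)) \<le> Max (B ` {is. length is \<le> N})"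
      by (intro order_trans[OF B] Max_ge) (auto intro: fin)
    thus "(\<lambda>(is, x). norm (partial_derivs is \<phi> x)) z \<le> Max (B ` {is. length is \<le> N})" by (auto simp: split_beta)
  qed
qed

lemma norm_le_C_norm:
  assumes "\<phi> \<in> test_functions" "length is \<le> N"
  shows "norm (partial_derivs is \<phi> x) \<le> C_norm N \<phi>"
proof -
  have "(is, x) \<in> {is. length is \<le> N} \<times> UNIV" using assms(2) by simp
  from cSUP_upper[OF this C_norm_bdd[OF assms(1)]] show ?thesis by (simp add: C_norm_def)
qed

lemma C_norm_leI:
  assumes "\<And>is x. length is \<le> N \<Longrightarrow> norm (partial_derivs is \<phi> x) \<le> M"
  shows "C_norm N \<phi> \<le> M"
  unfolding C_norm_def by (rule cSUP_least, rule ex_in_conv[THEN iffD1], rule exI[of _ "([], 0)"]) (use assms in auto)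

lemma C_norm_nonneg: "\<phi> \<in> test_functions \<Longrightarrow> C_norm N \<phi> \<ge> 0"
  by (rule order_trans[OF norm_ge_zero norm_le_C_norm[of \<phi> "[]"]]) auto

section \<open>Correlation with an integrable function\<close>

text \<open>Both the dual of the fractional integral and the superpositions of translates in
  \<open>distribution_corr\<close> have this form. All regularity comes from the second argument, which makes
  the first one free to be singular.\<close>

definition corr :: "(real^'n \<Rightarrow> complex) \<Rightarrow> (real^'n \<Rightarrow> complex) \<Rightarrow> real^'n \<Rightarrow> complex" where
  "corr k \<phi> x = (LINT y|lebesgue. k y * \<phi> (x + y))"

lemma continuous_lebesgue_measurable:
  assumes "continuous_on UNIV f" shows "f \<in> borel_measurable lebesgue"
  by (rule measurable_completion) (use borel_measurable_continuous_onI[OF assms] in simp)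

lemma test_continuous: "\<phi> \<in> test_functions \<Longrightarrow> continuous_on S \<phi>"
  by (intro smooth_continuous_on test_smooth)

lemma integrable_mult_bounded:
  fixes k u :: "real^'n \<Rightarrow> complex"
  assumes k: "integrable lebesgue k" and u: "u \<in> borel_measurable lebesgue" "\<And>y. norm (u y) \<le> B"
  shows "integrable lebesgue (\<lambda>y. k y * u y)"
    and "norm (LINT y|lebesgue. k y * u y) \<le> B * (LINT y|lebesgue. norm (k y))"
proof -
  have bd: "norm (k y * u y) \<le> B * norm (k y)" for y
    using mult_left_mono[OF u(2)[of y] norm_ge_zero[of "k y"]] by (simp add: norm_mult mult.commute)
  have int: "integrable lebesgue (\<lambda>y. B * norm (k y))" using k by simp
  have [measurable]: "k \<in> borel_measurable lebesgue" "u \<in> borel_measurable lebesgue" using k u by auto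
  show "integrable lebesgue (\<lambda>y. k y * u y)"
    by (rule Bochner_Integration.integrable_bound[OF int]) (auto intro!: AE_I2 order_trans[OF bd])
  have "norm (LINT y|lebesgue. k y * u y) \<le> (LINT y|lebesgue. B * norm (k y))"
    using int bd \<open>integrable lebesgue (\<lambda>y. k y * u y)\<close>
    by (intro order_trans[OF integral_norm_bound Bochner_Integration.integral_mono]) auto
  thus "norm (LINT y|lebesgue. k y * u y) \<le> B * (LINT y|lebesgue. norm (k y))" by simp
qed

lemma translate_measurable:
  "\<phi> \<in> test_functions \<Longrightarrow> (\<lambda>y. \<phi> (x + y)) \<in> borel_measurable lebesgue"
  by (intro continuous_lebesgue_measurable continuous_on_compose2[OF test_continuous[of _ UNIV]]
      continuous_intros) auto

lemma corr_integrable: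
  assumes "integrable lebesgue k" "\<phi> \<in> test_functions"
  shows "integrable lebesgue (\<lambda>y. k y * \<phi> (x + y))"
proof -
  obtain B where "\<And>x. norm (\<phi> x) \<le> B" using test_bounded[OF assms(2)] by blast
  thus ?thesis by (intro integrable_mult_bounded(1)[where B = B] assms translate_measurable)
qed

lemma corr_bound:
  assumes "integrable lebesgue k" "\<phi> \<in> test_functions" "\<And>x. norm (\<phi> x) \<le> B"
  shows "norm (corr k \<phi> x) \<le> B * (LINT y|lebesgue. norm (k y))"
  unfolding corr_def by (intro integrable_mult_bounded(2) assms translate_measurable)

text \<open>Integrating the uniform Taylor remainder of \<open>\<phi>\<close> against \<open>|k|\<close> leaves an error that is still
  quadratic in the increment.\<close>

lemma corr_has_derivative:
  assumes k: "integrable lebesgue k" and \<phi>: "\<phi> \<in> test_functions"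
  shows "(corr k \<phi> has_derivative (\<lambda>h. \<Sum>i\<in>UNIV. (h $ i) *\<^sub>R corr k (partial_deriv i \<phi>) x)) (at x)"
proof -
  obtain M where M: "M > 0"
    "\<And>x h. norm (\<phi> (x + h) - \<phi> x - (\<Sum>i\<in>UNIV. (h $ i) *\<^sub>R partial_deriv i \<phi> x)) \<le> M * (norm h)\<^sup>2"
    using test_Taylor[OF \<phi>] by blast
  let ?D = "\<lambda>h. \<Sum>i\<in>UNIV. (h $ i) *\<^sub>R corr k (partial_deriv i \<phi>) x"
  let ?K = "LINT y|lebesgue. norm (k y)"
  have est: "norm (corr k \<phi> (x + h) - corr k \<phi> x - ?D h) \<le> (M * (norm h)\<^sup>2) * ?K" for h
  proof -
    let ?u = "\<lambda>y. \<phi> (x + y + h) - \<phi> (x + y) - (\<Sum>i\<in>UNIV. (h $ i) *\<^sub>R partial_deriv i \<phi> (x + y))"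
    have i: "integrable lebesgue (\<lambda>y. k y * partial_deriv i \<phi> (x + y))" for i
      by (rule corr_integrable[OF k test_partial_deriv[OF \<phi>]])
    have "corr k \<phi> (x + h) - corr k \<phi> x - ?D h =
        (LINT y|lebesgue. k y * \<phi> (x + h + y)) - (LINT y|lebesgue. k y * \<phi> (x + y))
         - (LINT y|lebesgue. (\<Sum>i\<in>UNIV. (h $ i) *\<^sub>R (k y * partial_deriv i \<phi> (x + y))))"
      by (simp add: corr_def Bochner_Integration.integral_sum i)
    also have "\<dots> = (LINT y|lebesgue. k y * \<phi> (x + h + y) - k y * \<phi> (x + y)
         - (\<Sum>i\<in>UNIV. (h $ i) *\<^sub>R (k y * partial_deriv i \<phi> (x + y))))"
      using corr_integrable[OF k \<phi>] i
      by (subst Bochner_Integration.integral_diff, simp, simp)+ simp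
    also have "\<dots> = (LINT y|lebesgue. k y * ?u y)"
      by (intro Bochner_Integration.integral_cong)
         (auto simp: algebra_simps sum_distrib_left)
    finally have eq: "corr k \<phi> (x + h) - corr k \<phi> x - ?D h = (LINT y|lebesgue. k y * ?u y)" .
    show ?thesis unfolding eq
    proof (rule integrable_mult_bounded(2)[OF k])
      have 1: "(\<lambda>y. \<phi> (x + y + h)) \<in> borel_measurable lebesgue"
        using translate_measurable[OF \<phi>, of "x + h"] by (simp add: ac_simps)
      show "?u \<in> borel_measurable lebesgue"
        by (intro borel_measurable_diff borel_measurable_sum borel_measurable_scaleR 1
            borel_measurable_const translate_measurable \<phi> test_partial_deriv)
      show "norm (?u y) \<le> M * (norm h)\<^sup>2" for y by (rule M(2))
    qed
  qed
  have lin: "bounded_linear ?D"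
    by (intro bounded_linear_sum bounded_linear_compose[OF bounded_linear_scaleR_left bounded_linear_vec_nth])
  show ?thesis unfolding has_derivative_at
  proof (intro conjI lin)
    have K0: "?K \<ge> 0" by simp
    show "(\<lambda>h. norm (corr k \<phi> (x + h) - corr k \<phi> x - ?D h) / norm h) \<midarrow>0\<rightarrow> 0"
    proof (rule tendsto_sandwich[of "\<lambda>_. 0" _ _ "\<lambda>h. M * ?K * norm h"])
      show "\<forall>\<^sub>F h in at 0. norm (corr k \<phi> (x + h) - corr k \<phi> x - ?D h) / norm h \<le> M * ?K * norm h"
      proof (rule eventually_at_filter[THEN iffD2], rule always_eventually, intro allI impI)
        fix h :: "real^'a" assume "h \<noteq> 0"
        thus "norm (corr k \<phi> (x + h) - corr k \<phi> x - ?D h) / norm h \<le> M * ?K * norm h"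
          using est[of h] by (simp add: field_simps power2_eq_square)
      qed
      have "((\<lambda>h::real^'a. M * ?K * norm h) \<longlongrightarrow> M * ?K * norm (0::real^'a)) (at 0)"
        by (intro tendsto_intros)
      thus "((\<lambda>h::real^'a. M * ?K * norm h) \<longlongrightarrow> 0) (at 0)" by simp
    qed auto
  qed
qed

lemma partial_deriv_corr:
  assumes "integrable lebesgue k" "\<phi> \<in> test_functions"
  shows "partial_deriv i (corr k \<phi>) = corr k (partial_deriv i \<phi>)"
proof
  fix x
  have "partial_deriv i (corr k \<phi>) x = (\<Sum>j\<in>UNIV. (axis i (1::real) $ j) *\<^sub>R corr k (partial_deriv j \<phi>) x)"
    by (rule partial_deriv_eq[OF corr_has_derivative[OF assms]])
  also have "\<dots> = (\<Sum>j\<in>UNIV. if j = i then corr k (partial_deriv j \<phi>) x else 0)"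
    by (intro sum.cong) (auto simp: axis_def)
  finally show "partial_deriv i (corr k \<phi>) x = corr k (partial_deriv i \<phi>) x" by simp
qed

lemma partial_derivs_corr:
  assumes "integrable lebesgue k" "\<phi> \<in> test_functions"
  shows "partial_derivs is (corr k \<phi>) = corr k (partial_derivs is \<phi>)"
  by (induction "is") (simp_all add: partial_deriv_corr assms test_partial_derivs)

lemma smooth_corr:
  assumes "integrable lebesgue k" "\<phi> \<in> test_functions"
  shows "smooth (corr k \<phi>)"
  unfolding smooth_def partial_derivs_corr[OF assms] differentiable_on_def differentiable_def
  using corr_has_derivative[OF assms(1) test_partial_derivs[OF assms(2)]] by blast

lemma corr_support:
  assumes "\<And>y. norm y > R \<Longrightarrow> k y = 0" "\<And>x. norm x > S \<Longrightarrow> \<phi> x = 0" "norm x > R + S"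
  shows "corr k \<phi> x = 0"
proof -
  have "k y * \<phi> (x + y) = 0" for y
  proof (cases "norm y > R")
    case False
    have "norm x \<le> norm (x + y) + norm y" by (metis add_diff_cancel norm_triangle_ineq4)
    hence "norm (x + y) > S" using False assms(3) by simp
    thus ?thesis using assms(2) by simp
  qed (use assms(1) in auto)
  hence "(\<lambda>y. k y * \<phi> (x + y)) = (\<lambda>y. 0)" by (rule ext)
  thus ?thesis unfolding corr_def by (metis Bochner_Integration.integral_zero)
qed

lemma test_corr:
  assumes "integrable lebesgue k" "\<phi> \<in> test_functions" "\<And>y. norm y > R \<Longrightarrow> k y = 0"
  shows "corr k \<phi> \<in> test_functions"
proof -
  obtain S where S: "\<And>x. norm x > S \<Longrightarrow> \<phi> x = 0" using test_support_ball[OF assms(2)] by blast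
  show ?thesis
    by (rule test_functionsI_ball[where R = "R + S"])
       (use assms smooth_corr corr_support[of R k S \<phi>] S in auto)
qed

text \<open>Derivatives fall on \<open>\<phi>\<close> only, so the \<open>L\<^sup>1\<close> norm of \<open>k\<close> controls the correlation in every \<open>C\<^sup>N\<close> norm;
  this makes \<open>L\<^sup>1\<close> convergence of kernels visible to distributions.\<close>

lemma C_norm_corr:
  assumes "integrable lebesgue k" "\<phi> \<in> test_functions"
  shows "C_norm N (corr k \<phi>) \<le> C_norm N \<phi> * (LINT y|lebesgue. norm (k y))"
  by (rule C_norm_leI)
     (auto simp: partial_derivs_corr assms intro!: corr_bound test_partial_derivs norm_le_C_norm)

lemma corr_diff_left:
  assumes "integrable lebesgue k" "integrable lebesgue l" "\<phi> \<in> test_functions"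
  shows "corr (\<lambda>y. k y - l y) \<phi> x = corr k \<phi> x - corr l \<phi> x"
  using corr_integrable[OF assms(1,3)] corr_integrable[OF assms(2,3)]
  by (simp add: corr_def left_diff_distrib)

lemma corr_add_left:
  assumes "integrable lebesgue k" "integrable lebesgue l" "\<phi> \<in> test_functions"
  shows "corr (\<lambda>y. k y + l y) \<phi> x = corr k \<phi> x + corr l \<phi> x"
  using corr_integrable[OF assms(1,3)] corr_integrable[OF assms(2,3)]
  by (simp add: corr_def distrib_right)

section \<open>Interchanging a distribution with an integral\<close>

lemma distribution_linear:
  assumes "f \<in> distributions" "\<phi> \<in> test_functions" "\<psi> \<in> test_functions"
  shows "f (\<lambda>x. a * \<phi> x + b * \<psi> x) = a * f \<phi> + b * f \<psi>"
  using assms unfolding distributions_def by blast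

lemma distribution_diff:
  assumes "f \<in> distributions" "\<phi> \<in> test_functions" "\<psi> \<in> test_functions"
  shows "f (\<lambda>x. \<phi> x - b * \<psi> x) = f \<phi> - b * f \<psi>"
  using distribution_linear[OF assms, of 1 "-b"] by simp

lemma distribution_cmult:
  assumes "f \<in> distributions" "\<phi> \<in> test_functions"
  shows "f (\<lambda>x. a * \<phi> x) = a * f \<phi>"
  using distribution_linear[OF assms(1,2) test_zero, of a 0] by simp

text \<open>Continuity on the test functions supported in a ball, with the support condition in pointwise
  form.\<close>

lemma distribution_bound:
  assumes "f \<in> distributions"
  obtains C N where "C > 0"
    "\<forall>\<phi>\<in>test_functions. (\<forall>x. norm x > R \<longrightarrow> \<phi> x = 0) \<longrightarrow> norm (f \<phi>) \<le> C * C_norm N \<phi>"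
proof -
  have "compact (cball (0::real^'a) R)" by simp
  moreover have "\<forall>K. compact K \<longrightarrow> (\<exists>C N. \<forall>\<phi>\<in>test_functions. supp \<phi> \<subseteq> K \<longrightarrow>
        norm (f \<phi>) \<le> C * C_norm N \<phi>)"
    using assms unfolding distributions_def by simp
  ultimately have "\<exists>C N. \<forall>\<phi>\<in>test_functions. supp \<phi> \<subseteq> cball 0 R \<longrightarrow>
        norm (f \<phi>) \<le> C * C_norm N \<phi>" by blast
  then obtain C N where "\<forall>\<phi>\<in>test_functions. supp \<phi> \<subseteq> cball 0 R \<longrightarrow>
        norm (f \<phi>) \<le> C * C_norm N \<phi>" by blast
  hence CN: "\<And>\<phi>. \<phi> \<in> test_functions \<Longrightarrow> supp \<phi> \<subseteq> cball 0 R \<Longrightarrow> norm (f \<phi>) \<le> C * C_norm N \<phi>"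
    by blast
  have *: "norm (f \<phi>) \<le> (\<bar>C\<bar> + 1) * C_norm N \<phi>"
    if "\<phi> \<in> test_functions" "\<And>x. norm x > R \<Longrightarrow> \<phi> x = 0" for \<phi>
  proof -
    have "supp \<phi> \<subseteq> cball 0 R" by (rule supp_subset) (use that(2) in force)+
    hence "norm (f \<phi>) \<le> C * C_norm N \<phi>" by (rule CN[OF that(1)])
    also have "\<dots> \<le> (\<bar>C\<bar> + 1) * C_norm N \<phi>"
      by (intro mult_right_mono C_norm_nonneg that) auto
    finally show ?thesis .
  qed
  show ?thesis by (rule that[of "\<bar>C\<bar> + 1" N]) (use * in auto)
qed

lemma test_translate: "\<phi> \<in> test_functions \<Longrightarrow> (\<lambda>x. \<phi> (x + y)) \<in> test_functions"
  using test_affine[of \<phi> 1 y] by simp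

lemma partial_derivs_translate:
  "\<phi> \<in> test_functions \<Longrightarrow> partial_derivs is (\<lambda>x. \<phi> (x + y)) = (\<lambda>x. partial_derivs is \<phi> (x + y))"
  using partial_derivs_affine[OF test_smooth, of \<phi> "is" 1 y] by simp

lemma partial_derivs_Lipschitz:
  fixes \<phi> :: "real^'n \<Rightarrow> complex"
  assumes "\<phi> \<in> test_functions"
  obtains L where "L > 0"
    "\<And>is x y. length is \<le> N \<Longrightarrow>
       norm (partial_derivs is \<phi> x - partial_derivs is \<phi> y) \<le> L * norm (x - y)"
proof -
  have "\<exists>L. \<forall>is. 0 < L is \<and> (\<forall>x y. norm (partial_derivs is \<phi> x - partial_derivs is \<phi> y) \<le> L is * norm (x - y))"
    by (intro choice allI) (rule test_Lipschitz[OF test_partial_derivs[OF assms]], blast)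
  then obtain L where L: "\<And>is. 0 < L is"
    "\<And>is x y. norm (partial_derivs is \<phi> x - partial_derivs is \<phi> y) \<le> L is * norm (x - y)" by blast
  let ?A = "{is :: 'n list. length is \<le> N}"
  have fin: "finite ?A" using finite_lists_length_le[of "UNIV :: 'n set" N] by simp
  have le: "L is \<le> sum L ?A" if "length is \<le> N" for "is"
    by (rule member_le_sum) (use that L(1) fin in \<open>auto intro: less_imp_le\<close>)
  show ?thesis
  proof (rule that[of "sum L ?A"])
    show "0 < sum L ?A" using L(1)[of "[]"] le[of "[]"] by simp
    fix "is" :: "'n list" and x y assume "length is \<le> N"
    thus "norm (partial_derivs is \<phi> x - partial_derivs is \<phi> y) \<le> sum L ?A * norm (x - y)"
      by (intro order_trans[OF L(2)] mult_right_mono le) auto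
  qed
qed

text \<open>The derivatives of \<open>\<eta>\<close> up to the order of \<open>f\<close> on the relevant ball share a Lipschitz constant. So
  the translates of \<open>\<eta>\<close> by nearby vectors are close in the seminorm that bounds \<open>f\<close>, and a
  superposition of translates by vectors close to \<open>z\<close> is nearly a multiple of the translate by \<open>z\<close>.
  The second error is proportional to \<open>\<integral>|g|\<close>, which makes it additive over pieces of \<open>g\<close>.\<close>

lemma distribution_localized:
  assumes f: "f \<in> distributions" and \<eta>: "\<eta> \<in> test_functions"
  shows "\<exists>L>0. (\<forall>y y'. norm y \<le> R \<longrightarrow> norm y' \<le> R \<longrightarrow>
       norm (f (\<lambda>x. \<eta> (x + y)) - f (\<lambda>x. \<eta> (x + y'))) \<le> L * norm (y - y')) \<and>
    (\<forall>g z \<delta>. integrable lebesgue g \<longrightarrow> norm z \<le> R \<longrightarrow> \<delta> \<ge> 0 \<longrightarrow>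
       (\<forall>y. g y \<noteq> 0 \<longrightarrow> norm y \<le> R \<and> norm (y - z) \<le> \<delta>) \<longrightarrow>
       norm (f (corr g \<eta>) - (LINT y|lebesgue. g y) * f (\<lambda>x. \<eta> (x + z))) \<le> L * \<delta> * (LINT y|lebesgue. norm (g y)))"
proof -
  obtain S where S: "\<And>x. norm x > S \<Longrightarrow> \<eta> x = 0" using test_support_ball[OF \<eta>] by blast
  obtain C N where C: "C > 0" "\<forall>\<phi>\<in>test_functions. (\<forall>x. norm x > R + S \<longrightarrow> \<phi> x = 0) \<longrightarrow>
      norm (f \<phi>) \<le> C * C_norm N \<phi>"
    using distribution_bound[OF f, of "R + S"] by blast
  obtain L where L: "L > 0" "\<And>is x y. length is \<le> N \<Longrightarrow>
       norm (partial_derivs is \<eta> x - partial_derivs is \<eta> y) \<le> L * norm (x - y)"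
    using partial_derivs_Lipschitz[OF \<eta>] by blast
  have tsupp: "\<eta> (x + y) = 0" if "norm x > R + S" "norm y \<le> R" for x y
  proof -
    have "norm x \<le> norm (x + y) + norm y" by (metis add_diff_cancel norm_triangle_ineq4)
    thus ?thesis using that S by simp
  qed
  show ?thesis
  proof (intro exI[of _ "C * L"] conjI allI impI)
    show "C * L > 0" using C(1) L(1) by simp
  next
    fix y y' :: "real^'a" assume y: "norm y \<le> R" "norm y' \<le> R"
    let ?\<phi> = "\<lambda>x. \<eta> (x + y) - 1 * \<eta> (x + y')"
    have t: "?\<phi> \<in> test_functions" 
      using test_linear[OF test_translate[OF \<eta>, of y] test_translate[OF \<eta>, of y'], of 1 "-1"] by simp
    have "f (\<lambda>x. \<eta> (x + y)) - f (\<lambda>x. \<eta> (x + y')) = f ?\<phi>"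
      using distribution_diff[OF f test_translate[OF \<eta>, of y] test_translate[OF \<eta>, of y'], of 1] by simp
    also have "norm \<dots> \<le> C * C_norm N ?\<phi>" by (rule C(2)[rule_format, OF t]) (use tsupp y in auto)
    also have "C_norm N ?\<phi> \<le> L * norm (y - y')"
    proof (rule C_norm_leI)
      fix "is" :: "'a list" and x assume len: "length is \<le> N"
      have "partial_derivs is ?\<phi> x = partial_derivs is \<eta> (x + y) - partial_derivs is \<eta> (x + y')"
        using partial_derivs_linear[OF test_smooth[OF test_translate[OF \<eta>, of y]] 
            test_smooth[OF test_translate[OF \<eta>, of y']], of "is" 1 "-1"]
        by (simp add: partial_derivs_translate[OF \<eta>])
      thus "norm (partial_derivs is ?\<phi> x) \<le> L * norm (y - y')" using L(2)[OF len, of "x + y" "x + y'"] by simp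
    qed
    finally show "norm (f (\<lambda>x. \<eta> (x + y)) - f (\<lambda>x. \<eta> (x + y'))) \<le> C * L * norm (y - y')"
      using C(1) by (simp add: mult.assoc)
  next
    fix g :: "real^'a \<Rightarrow> complex" and z \<delta>
    assume g: "integrable lebesgue g" and z: "norm z \<le> R" and d: "\<delta> \<ge> 0"
      and "\<forall>y. g y \<noteq> 0 \<longrightarrow> norm y \<le> R \<and> norm (y - z) \<le> \<delta>"
    hence gs: "\<And>y. g y \<noteq> 0 \<Longrightarrow> norm y \<le> R \<and> norm (y - z) \<le> \<delta>" by blast
    let ?I = "LINT y|lebesgue. g y" let ?K = "LINT y|lebesgue. norm (g y)"
    let ?\<phi> = "\<lambda>x. corr g \<eta> x - ?I * \<eta> (x + z)"
    have g0: "\<And>y. norm y > R \<Longrightarrow> g y = 0" using gs by force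
    have tc: "corr g \<eta> \<in> test_functions" by (rule test_corr[OF g \<eta> g0])
    have t: "?\<phi> \<in> test_functions"
      using test_linear[OF tc test_translate[OF \<eta>, of z], of 1 "- ?I"] by simp
    have "f (corr g \<eta>) - ?I * f (\<lambda>x. \<eta> (x + z)) = f ?\<phi>"
      using distribution_diff[OF f tc test_translate[OF \<eta>, of z]] by simp
    also have "norm \<dots> \<le> C * C_norm N ?\<phi>"
      by (rule C(2)[rule_format, OF t]) (use tsupp z corr_support[OF g0 S] in auto)
    also have "C_norm N ?\<phi> \<le> (L * \<delta>) * ?K"
    proof (rule C_norm_leI)
      fix "is" :: "'a list" and x assume len: "length is \<le> N"
      let ?\<zeta> = "partial_derivs is \<eta>"
      have \<zeta>: "?\<zeta> \<in> test_functions" by (rule test_partial_derivs[OF \<eta>])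
      have "partial_derivs is ?\<phi> x = corr g ?\<zeta> x - ?I * ?\<zeta> (x + z)"
        using partial_derivs_linear[OF test_smooth[OF tc] 
            test_smooth[OF test_translate[OF \<eta>, of z]], of "is" 1 "-?I"]
        by (simp add: partial_derivs_translate[OF \<eta>] partial_derivs_corr[OF g \<eta>])
      also have "\<dots> = (LINT y|lebesgue. g y * (?\<zeta> (x + y) - ?\<zeta> (x + z)))"
        using corr_integrable[OF g \<zeta>] g by (simp add: corr_def right_diff_distrib)
      also have "\<dots> = (LINT y|lebesgue. g y * (indicator {y. norm (y - z) \<le> \<delta>} y *\<^sub>R (?\<zeta> (x + y) - ?\<zeta> (x + z))))"
        by (intro Bochner_Integration.integral_cong) (auto simp: indicator_def dest: gs)
      also have "norm \<dots> \<le> (L * \<delta>) * ?K"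
      proof (rule integrable_mult_bounded(2)[OF g])
        have "{y::real^'a. norm (y - z) \<le> \<delta>} = cball z \<delta>" by (auto simp: dist_norm norm_minus_commute)
        hence [measurable]: "{y::real^'a. norm (y - z) \<le> \<delta>} \<in> sets lebesgue" by simp
        have [measurable]: "(\<lambda>y. ?\<zeta> (x + y)) \<in> borel_measurable lebesgue" by (rule translate_measurable[OF \<zeta>])
        show "(\<lambda>y. indicator {y. norm (y - z) \<le> \<delta>} y *\<^sub>R (?\<zeta> (x + y) - ?\<zeta> (x + z))) \<in> borel_measurable lebesgue"
          by measurable
        fix y
        show "norm (indicator {y. norm (y - z) \<le> \<delta>} y *\<^sub>R (?\<zeta> (x + y) - ?\<zeta> (x + z))) \<le> L * \<delta>"
        proof (cases "norm (y - z) \<le> \<delta>")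
          case True
          have "norm (?\<zeta> (x + y) - ?\<zeta> (x + z)) \<le> L * norm (y - z)" using L(2)[OF len, of "x+y" "x+z"] by simp
          also have "\<dots> \<le> L * \<delta>" using True L(1) by simp
          finally show ?thesis using True by simp
        qed (use L(1) d in simp)
      qed
      finally show "norm (partial_derivs is ?\<phi> x) \<le> L * \<delta> * ?K" .
    qed
    finally show "norm (f (corr g \<eta>) - ?I * f (\<lambda>x. \<eta> (x + z))) \<le> C * L * \<delta> * ?K"
      using C(1) by (simp add: mult.assoc)
  qed
qed

lemma distribution_translate_continuous:
  assumes f: "f \<in> distributions" and \<eta>: "\<eta> \<in> test_functions"
  shows "continuous_on UNIV (\<lambda>y. f (\<lambda>x. \<eta> (x + y)))"
proof -
  have "continuous_on (ball 0 R) (\<lambda>y. f (\<lambda>x. \<eta> (x + y)))" for R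
  proof -
    obtain L where L: "L > 0"
      "\<forall>y y'. norm y \<le> R \<longrightarrow> norm y' \<le> R \<longrightarrow>
       norm (f (\<lambda>x. \<eta> (x + y)) - f (\<lambda>x. \<eta> (x + y'))) \<le> L * norm (y - y')"
      using distribution_localized[OF f \<eta>, of R] by blast
    have "L-lipschitz_on (ball 0 R) (\<lambda>y. f (\<lambda>x. \<eta> (x + y)))"
      using L by (intro lipschitz_onI) (auto simp: dist_norm)
    thus ?thesis by (rule lipschitz_on_continuous_on)
  qed
  hence "isCont (\<lambda>y. f (\<lambda>x. \<eta> (x + y))) y" for y
    by (rule continuous_on_interior[where S = "ball 0 (norm y + 1)"]) simp
  thus ?thesis by (simp add: continuous_at_imp_continuous_on)
qed

text \<open>A distribution may be applied under the integral over translates. The defect of the identity is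
  additive in \<open>g\<close>, and by \<open>distribution_localized\<close> it is at most \<open>2L\<delta> \<integral>|g|\<close> when \<open>g\<close> lives in a ball of
  radius \<open>\<delta>\<close>. Cutting \<open>g\<close> along a finite cover of its support by such balls gives the same bound for
  \<open>g\<close> itself, and \<open>\<delta>\<close> is arbitrary.\<close>

lemma distribution_corr:
  fixes g :: "real^'n \<Rightarrow> complex"
  assumes f: "f \<in> distributions" and \<eta>: "\<eta> \<in> test_functions"
    and g: "integrable lebesgue g" and gR: "\<And>y. norm y > R \<Longrightarrow> g y = 0"
  shows "f (corr g \<eta>) = (LINT y|lebesgue. g y * f (\<lambda>x. \<eta> (x + y)))"
proof -
  let ?F = "\<lambda>y. f (\<lambda>x. \<eta> (x + y))"
  let ?D = "\<lambda>g. f (corr g \<eta>) - (LINT y|lebesgue. g y * ?F y)"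
  obtain L where L: "L > 0"
    "\<forall>y y'. norm y \<le> R \<longrightarrow> norm y' \<le> R \<longrightarrow>
       norm (f (\<lambda>x. \<eta> (x + y)) - f (\<lambda>x. \<eta> (x + y'))) \<le> L * norm (y - y')"
    "\<forall>g z \<delta>. integrable lebesgue g \<longrightarrow> norm z \<le> R \<longrightarrow> \<delta> \<ge> 0 \<longrightarrow>
       (\<forall>y. g y \<noteq> 0 \<longrightarrow> norm y \<le> R \<and> norm (y - z) \<le> \<delta>) \<longrightarrow>
       norm (f (corr g \<eta>) - (LINT y|lebesgue. g y) * f (\<lambda>x. \<eta> (x + z))) \<le> L * \<delta> * (LINT y|lebesgue. norm (g y))"
    using distribution_localized[OF f \<eta>, of R] by blast
  have Fm: "?F \<in> borel_measurable lebesgue"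
    by (rule continuous_lebesgue_measurable[OF distribution_translate_continuous[OF f \<eta>]])
  have "compact (?F ` cball 0 R)"
    by (intro compact_continuous_image continuous_on_subset[OF distribution_translate_continuous[OF f \<eta>]]) auto
  hence "bounded (?F ` cball 0 R)" by (rule compact_imp_bounded)
  then obtain B where B: "B > 0" "\<And>y. norm y \<le> R \<Longrightarrow> norm (?F y) \<le> B" unfolding bounded_pos by auto
  have gF: "integrable lebesgue (\<lambda>y. g y * ?F y)" 
    if g: "integrable lebesgue g" and g0: "\<And>y. norm y > R \<Longrightarrow> g y = 0" for g
  proof -
    have Fi: "(\<lambda>y. indicator (cball 0 R) y *\<^sub>R ?F y) \<in> borel_measurable lebesgue"
      by (intro borel_measurable_scaleR borel_measurable_indicator Fm) simp
    have "integrable lebesgue (\<lambda>y. g y * (indicator (cball 0 R) y *\<^sub>R ?F y))"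
      by (rule integrable_mult_bounded(1)[OF g Fi, where B = B]) (use B in \<open>simp add: indicator_def\<close>)
    moreover have "g y * (indicator (cball 0 R) y *\<^sub>R ?F y) = g y * ?F y" for y
      using g0[of y] by (auto simp: indicator_def)
    ultimately show ?thesis by simp
  qed
  have step: "norm (?D g) \<le> 2 * L * \<delta> * (LINT y|lebesgue. norm (g y))"
    if g: "integrable lebesgue g" and z: "norm z \<le> R" and d: "\<delta> \<ge> 0"
      and gs: "\<And>y. g y \<noteq> 0 \<Longrightarrow> norm y \<le> R \<and> norm (y - z) \<le> \<delta>" for g z \<delta>
  proof -
    have g0: "\<And>y. norm y > R \<Longrightarrow> g y = 0" using gs by force
    let ?K = "LINT y|lebesgue. norm (g y)"
    have "(LINT y|lebesgue. g y) * ?F z - (LINT y|lebesgue. g y * ?F y) 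
        = (LINT y|lebesgue. g y * (?F z - ?F y))"
      using gF[OF g g0] g by (simp add: right_diff_distrib)
    also have "\<dots> = (LINT y|lebesgue. g y * (indicator (cball 0 R \<inter> cball z \<delta>) y *\<^sub>R (?F z - ?F y)))"
      by (intro Bochner_Integration.integral_cong) 
         (auto simp: indicator_def dist_norm norm_minus_commute dest: gs)
    also have "norm \<dots> \<le> (L * \<delta>) * ?K"
    proof (rule integrable_mult_bounded(2)[OF g])
      show "(\<lambda>y. indicator (cball 0 R \<inter> cball z \<delta>) y *\<^sub>R (?F z - ?F y)) \<in> borel_measurable lebesgue"
        by (intro borel_measurable_scaleR borel_measurable_indicator borel_measurable_diff
            borel_measurable_const Fm) simp
      fix y
      show "norm (indicator (cball 0 R \<inter> cball z \<delta>) y *\<^sub>R (?F z - ?F y)) \<le> L * \<delta>"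
      proof (cases "y \<in> cball 0 R \<inter> cball z \<delta>")
        case True
        hence "norm (?F z - ?F y) \<le> L * norm (z - y)" using L(2) z by simp
        also have "\<dots> \<le> L * \<delta>" using True L(1) by (simp add: dist_norm)
        finally show ?thesis using True by simp
      qed (use L(1) d in simp)
    qed
    finally have 1: "norm ((LINT y|lebesgue. g y) * ?F z - (LINT y|lebesgue. g y * ?F y)) \<le> (L * \<delta>) * ?K" .
    have 2: "norm (f (corr g \<eta>) - (LINT y|lebesgue. g y) * ?F z) \<le> L * \<delta> * ?K"
      by (rule L(3)[rule_format, OF g z d gs])
    have "?D g = (f (corr g \<eta>) - (LINT y|lebesgue. g y) * ?F z) + ((LINT y|lebesgue. g y) * ?F z - (LINT y|lebesgue. g y * ?F y))"
      by simp
    hence "norm (?D g) \<le> L * \<delta> * ?K + L * \<delta> * ?K"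
      by (metis (no_types, lifting) 1 2 norm_triangle_mono)
    thus ?thesis by simp
  qed
  have cover: "norm (?D g) \<le> 2 * L * \<delta> * (LINT y|lebesgue. norm (g y))"
    if "finite Z" "Z \<subseteq> cball 0 R" "\<delta> > 0" "integrable lebesgue g"
      "\<And>y. g y \<noteq> 0 \<Longrightarrow> norm y \<le> R \<and> y \<in> (\<Union>z\<in>Z. cball z \<delta>)" for Z g \<delta>
    using that(1,2,4,5)
  proof (induction Z arbitrary: g rule: finite_induct)
    case empty
    hence "g = (\<lambda>y. 0)" by auto
    hence "corr g \<eta> = (\<lambda>x. 0 * \<eta> x)" by (simp add: corr_def[abs_def])
    hence "f (corr g \<eta>) = 0" using distribution_cmult[OF f \<eta>, of 0] by simp
    thus ?case using \<open>g = (\<lambda>y. 0)\<close> by simp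
  next
    case (insert z Z)
    let ?a = "\<lambda>y. indicator (cball z \<delta>) y *\<^sub>R g y" and ?b = "\<lambda>y. indicator (- cball z \<delta>) y *\<^sub>R g y"
    have ia: "integrable lebesgue ?a" and ib: "integrable lebesgue ?b"
      by (rule integrable_mult_indicator[OF _ insert.prems(2)]; simp)+
    have a0: "\<And>y. norm y > R \<Longrightarrow> ?a y = 0" and b0: "\<And>y. norm y > R \<Longrightarrow> ?b y = 0"
      using insert.prems(3) by (force simp: indicator_def)+
    have gab: "g = (\<lambda>y. ?a y + ?b y)" by (auto simp: indicator_def)
    have 1: "norm (?D ?a) \<le> 2 * L * \<delta> * (LINT y|lebesgue. norm (?a y))"
      by (rule step[OF ia, of z]) (use insert.prems \<open>\<delta> > 0\<close> in \<open>auto simp: indicator_def dist_norm norm_minus_commute split: if_splits\<close>)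
    have 2: "norm (?D ?b) \<le> 2 * L * \<delta> * (LINT y|lebesgue. norm (?b y))"
      by (rule insert.IH) (use insert.prems ib in \<open>force simp: indicator_def split: if_splits\<close>)+
    have "corr g \<eta> = (\<lambda>x. 1 * corr ?a \<eta> x + 1 * corr ?b \<eta> x)"
      by (subst gab) (simp add: corr_add_left[OF ia ib \<eta>, abs_def])
    hence "f (corr g \<eta>) = f (corr ?a \<eta>) + f (corr ?b \<eta>)"
      using distribution_linear[OF f test_corr[OF ia \<eta> a0] test_corr[OF ib \<eta> b0], where a = 1 and b = 1] by simp
    moreover have "(LINT y|lebesgue. g y * ?F y) = (LINT y|lebesgue. ?a y * ?F y) + (LINT y|lebesgue. ?b y * ?F y)"
    proof -
      have "(\<lambda>y. g y * ?F y) = (\<lambda>y. ?a y * ?F y + ?b y * ?F y)" by (auto simp: indicator_def)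
      thus ?thesis using Bochner_Integration.integral_add[OF gF[OF ia a0] gF[OF ib b0]] by simp
    qed
    moreover have "(LINT y|lebesgue. norm (g y)) = (LINT y|lebesgue. norm (?a y)) + (LINT y|lebesgue. norm (?b y))"
    proof -
      have "(\<lambda>y. norm (g y)) = (\<lambda>y. norm (?a y) + norm (?b y))" by (auto simp: indicator_def)
      thus ?thesis
        using Bochner_Integration.integral_add[OF integrable_norm[OF ia] integrable_norm[OF ib]] by simp
    qed
    ultimately have D: "?D g = ?D ?a + ?D ?b" and
      K: "(LINT y|lebesgue. norm (g y)) = (LINT y|lebesgue. norm (?a y)) + (LINT y|lebesgue. norm (?b y))"
      by simp_all
    have "norm (?D g) \<le> norm (?D ?a) + norm (?D ?b)" unfolding D by (rule norm_triangle_ineq)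
    also have "\<dots> \<le> 2 * L * \<delta> * (LINT y|lebesgue. norm (?a y)) + 2 * L * \<delta> * (LINT y|lebesgue. norm (?b y))"
      by (rule add_mono[OF 1 2])
    also have "\<dots> = 2 * L * \<delta> * (LINT y|lebesgue. norm (g y))" unfolding K by (rule distrib_left[symmetric])
    finally show ?case .
  qed
  have small: "norm (?D g) \<le> 2 * L * \<delta> * (LINT y|lebesgue. norm (g y))" if "\<delta> > 0" for \<delta>
  proof -
    have "\<exists>Z \<subseteq> cball (0::real^'n) R. finite Z \<and> cball 0 R \<subseteq> (\<Union>z\<in>Z. ball z \<delta>)"
    proof (rule compactE_image[of "cball (0::real^'n) R" "cball 0 R" "\<lambda>z. ball z \<delta>"])
      show "cball 0 R \<subseteq> (\<Union>z\<in>cball (0::real^'n) R. ball z \<delta>)" using \<open>\<delta> > 0\<close> by auto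
    qed (simp_all, blast)
    then obtain Z :: "(real^'n) set" where Z: "finite Z" "Z \<subseteq> cball 0 R" "cball 0 R \<subseteq> (\<Union>z\<in>Z. ball z \<delta>)"
      by blast
    show ?thesis
    proof (rule cover[OF Z(1,2) that g])
      fix y assume "g y \<noteq> 0"
      hence "y \<in> cball 0 R" using gR[of y] by force
      thus "norm y \<le> R \<and> y \<in> (\<Union>z\<in>Z. cball z \<delta>)" using Z(3) \<open>y \<in> cball 0 R\<close> by force
    qed
  qed
  have "norm (?D g) \<le> 0"
  proof (rule field_le_epsilon)
    fix e :: real assume e: "e > 0"
    let ?K = "LINT y|lebesgue. norm (g y)"
    have K: "?K \<ge> 0" by simp
    have "norm (?D g) \<le> 2 * L * (e / (2 * L * (?K + 1))) * ?K"
      by (rule small) (use e L(1) K in \<open>simp add: add_nonneg_pos\<close>)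
    also have "\<dots> = e * (?K / (?K + 1))" using L(1) by simp
    also have "\<dots> \<le> e * 1"
    proof (rule mult_left_mono)
      have "K / (K + 1) \<le> 1" if "K \<ge> 0" for K :: real using that by simp
      thus "?K / (?K + 1) \<le> 1" using K by blast
    qed (use e in simp)
    finally show "norm (?D g) \<le> 0 + e" by simp
  qed
  thus ?thesis by simp
qed

section \<open>Smoothness away from the origin\<close>

lemma has_derivative_norm_powr:
  assumes "x \<noteq> 0"
  shows "((\<lambda>x::real^'n. of_real (norm x powr a) :: complex) has_derivative
           (\<lambda>h. of_real (norm x powr a * ((h \<bullet> sgn x) * a / norm x)))) (at x)"
proof -
  have "((\<lambda>x::real^'n. norm x powr a) has_derivative
           (\<lambda>h. norm x powr a * (0 * ln (norm x) + (h \<bullet> sgn x) * a / norm x))) (at x)"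
    by (rule has_derivative_powr[OF has_derivative_norm[OF assms] has_derivative_const]) (use assms in auto)
  hence "((\<lambda>x::real^'n. norm x powr a) has_derivative
           (\<lambda>h. norm x powr a * ((h \<bullet> sgn x) * a / norm x))) (at x)"
    by (simp only: mult_zero_left add_0_left)
  thus ?thesis by (rule has_derivative_of_real)
qed

text \<open>An algebra that contains the kernel pieces and is stable under partial derivatives on the
  complement of the origin.\<close>

inductive norm_algebra :: "(real^'n \<Rightarrow> complex) \<Rightarrow> bool" where
  smooth: "smooth f \<Longrightarrow> norm_algebra f"
| const: "norm_algebra (\<lambda>x. c)"
| coord: "norm_algebra (\<lambda>x. of_real (x $ i))"
| norm_powr: "norm_algebra (\<lambda>x. of_real (norm x powr a))"
| add: "norm_algebra f \<Longrightarrow> norm_algebra g \<Longrightarrow> norm_algebra (\<lambda>x. f x + g x)"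
| mult: "norm_algebra f \<Longrightarrow> norm_algebra g \<Longrightarrow> norm_algebra (\<lambda>x. f x * g x)"

lemma norm_algebra_differentiable:
  assumes "norm_algebra f" "x \<noteq> 0"
  shows "f differentiable (at x)"
  using assms
proof (induction rule: norm_algebra.induct)
  case (coord i)
  have "((\<lambda>x::real^'a. of_real (x $ i) :: complex) has_derivative (\<lambda>h. of_real (h $ i))) (at x)"
    by (rule has_derivative_of_real[OF bounded_linear_imp_has_derivative[OF bounded_linear_vec_nth]])
  thus ?case by (auto simp: differentiable_def)
next
  case (norm_powr a)
  show ?case using has_derivative_norm_powr[OF norm_powr] by (auto simp: differentiable_def)
qed (simp_all add: smooth_differentiable)

text \<open>Stability under partial derivatives, which is why coordinate functions and all real powers of
  the norm are generators: \<open>\<partial>\<^sub>i |x|\<^sup>a = a |x|\<^bsup>a-2\<^esup> x\<^sub>i\<close>.\<close>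

lemma norm_algebra_partial_deriv:
  assumes "norm_algebra f"
  shows "\<exists>g. norm_algebra g \<and> (\<forall>x\<in>-{0}. partial_deriv i f x = g x)"
  using assms
proof (induction rule: norm_algebra.induct)
  case (smooth f)
  thus ?case by (intro exI[of _ "partial_deriv i f"]) (simp add: norm_algebra.smooth smooth_partial_deriv)
next
  case (const c)
  have "partial_deriv i (\<lambda>x. c) x = 0" for x
    using partial_deriv_eq[of "\<lambda>x. c" "\<lambda>h. 0" x i] by simp
  thus ?case by (intro exI[of _ "\<lambda>x. 0"]) (simp add: norm_algebra.const)
next
  case (coord k)
  have "((\<lambda>x::real^'a. of_real (x $ k) :: complex) has_derivative (\<lambda>h. of_real (h $ k))) (at x)" for x
    by (rule has_derivative_of_real[OF bounded_linear_imp_has_derivative[OF bounded_linear_vec_nth]])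
  from partial_deriv_eq[OF this] 
  have "partial_deriv i (\<lambda>x::real^'a. of_real (x $ k)) x = of_real (axis i 1 $ k)" for x .
  thus ?case by (intro exI[of _ "\<lambda>x. of_real (axis i 1 $ k)"]) (simp add: norm_algebra.const)
next
  case (norm_powr a)
  have "partial_deriv i (\<lambda>x. of_real (norm x powr a)) x = of_real a * (of_real (norm x powr (a - 2)) * of_real (x $ i))"
    if "x \<noteq> 0" for x :: "real^'a"
  proof -
    have "partial_deriv i (\<lambda>x. of_real (norm x powr a)) x = of_real (norm x powr a * ((axis i 1 \<bullet> sgn x) * a / norm x))"
      by (rule partial_deriv_eq[OF has_derivative_norm_powr[OF that]])
    also have "axis i 1 \<bullet> sgn x = x $ i / norm x"
      by (simp add: inner_axis' sgn_div_norm divide_inverse mult.commute)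
    also have "norm x powr a * (x $ i / norm x * a / norm x) = a * (norm x powr (a - 2) * x $ i)"
      using that by (simp add: powr_diff power2_eq_square)
    finally show ?thesis by simp
  qed
  thus ?case
    by (intro exI[of _ "\<lambda>x. of_real a * (of_real (norm x powr (a - 2)) * of_real (x $ i))"])
       (simp add: norm_algebra.mult[OF norm_algebra.const norm_algebra.mult[OF norm_algebra.norm_powr norm_algebra.coord]])
next
  case (add f g)
  then obtain f' g' where fg: "norm_algebra f'" "norm_algebra g'"
    "\<And>x. x \<noteq> 0 \<Longrightarrow> partial_deriv i f x = f' x" "\<And>x. x \<noteq> 0 \<Longrightarrow> partial_deriv i g x = g' x"
    by auto
  have "partial_deriv i (\<lambda>x. f x + g x) x = f' x + g' x" if x0: "x \<noteq> 0" for x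
  proof -
    obtain D E where DE: "(f has_derivative D) (at x)" "(g has_derivative E) (at x)"
      using norm_algebra_differentiable[OF add.hyps(1) x0] norm_algebra_differentiable[OF add.hyps(2) x0]
      by (auto simp: differentiable_def)
    show ?thesis using partial_deriv_eq[OF has_derivative_add[OF DE], of i] partial_deriv_eq[OF DE(1), of i]
        partial_deriv_eq[OF DE(2), of i] fg(3,4)[OF x0] by simp
  qed
  thus ?case using fg by (intro exI[of _ "\<lambda>x. f' x + g' x"]) (auto intro: norm_algebra.intros)
next
  case (mult f g)
  then obtain f' g' where fg: "norm_algebra f'" "norm_algebra g'"
    "\<And>x. x \<noteq> 0 \<Longrightarrow> partial_deriv i f x = f' x" "\<And>x. x \<noteq> 0 \<Longrightarrow> partial_deriv i g x = g' x"
    by auto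
  have "partial_deriv i (\<lambda>x. f x * g x) x = f x * g' x + f' x * g x" if x0: "x \<noteq> 0" for x
  proof -
    obtain D E where DE: "(f has_derivative D) (at x)" "(g has_derivative E) (at x)"
      using norm_algebra_differentiable[OF mult.hyps(1) x0] norm_algebra_differentiable[OF mult.hyps(2) x0]
      by (auto simp: differentiable_def)
    show ?thesis using partial_deriv_eq[OF has_derivative_mult[OF DE], of i] partial_deriv_eq[OF DE(1), of i]
        partial_deriv_eq[OF DE(2), of i] fg(3,4)[OF x0] by simp
  qed
  thus ?case using fg mult.hyps 
    by (intro exI[of _ "\<lambda>x. f x * g' x + f' x * g x"]) (auto intro: norm_algebra.intros)
qed

text \<open>Away from the origin this is \<open>partial_derivs_coinduct\<close>; near the origin all derivatives vanish
  together with \<open>f\<close>.\<close>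

lemma smooth_norm_algebra:
  assumes f: "norm_algebra f" and e: "e > 0" "\<And>x. norm x < e \<Longrightarrow> f x = 0"
  shows "smooth f"
  unfolding smooth_def
proof
  fix "is" :: "'a list"
  have 1: "partial_derivs is f differentiable_on (- {0})"
  proof (rule partial_derivs_coinduct[where X = norm_algebra])
    show "g differentiable_on - {0}" if "norm_algebra g" for g :: "real^'a \<Rightarrow> complex"
      using norm_algebra_differentiable[OF that] 
      by (auto simp: differentiable_on_def intro: differentiable_at_withinI)
  qed (use f norm_algebra_partial_deriv in auto)
  show "partial_derivs is f differentiable_on UNIV" unfolding differentiable_on_def
  proof
    fix x :: "real^'a"
    show "partial_derivs is f differentiable (at x within UNIV)"
    proof (cases "x = 0")
      case False
      thus ?thesis using 1 by (simp add: differentiable_on_eq_differentiable_at[OF open_Compl[OF closed_singleton]])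
    next
      case True
      have eq: "partial_derivs is f y = 0" if "y \<in> ball 0 e" for y
        using partial_derivs_cong_open[OF open_ball, of 0 e f "\<lambda>x. 0" y "is"] e that 
        by (simp add: partial_derivs_zero)
      have "(partial_derivs is f has_derivative (\<lambda>h. 0)) (at 0 within ball 0 e)"
        by (rule has_derivative_transform[OF _ eq has_derivative_const]) (use e in auto)
      hence "(partial_derivs is f has_derivative (\<lambda>h. 0)) (at 0)"
        using at_within_open[of "0::real^'a" "ball 0 e"] e by simp
      thus ?thesis unfolding True differentiable_def by blast
    qed
  qed
qed

section \<open>Dyadic decomposition of the kernel\<close>

definition kernel_piece :: "(real^'n \<Rightarrow> complex) \<Rightarrow> real \<Rightarrow> nat \<Rightarrow> real^'n \<Rightarrow> complex" where
  "kernel_piece \<phi>\<^sub>0 \<alpha> j y =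
     (\<phi>\<^sub>0 (2 ^ j *\<^sub>R y) - \<phi>\<^sub>0 (2 ^ Suc j *\<^sub>R y)) * of_real (norm y powr (\<alpha> - real CARD('n)))"

lemma norm_le_card: 
  fixes x :: "real^'n"
  assumes "\<And>i. \<bar>x $ i\<bar> \<le> c" shows "norm x \<le> c * real CARD('n)"
proof -
  have "norm x \<le> (\<Sum>i\<in>UNIV. \<bar>x $ i\<bar>)" by (rule norm_le_l1_cart)
  also have "\<dots> \<le> (\<Sum>i\<in>(UNIV::'n set). c)" by (rule sum_mono) (rule assms)
  finally show ?thesis by (simp add: mult.commute)
qed

lemma cutoff_zero:
  assumes "cutoff \<phi>\<^sub>0" "\<bar>y $ i\<bar> > 1"
  shows "\<phi>\<^sub>0 y = 0"
proof (rule ccontr)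
  assume "\<phi>\<^sub>0 y \<noteq> 0"
  hence "y \<in> supp \<phi>\<^sub>0" unfolding supp_def using closure_subset by fastforce
  hence "y \<in> cube 0 2" using assms(1) by (auto simp: cutoff_def)
  thus False using assms(2) by (auto simp: cube_def dest: spec[of _ i])
qed

lemma cutoff_one:
  assumes "cutoff \<phi>\<^sub>0" "norm y \<le> 1/2"
  shows "\<phi>\<^sub>0 y = 1"
proof -
  have "\<bar>y $ i\<bar> \<le> 1 / 2" for i using component_le_norm_cart[of y i] assms(2) by linarith
  hence "y \<in> cube 0 1" by (simp add: cube_def)
  thus ?thesis using assms(1) by (auto simp: cutoff_def)
qed

lemma norm_powr_rescale:
  "norm (y :: real^'n) powr (\<alpha> - real CARD('n)) =
     2 powr (real J * (real CARD('n) - \<alpha>)) * norm (2 ^ J *\<^sub>R y) powr (\<alpha> - real CARD('n))"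
proof -
  have "norm (2 ^ J *\<^sub>R y) powr (\<alpha> - real CARD('n)) =
      2 powr (real J * (\<alpha> - real CARD('n))) * norm y powr (\<alpha> - real CARD('n))"
    by (simp add: powr_mult powr_powr flip: powr_realpow)
  hence "2 powr (real J * (real CARD('n) - \<alpha>)) * norm (2 ^ J *\<^sub>R y) powr (\<alpha> - real CARD('n)) =
       2 powr (real J * (real CARD('n) - \<alpha>) + real J * (\<alpha> - real CARD('n))) * norm y powr (\<alpha> - real CARD('n))"
    by (simp add: powr_add)
  thus ?thesis by (simp add: algebra_simps)
qed

text \<open>All pieces are rescalings of the piece with index \<open>0\<close>, because the power of the norm is
  homogeneous.\<close>

lemma kernel_piece_scale:
  "kernel_piece \<phi>\<^sub>0 \<alpha> (j + J) y =
     of_real (2 powr (real J * (real CARD('n) - \<alpha>))) * kernel_piece \<phi>\<^sub>0 \<alpha> j (2 ^ J *\<^sub>R (y :: real^'n))"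
  unfolding kernel_piece_def norm_powr_rescale[of y \<alpha> J] by (simp add: power_add algebra_simps)

lemma kernel_piece_0_zero:
  assumes "cutoff \<phi>\<^sub>0" "\<bar>y $ i\<bar> > 1"
  shows "kernel_piece \<phi>\<^sub>0 \<alpha> 0 y = 0"
  using cutoff_zero[OF assms] cutoff_zero[OF assms(1), of "2 *\<^sub>R y" i] assms(2)
  by (simp add: kernel_piece_def)

lemma large_component:
  assumes "real CARD('n) < norm (x :: real^'n)" obtains i where "\<bar>x $ i\<bar> > 1"
proof -
  have "\<exists>i. \<bar>x $ i\<bar> > 1" using assms norm_le_card[of x 1] by (simp add: not_le[symmetric]) blast
  thus ?thesis using that by blast
qed

lemma kernel_piece_support:
  fixes \<phi>\<^sub>0 :: "real^'n \<Rightarrow> complex"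
  assumes "cutoff \<phi>\<^sub>0" "real CARD('n) < norm (2 ^ j *\<^sub>R y)"
  shows "kernel_piece \<phi>\<^sub>0 \<alpha> j y = 0"
proof -
  obtain i where "\<bar>(2 ^ j *\<^sub>R y) $ i\<bar> > 1" using large_component[OF assms(2)] by blast
  from kernel_piece_0_zero[OF assms(1) this, of \<alpha>] show ?thesis
    using kernel_piece_scale[of \<phi>\<^sub>0 \<alpha> 0 j y] by simp
qed

text \<open>The difference \<open>\<phi>\<^sub>0(y) - \<phi>\<^sub>0(2y)\<close> vanishes for \<open>|y| < 1/4\<close> since both terms are \<open>1\<close> there, and this
  removes the singularity of the power of the norm.\<close>

lemma test_kernel_piece_0:
  fixes \<phi>\<^sub>0 :: "real^'n \<Rightarrow> complex"
  assumes "cutoff \<phi>\<^sub>0"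
  shows "kernel_piece \<phi>\<^sub>0 \<alpha> 0 \<in> test_functions"
proof (rule test_functionsI_ball[where R = "real CARD('n)"])
  have sm: "smooth \<phi>\<^sub>0" using assms by (simp add: cutoff_def test_smooth)
  have "smooth (\<lambda>x. 1 * \<phi>\<^sub>0 x + (-1) * \<phi>\<^sub>0 (2 *\<^sub>R x + 0))"
    by (intro smooth_linear sm smooth_affine)
  hence "norm_algebra (\<lambda>y. (\<phi>\<^sub>0 y - \<phi>\<^sub>0 (2 *\<^sub>R y)) * of_real (norm y powr (\<alpha> - real CARD('n))))"
    by (intro norm_algebra.mult norm_algebra.norm_powr norm_algebra.smooth) simp
  hence "norm_algebra (kernel_piece \<phi>\<^sub>0 \<alpha> 0)" by (simp add: kernel_piece_def[abs_def])
  thus "smooth (kernel_piece \<phi>\<^sub>0 \<alpha> 0)"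
    by (rule smooth_norm_algebra[where e = "1/4"]) (use cutoff_one[OF assms] in \<open>auto simp: kernel_piece_def\<close>)
  fix x :: "real^'n" assume "real CARD('n) < norm x"
  thus "kernel_piece \<phi>\<^sub>0 \<alpha> 0 x = 0" using kernel_piece_support[OF assms, of 0] by simp
qed

lemma test_kernel_piece:
  assumes "cutoff \<phi>\<^sub>0" shows "kernel_piece \<phi>\<^sub>0 \<alpha> j \<in> test_functions"
  using test_cmult[OF test_affine[OF test_kernel_piece_0[OF assms], where c = "2 ^ j" and b = 0]]
    kernel_piece_scale[of \<phi>\<^sub>0 \<alpha> 0 j, abs_def] by simp

lemma I_kernel_altdef: "I_kernel \<phi>\<^sub>0 \<alpha> y = \<phi>\<^sub>0 y * of_real (norm (y :: real^'n) powr (\<alpha> - real CARD('n)))"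
proof -
  have "norm y powr (\<alpha> - real CARD('n)) = inverse (norm y powr (real CARD('n) - \<alpha>))"
    by (subst powr_minus[symmetric]) simp
  thus ?thesis by (simp add: I_kernel_def divide_inverse)
qed

text \<open>The sum telescopes, and what is left of the kernel is the kernel itself on a smaller scale.\<close>

lemma I_kernel_scale:
  "I_kernel \<phi>\<^sub>0 \<alpha> y - (\<Sum>j<J. kernel_piece \<phi>\<^sub>0 \<alpha> j y) =
     of_real (2 powr (real J * (real CARD('n) - \<alpha>))) * I_kernel \<phi>\<^sub>0 \<alpha> (2 ^ J *\<^sub>R (y :: real^'n))"
proof -
  have "(\<Sum>j<J. kernel_piece \<phi>\<^sub>0 \<alpha> j y) = (\<phi>\<^sub>0 y - \<phi>\<^sub>0 (2 ^ J *\<^sub>R y)) * of_real (norm y powr (\<alpha> - real CARD('n)))"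
    by (induction J) (simp_all add: kernel_piece_def algebra_simps)
  hence 1: "I_kernel \<phi>\<^sub>0 \<alpha> y - (\<Sum>j<J. kernel_piece \<phi>\<^sub>0 \<alpha> j y) = \<phi>\<^sub>0 (2 ^ J *\<^sub>R y) * of_real (norm y powr (\<alpha> - real CARD('n)))"
    by (simp add: I_kernel_altdef algebra_simps)
  show ?thesis unfolding 1 norm_powr_rescale[of y \<alpha> J] by (simp add: I_kernel_altdef)
qed

lemma lebesgue_affine:
  fixes t :: "real^'n"
  assumes c: "c \<noteq> 0"
  shows "lebesgue = density (distr lebesgue lebesgue (\<lambda>x. t + c *\<^sub>R x)) (\<lambda>_. ennreal (\<bar>c\<bar> ^ CARD('n)))" (is ?A)
    and "(\<lambda>x. t + c *\<^sub>R x) \<in> lebesgue \<rightarrow>\<^sub>M lebesgue" (is ?B)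
proof -
  have eq: "(\<lambda>x::real^'n. t + (\<Sum>j\<in>Basis. (c * (x \<bullet> j)) *\<^sub>R j)) = (\<lambda>x. t + c *\<^sub>R x)"
  proof
    fix x :: "real^'n"
    have "(\<Sum>j\<in>Basis. (c * (x \<bullet> j)) *\<^sub>R j) = c *\<^sub>R (\<Sum>j\<in>Basis. (x \<bullet> j) *\<^sub>R j)"
      by (simp add: scaleR_sum_right)
    thus "t + (\<Sum>j\<in>Basis. (c * (x \<bullet> j)) *\<^sub>R j) = t + c *\<^sub>R x" by (simp add: euclidean_representation)
  qed
  have "(\<Prod>j\<in>(Basis :: (real^'n) set). \<bar>c\<bar>) = \<bar>c\<bar> ^ CARD('n)" by simp
  thus ?A using lebesgue_affine_euclidean[where c = "\<lambda>_::real^'n. c" and t = t] c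
    unfolding eq by simp
  show ?B using lebesgue_affine_measurable[where c = "\<lambda>_::real^'n. c" and t = t] c unfolding eq by simp
qed

lemma integral_lebesgue_affine:
  fixes h :: "real^'n \<Rightarrow> 'b :: {banach, second_countable_topology}"
  assumes c: "c \<noteq> 0" and h: "h \<in> borel_measurable lebesgue"
  shows "(LINT x|lebesgue. h (t + c *\<^sub>R x)) = (1 / \<bar>c\<bar> ^ CARD('n)) *\<^sub>R (LINT x|lebesgue. h x)"
    and "integrable lebesgue h \<Longrightarrow> integrable lebesgue (\<lambda>x. h (t + c *\<^sub>R x))"
proof -
  let ?T = "\<lambda>x::real^'n. t + c *\<^sub>R x"
  have h': "h \<in> borel_measurable (distr lebesgue lebesgue ?T)" using h by simp
  have "(LINT x|lebesgue. h x) = (LINT x|density (distr lebesgue lebesgue ?T) (\<lambda>_. ennreal (\<bar>c\<bar> ^ CARD('n))). h x)"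
    by (subst lebesgue_affine(1)[OF c, of t]) (rule refl)
  also have "\<dots> = (LINT x|distr lebesgue lebesgue ?T. (\<bar>c\<bar> ^ CARD('n)) *\<^sub>R h x)"
    by (rule integral_density) (use h' in auto)
  also have "\<dots> = (LINT x|lebesgue. (\<bar>c\<bar> ^ CARD('n)) *\<^sub>R h (?T x))"
    by (rule integral_distr) (use lebesgue_affine(2)[OF c] h in auto)
  finally show "(LINT x|lebesgue. h (t + c *\<^sub>R x)) = (1 / \<bar>c\<bar> ^ CARD('n)) *\<^sub>R (LINT x|lebesgue. h x)"
    using c by simp
  assume "integrable lebesgue h"
  hence "integrable (density (distr lebesgue lebesgue ?T) (\<lambda>_. ennreal (\<bar>c\<bar> ^ CARD('n)))) h"
    by (subst (asm) lebesgue_affine(1)[OF c, of t])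
  hence "integrable (distr lebesgue lebesgue ?T) (\<lambda>x. (\<bar>c\<bar> ^ CARD('n)) *\<^sub>R h x)"
    by (subst (asm) integrable_density) (use h' in auto)
  from integrable_scaleR_right[OF this, of "1 / \<bar>c\<bar> ^ CARD('n)"]
  have "integrable (distr lebesgue lebesgue ?T) h" using c by simp
  thus "integrable lebesgue (\<lambda>x. h (t + c *\<^sub>R x))"
    by (subst (asm) integrable_distr_eq) (use lebesgue_affine(2)[OF c] h in auto)
qed

lemma test_measurable: "\<phi> \<in> test_functions \<Longrightarrow> \<phi> \<in> borel_measurable lebesgue"
  by (rule continuous_lebesgue_measurable[OF test_continuous])

lemma test_integrable:
  assumes "\<phi> \<in> test_functions" shows "integrable lebesgue \<phi>"
proof -
  obtain R where R: "R > 0" "\<And>x. norm x > R \<Longrightarrow> \<phi> x = 0" using test_support_ball[OF assms] by blast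
  obtain B where B: "B > 0" "\<And>x. norm (\<phi> x) \<le> B" using test_bounded[OF assms] by blast
  have fin: "emeasure lebesgue (cball (0::real^'a) R) < \<infinity>"
    using emeasure_bounded_finite[OF bounded_cball] by simp
  have "integrable lebesgue (\<lambda>x::real^'a. indicator (cball 0 R) x *\<^sub>R (complex_of_real B))"
    by (rule integrable.intros[OF has_bochner_integral_indicator]) (use fin in auto)
  thus ?thesis
    by (rule Bochner_Integration.integrable_bound)
       (use test_measurable[OF assms] B R(2) in \<open>force simp: indicator_def intro!: AE_I2\<close>)+
qed

text \<open>The dilation by \<open>2\<^sup>J\<close> contributes \<open>2\<^bsup>-Jn\<^esup>\<close> and the factor \<open>2\<^bsup>J(n-\<alpha>)\<^esup>\<close>, so a net gain of \<open>2\<^bsup>-J\<alpha>\<^esup>\<close>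
  remains. It gives the convergence of the series of pieces and the decay of its remainder.\<close>

lemma integral_norm_rescale:
  fixes k :: "real^'n \<Rightarrow> complex"
  assumes [measurable]: "k \<in> borel_measurable lebesgue"
  shows "(LINT y|lebesgue. norm (of_real (2 powr (real J * (real CARD('n) - \<alpha>))) * k (2 ^ J *\<^sub>R y))) =
     2 powr (- real J * \<alpha>) * (LINT y|lebesgue. norm (k y))"
proof -
  let ?n = "real CARD('n)"
  have "(LINT y|lebesgue. norm (of_real (2 powr (real J * (?n - \<alpha>))) * k (2 ^ J *\<^sub>R y))) =
      2 powr (real J * (?n - \<alpha>)) * (LINT y|lebesgue. norm (k (0 + 2 ^ J *\<^sub>R y)))"
    by (simp add: norm_mult)
  also have "(LINT y|lebesgue. norm (k (0 + 2 ^ J *\<^sub>R y))) = (1 / \<bar>2 ^ J\<bar> ^ CARD('n)) *\<^sub>R (LINT y|lebesgue. norm (k y))"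
    by (rule integral_lebesgue_affine(1)) auto
  also have "1 / \<bar>2 ^ J\<bar> ^ CARD('n) = (2::real) powr (- real J * ?n)"
    by (simp add: powr_minus divide_inverse powr_powr[symmetric] powr_realpow)
  also have "2 powr (real J * (?n - \<alpha>)) * (2 powr (- real J * ?n) *\<^sub>R (LINT y|lebesgue. norm (k y)))
     = 2 powr (real J * (?n - \<alpha>) + (- real J * ?n)) * (LINT y|lebesgue. norm (k y))"
    by (simp only: powr_add) simp
  also have "real J * (?n - \<alpha>) + (- real J * ?n) = - real J * \<alpha>" by (simp add: algebra_simps)
  finally show ?thesis .
qed

lemma I_kernel_support:
  fixes \<phi>\<^sub>0 :: "real^'n \<Rightarrow> complex"
  assumes "cutoff \<phi>\<^sub>0" "norm y > real CARD('n)"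
  shows "I_kernel \<phi>\<^sub>0 \<alpha> y = 0"
proof -
  obtain i where "\<bar>y $ i\<bar> > 1" using large_component[OF assms(2)] by blast
  thus ?thesis using cutoff_zero[OF assms(1)] by (simp add: I_kernel_def)
qed

text \<open>At each point the series is finite: once \<open>2\<^sup>j y\<close> leaves the support of \<open>\<phi>\<^sub>0\<close>, all further pieces
  vanish. At the origin all terms are \<open>0\<close>, as \<open>0\<close> to any real power is \<open>0\<close> and division by \<open>0\<close> gives
  \<open>0\<close>.\<close>

lemma I_kernel_sums:
  fixes \<phi>\<^sub>0 :: "real^'n \<Rightarrow> complex"
  assumes "cutoff \<phi>\<^sub>0"
  shows "summable (\<lambda>j. norm (kernel_piece \<phi>\<^sub>0 \<alpha> j y))" "(\<Sum>j. kernel_piece \<phi>\<^sub>0 \<alpha> j y) = I_kernel \<phi>\<^sub>0 \<alpha> y"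
proof -
  obtain J where J: "\<And>j. j \<ge> J \<Longrightarrow> I_kernel \<phi>\<^sub>0 \<alpha> (2 ^ j *\<^sub>R y) = 0 \<and> kernel_piece \<phi>\<^sub>0 \<alpha> j y = 0"
  proof (cases "y = 0")
    case True
    thus ?thesis by (intro that[of 0]) (simp add: I_kernel_def kernel_piece_def)
  next
    case False
    obtain J where J: "2 ^ J > real CARD('n) / norm y" using real_arch_pow[of 2] by auto
    have big: "real CARD('n) < norm (2 ^ j *\<^sub>R y)" if "j \<ge> J" for j
    proof -
      have "real CARD('n) < 2 ^ J * norm y" using J False by (simp add: field_simps)
      also have "\<dots> \<le> 2 ^ j * norm y" by (intro mult_right_mono power_increasing that) auto
      finally show ?thesis by simp
    qed
    show ?thesis
    proof (rule that[of J])
      fix j assume j: "j \<ge> J"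
      have "real CARD('n) < norm (2 ^ j *\<^sub>R y)" by (rule big) (rule j)
      hence "I_kernel \<phi>\<^sub>0 \<alpha> (2 ^ j *\<^sub>R y) = 0" and "kernel_piece \<phi>\<^sub>0 \<alpha> j y = 0"
        using I_kernel_support[of \<phi>\<^sub>0 "2 ^ j *\<^sub>R y" \<alpha>] kernel_piece_support[of \<phi>\<^sub>0 j y \<alpha>] assms by blast+
      thus "I_kernel \<phi>\<^sub>0 \<alpha> (2 ^ j *\<^sub>R y) = 0 \<and> kernel_piece \<phi>\<^sub>0 \<alpha> j y = 0" ..
    qed
  qed
  show "summable (\<lambda>j. norm (kernel_piece \<phi>\<^sub>0 \<alpha> j y))"
    by (rule summable_finite[of "{..<J}"]) (use J in \<open>auto simp: not_less\<close>)
  have "(\<Sum>j. kernel_piece \<phi>\<^sub>0 \<alpha> j y) = (\<Sum>j<J. kernel_piece \<phi>\<^sub>0 \<alpha> j y)"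
    by (rule suminf_finite) (use J in \<open>auto simp: not_less\<close>)
  also have "\<dots> = I_kernel \<phi>\<^sub>0 \<alpha> y" using I_kernel_scale[of \<phi>\<^sub>0 \<alpha> y J] J[of J] by simp
  finally show "(\<Sum>j. kernel_piece \<phi>\<^sub>0 \<alpha> j y) = I_kernel \<phi>\<^sub>0 \<alpha> y" .
qed

lemma two_powr_alpha:
  assumes "0 < (\<alpha>::real)" shows "2 powr (- real j * \<alpha>) = (2 powr (- \<alpha>)) ^ j" "2 powr (- \<alpha>) < 1"
  using assms by (simp_all add: powr_power mult.commute powr_less_one)

lemma I_kernel_integrable:
  fixes \<phi>\<^sub>0 :: "real^'n \<Rightarrow> complex"
  assumes "cutoff \<phi>\<^sub>0" "0 < \<alpha>"
  shows "integrable lebesgue (I_kernel \<phi>\<^sub>0 \<alpha>)"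
proof -
  have "integrable lebesgue (\<lambda>y. \<Sum>j. kernel_piece \<phi>\<^sub>0 \<alpha> j y)"
  proof (rule integrable_suminf)
    show "integrable lebesgue (kernel_piece \<phi>\<^sub>0 \<alpha> j)" for j
      by (rule test_integrable[OF test_kernel_piece[OF assms(1)]])
    show "AE y in lebesgue. summable (\<lambda>j. norm (kernel_piece \<phi>\<^sub>0 \<alpha> j y))"
      using I_kernel_sums(1)[OF assms(1)] by simp
    have sum: "summable (\<lambda>j. (2 powr (- \<alpha>)) ^ j * (LINT y|lebesgue. norm (kernel_piece \<phi>\<^sub>0 \<alpha> 0 y)))"
      by (intro summable_mult2 summable_geometric) (use two_powr_alpha(2)[OF assms(2)] in simp)
    show "summable (\<lambda>j. LINT y|lebesgue. norm (kernel_piece \<phi>\<^sub>0 \<alpha> j y))"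
    proof -
      have piece: "(LINT y|lebesgue. norm (kernel_piece \<phi>\<^sub>0 \<alpha> j y)) =
          2 powr (- real j * \<alpha>) * (LINT y|lebesgue. norm (kernel_piece \<phi>\<^sub>0 \<alpha> 0 y))" for j
      proof -
        have eq: "kernel_piece \<phi>\<^sub>0 \<alpha> j = (\<lambda>y. of_real (2 powr (real j * (real CARD('n) - \<alpha>))) * kernel_piece \<phi>\<^sub>0 \<alpha> 0 (2 ^ j *\<^sub>R y))"
        proof
          fix y
          show "kernel_piece \<phi>\<^sub>0 \<alpha> j y = of_real (2 powr (real j * (real CARD('n) - \<alpha>))) * kernel_piece \<phi>\<^sub>0 \<alpha> 0 (2 ^ j *\<^sub>R y)"
            using kernel_piece_scale[of \<phi>\<^sub>0 \<alpha> 0 j y] by (simp only: add_0)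
        qed
        have "(LINT y|lebesgue. norm (kernel_piece \<phi>\<^sub>0 \<alpha> j y)) =
          (LINT y|lebesgue. norm (of_real (2 powr (real j * (real CARD('n) - \<alpha>))) * kernel_piece \<phi>\<^sub>0 \<alpha> 0 (2 ^ j *\<^sub>R y)))"
          unfolding eq ..
        also have "\<dots> = 2 powr (- real j * \<alpha>) * (LINT y|lebesgue. norm (kernel_piece \<phi>\<^sub>0 \<alpha> 0 y))"
          by (rule integral_norm_rescale[OF test_measurable[OF test_kernel_piece[OF assms(1)]]])
        finally show ?thesis .
      qed
      have eq: "(\<lambda>j. LINT y|lebesgue. norm (kernel_piece \<phi>\<^sub>0 \<alpha> j y)) =
          (\<lambda>j. (2 powr (- \<alpha>)) ^ j * (LINT y|lebesgue. norm (kernel_piece \<phi>\<^sub>0 \<alpha> 0 y)))"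
        by (rule ext) (subst piece, subst two_powr_alpha(1)[OF assms(2)], rule refl)
      show ?thesis unfolding eq by (rule sum)
    qed
  qed
  thus ?thesis by (simp add: I_kernel_sums(2)[OF assms(1)])
qed

lemma integral_norm_I_kernel_remainder:
  fixes \<phi>\<^sub>0 :: "real^'n \<Rightarrow> complex"
  assumes "cutoff \<phi>\<^sub>0" "0 < \<alpha>"
  shows "(LINT y|lebesgue. norm (I_kernel \<phi>\<^sub>0 \<alpha> y - (\<Sum>j<J. kernel_piece \<phi>\<^sub>0 \<alpha> j y))) =
     (2 powr (- \<alpha>)) ^ J * (LINT y|lebesgue. norm (I_kernel \<phi>\<^sub>0 \<alpha> y))"
proof -
  have m: "I_kernel \<phi>\<^sub>0 \<alpha> \<in> borel_measurable lebesgue" using I_kernel_integrable[OF assms] by auto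
  have "(LINT y|lebesgue. norm (I_kernel \<phi>\<^sub>0 \<alpha> y - (\<Sum>j<J. kernel_piece \<phi>\<^sub>0 \<alpha> j y))) =
     (LINT y|lebesgue. norm (of_real (2 powr (real J * (real CARD('n) - \<alpha>))) * I_kernel \<phi>\<^sub>0 \<alpha> (2 ^ J *\<^sub>R y)))"
    by (rule Bochner_Integration.integral_cong[OF refl]) (subst I_kernel_scale, rule refl)
  also have "\<dots> = 2 powr (- real J * \<alpha>) * (LINT y|lebesgue. norm (I_kernel \<phi>\<^sub>0 \<alpha> y))"
    by (rule integral_norm_rescale[OF m])
  finally show ?thesis by (subst (asm) two_powr_alpha(1)[OF assms(2)])
qed

section \<open>The local fractional integral as a series of convolutions\<close>

lemma corr_sum_left:
  assumes "\<And>j. integrable lebesgue (k j)" "\<phi> \<in> test_functions"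
  shows "corr (\<lambda>y. \<Sum>j<J. k j y) \<phi> x = (\<Sum>j<J. corr (k j) \<phi> x)"
  using corr_integrable[OF assms] by (simp add: corr_def sum_distrib_right)

lemma distribution_sum:
  assumes "f \<in> distributions" "\<And>j. \<phi> j \<in> test_functions"
  shows "f (\<lambda>x. \<Sum>j<(J::nat). \<phi> j x) = (\<Sum>j<J. f (\<phi> j))" "(\<lambda>x. \<Sum>j<J. \<phi> j x) \<in> test_functions"
proof (induction J)
  case 0
  { case 1 show ?case using distribution_cmult[OF assms(1) test_zero, of 0] by simp }
  { case 2 show ?case by (simp add: test_zero) }
next
  case (Suc J)
  { case 1 show ?case using distribution_linear[OF assms(1) Suc(2) assms(2)[of J], of 1 1] Suc(1) by simp }
  { case 2 show ?case using test_linear[OF Suc(2) assms(2)[of J], of 1 1] by simp }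
qed

lemma conv_continuous:
  assumes f: "f \<in> distributions" and \<theta>: "\<theta> \<in> test_functions"
  shows "continuous_on UNIV (conv \<theta> f)"
proof -
  have "(\<lambda>x. \<theta> (- x)) \<in> test_functions" using test_affine[OF \<theta>, of "-1" 0] by simp
  from distribution_translate_continuous[OF f this]
  have "continuous_on UNIV (\<lambda>x. f (\<lambda>z. \<theta> (- (z + - x))))"
    by (rule continuous_on_compose2) (auto intro: continuous_intros)
  thus ?thesis by (simp add: conv_def[abs_def])
qed

text \<open>After the substitution \<open>y \<mapsto> -x - y\<close> the roles of \<open>\<theta>\<close> and \<open>\<phi>\<close> are exchanged: the correlation
  becomes a superposition of translates of \<open>\<theta>(-\<cdot>)\<close> with density \<open>\<phi>(-\<cdot>)\<close>, to which
  \<open>distribution_corr\<close> applies.\<close>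

lemma distribution_conv_duality:
  fixes \<phi> \<theta> :: "real^'n \<Rightarrow> complex"
  assumes f: "f \<in> distributions" and \<phi>: "\<phi> \<in> test_functions" and \<theta>: "\<theta> \<in> test_functions"
  shows "f (corr \<theta> \<phi>) = (LINT x|lebesgue. conv \<theta> f x * \<phi> x)"
proof -
  have refl: "(\<lambda>x. \<psi> (- x)) \<in> test_functions" if "\<psi> \<in> test_functions" for \<psi> :: "real^'n \<Rightarrow> complex"
    using test_affine[OF that, of "-1" 0] by simp
  obtain R where R: "R > 0" "\<And>x. norm x > R \<Longrightarrow> \<phi> x = 0" using test_support_ball[OF \<phi>] by blast
  have swap: "corr \<theta> \<phi> = corr (\<lambda>y. \<phi> (- y)) (\<lambda>w. \<theta> (- w))"
  proof
    fix x
    have m: "(\<lambda>y. \<theta> y * \<phi> (x + y)) \<in> borel_measurable lebesgue"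
      by (intro borel_measurable_times test_measurable[OF \<theta>] translate_measurable[OF \<phi>])
    have "corr (\<lambda>y. \<phi> (- y)) (\<lambda>w. \<theta> (- w)) x = (LINT y|lebesgue. \<theta> (- x + (-1) *\<^sub>R y) * \<phi> (x + (- x + (-1) *\<^sub>R y)))"
      by (simp add: corr_def mult.commute)
    also have "\<dots> = corr \<theta> \<phi> x"
      unfolding corr_def by (subst integral_lebesgue_affine(1)[OF _ m]) auto
    finally show "corr \<theta> \<phi> x = corr (\<lambda>y. \<phi> (- y)) (\<lambda>w. \<theta> (- w)) x" by simp
  qed
  have conv: "conv \<theta> f x = f (\<lambda>z. \<theta> (- (z + - x)))" for x by (simp add: conv_def)
  have m: "(\<lambda>x. conv \<theta> f x * \<phi> x) \<in> borel_measurable lebesgue"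
    by (rule borel_measurable_times[OF continuous_lebesgue_measurable[OF conv_continuous[OF f \<theta>]] test_measurable[OF \<phi>]])
  have "f (corr \<theta> \<phi>) = (LINT y|lebesgue. \<phi> (- y) * f (\<lambda>x. \<theta> (- (x + y))))"
    unfolding swap
    by (rule distribution_corr[OF f refl[OF \<theta>] test_integrable[OF refl[OF \<phi>]], of R]) (use R in simp)
  also have "\<dots> = (LINT y|lebesgue. conv \<theta> f (0 + (-1) *\<^sub>R y) * \<phi> (0 + (-1) *\<^sub>R y))"
    by (simp add: conv mult.commute)
  also have "\<dots> = (LINT x|lebesgue. conv \<theta> f x * \<phi> x)"
    by (subst integral_lebesgue_affine(1)[OF _ m]) auto
  finally show ?thesis .
qed

text \<open>The partial sums miss the value of \<open>f\<close> at the correlation of \<open>\<phi>\<close> with the remainder of the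
  kernel. Its \<open>L\<^sup>1\<close> norm decays geometrically and its support stays in a fixed ball, so continuity of
  \<open>f\<close> applies with constants that do not depend on the number of terms.\<close>

lemma I_loc_sums:
  fixes \<phi>\<^sub>0 :: "real^'n \<Rightarrow> complex"
  assumes \<phi>0: "cutoff \<phi>\<^sub>0" and \<alpha>: "0 < \<alpha>" and f: "f \<in> distributions" and \<phi>: "\<phi> \<in> test_functions"
  shows "(\<lambda>j. LINT x|lebesgue. conv (kernel_piece \<phi>\<^sub>0 \<alpha> j) f x * \<phi> x) sums I_loc \<phi>\<^sub>0 \<alpha> f \<phi>"
proof -
  let ?k = "I_kernel \<phi>\<^sub>0 \<alpha>" let ?p = "kernel_piece \<phi>\<^sub>0 \<alpha>" let ?n = "real CARD('n)"
  let ?r = "\<lambda>J y. ?k y - (\<Sum>j<J. ?p j y)"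
  note p_test = test_kernel_piece[OF \<phi>0]
  note p_int = test_integrable[OF p_test]
  note k_int = I_kernel_integrable[OF \<phi>0 \<alpha>]
  have p0: "?p j y = 0" if "norm y > ?n" for j y
  proof -
    have "norm y * 1 \<le> norm y * 2 ^ j" by (intro mult_left_mono) auto
    hence "?n < norm (2 ^ j *\<^sub>R y)" using that by (simp add: mult.commute)
    thus ?thesis using kernel_piece_support[of \<phi>\<^sub>0 j y \<alpha>] \<phi>0 by blast
  qed
  have k0: "?k y = 0" if "norm y > ?n" for y by (rule I_kernel_support[OF \<phi>0 that])
  have r_int: "integrable lebesgue (?r J)" for J
    by (intro Bochner_Integration.integrable_diff Bochner_Integration.integrable_sum k_int p_int)
  have r0: "?r J y = 0" if "norm y > ?n" for J y using k0 p0 that by simp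
  obtain S where S: "\<And>x. norm x > S \<Longrightarrow> \<phi> x = 0" using test_support_ball[OF \<phi>] by blast
  obtain C N where C: "C > 0" "\<forall>\<phi>\<in>test_functions. (\<forall>x. norm x > ?n + S \<longrightarrow> \<phi> x = 0) \<longrightarrow>
      norm (f \<phi>) \<le> C * C_norm N \<phi>"
    using distribution_bound[OF f, of "?n + S"] by blast
  have part: "(\<Sum>j<J. LINT x|lebesgue. conv (?p j) f x * \<phi> x) = I_loc \<phi>\<^sub>0 \<alpha> f \<phi> - f (corr (?r J) \<phi>)" for J
  proof -
    have "(\<Sum>j<J. LINT x|lebesgue. conv (?p j) f x * \<phi> x) = (\<Sum>j<J. f (corr (?p j) \<phi>))"
      by (simp add: distribution_conv_duality[OF f \<phi> p_test])
    also have "\<dots> = f (\<lambda>x. \<Sum>j<J. corr (?p j) \<phi> x)"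
      by (rule distribution_sum(1)[OF f test_corr[OF p_int \<phi> p0], symmetric])
    also have "(\<lambda>x. \<Sum>j<J. corr (?p j) \<phi> x) = (\<lambda>x. corr ?k \<phi> x - 1 * corr (?r J) \<phi> x)"
    proof
      fix x
      have "corr (?r J) \<phi> x = corr ?k \<phi> x - corr (\<lambda>y. \<Sum>j<J. ?p j y) \<phi> x"
        by (intro corr_diff_left k_int \<phi> Bochner_Integration.integrable_sum p_int)
      thus "(\<Sum>j<J. corr (?p j) \<phi> x) = corr ?k \<phi> x - 1 * corr (?r J) \<phi> x"
        by (simp add: corr_sum_left[OF p_int \<phi>])
    qed
    also have "f \<dots> = f (corr ?k \<phi>) - 1 * f (corr (?r J) \<phi>)"
      by (rule distribution_diff[OF f test_corr[OF k_int \<phi> k0] test_corr[OF r_int \<phi> r0]])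
    also have "f (corr ?k \<phi>) = I_loc \<phi>\<^sub>0 \<alpha> f \<phi>" by (simp add: I_loc_def corr_def[abs_def])
    finally show ?thesis by simp
  qed
  have bound: "norm (f (corr (?r J) \<phi>)) \<le> (C * C_norm N \<phi> * (LINT y|lebesgue. norm (?k y))) * (2 powr (- \<alpha>)) ^ J" for J
  proof -
    have "norm (f (corr (?r J) \<phi>)) \<le> C * C_norm N (corr (?r J) \<phi>)"
      by (rule C(2)[rule_format, OF test_corr[OF r_int \<phi> r0]]) (use corr_support[OF r0 S] in auto)
    also have "\<dots> \<le> C * (C_norm N \<phi> * (LINT y|lebesgue. norm (?r J y)))"
      using C(1) C_norm_corr[OF r_int \<phi>] by simp
    finally show ?thesis by (simp add: integral_norm_I_kernel_remainder[OF \<phi>0 \<alpha>] mult_ac)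
  qed
  have "(\<lambda>J. f (corr (?r J) \<phi>)) \<longlonglongrightarrow> 0"
  proof (rule Lim_null_comparison)
    show "\<forall>\<^sub>F J in sequentially. norm (f (corr (?r J) \<phi>)) \<le> (C * C_norm N \<phi> * (LINT y|lebesgue. norm (?k y))) * (2 powr (- \<alpha>)) ^ J"
      using bound by (intro always_eventually allI)
    show "(\<lambda>J. (C * C_norm N \<phi> * (LINT y|lebesgue. norm (?k y))) * (2 powr (- \<alpha>)) ^ J) \<longlonglongrightarrow> 0"
      by (intro tendsto_mult_right_zero LIMSEQ_realpow_zero) (use two_powr_alpha(2)[OF \<alpha>] in auto)
  qed
  hence "(\<lambda>J. I_loc \<phi>\<^sub>0 \<alpha> f \<phi> - f (corr (?r J) \<phi>)) \<longlonglongrightarrow> I_loc \<phi>\<^sub>0 \<alpha> f \<phi> - 0"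
    by (intro tendsto_diff tendsto_const)
  thus ?thesis unfolding sums_def part by simp
qed

section \<open>Domination by the grand maximal function\<close>

text \<open>The value at \<open>x\<close> of the convolution with the \<open>j\<close>-th piece is a convolution evaluated at \<open>y\<close>, with
  the dilate of a translate of \<open>\<kappa>\<close>. The translation vector, measured at the scale of the piece, has
  entries at most \<open>1\<close>; hence the translate is supported in a ball of radius \<open>4n\<close>, far below the radius
  allowed in the grand maximal function.\<close>

lemma conv_kernel_piece_le:
  fixes \<phi>\<^sub>0 :: "real^'n \<Rightarrow> complex"
  assumes \<phi>0: "cutoff \<phi>\<^sub>0"
  obtains M :: real where "M > 0"
    "\<forall>f\<in>distributions. \<forall>j x y. (\<forall>i. \<bar>x $ i - y $ i\<bar> \<le> 1 / 2 ^ j) \<longrightarrow>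
       ennreal (norm (conv (kernel_piece \<phi>\<^sub>0 \<alpha> j) f x)) \<le> ennreal (M * 2 powr (- real j * \<alpha>)) * grand_max N f y"
proof -
  let ?n = "CARD('n)" let ?\<kappa> = "kernel_piece \<phi>\<^sub>0 \<alpha> 0"
  note \<kappa> = test_kernel_piece_0[OF \<phi>0, of \<alpha>]
  define M where "M = C_norm N ?\<kappa> + 1"
  have M: "M > 0" "C_norm N ?\<kappa> \<le> M" using C_norm_nonneg[OF \<kappa>, of N] by (auto simp: M_def)
  have "ennreal (norm (conv (kernel_piece \<phi>\<^sub>0 \<alpha> j) f x)) \<le> ennreal (M * 2 powr (- real j * \<alpha>)) * grand_max N f y"
    if f: "f \<in> distributions" and xy: "\<forall>i. \<bar>x $ i - y $ i\<bar> \<le> 1 / 2 ^ j" for f j x y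
  proof -
    define h where "h = 2 ^ j *\<^sub>R (x - y)"
    \<comment> \<open>One halving beyond the scale of the piece, because the grand maximal function only admits \<open>t < 1\<close>
      and \<open>j = 0\<close> must be covered.\<close>
    define t :: real where "t = 1 / 2 ^ Suc j"
    \<comment> \<open>\<open>1 / M\<close> normalizes the \<open>C\<^sup>N\<close> norm; \<open>1 / 2\<^sup>n\<close> compensates the halving in \<open>t\<close>.\<close>
    define b :: complex where "b = of_real (1 / (2 ^ ?n * M))"
    define \<psi> where "\<psi> = (\<lambda>w. b * ?\<kappa> ((1/2) *\<^sub>R w + h))"
    have t: "0 < t" "t < 1" by (auto simp: t_def one_less_power divide_less_eq simp del: power_Suc)
    have h: "\<bar>h $ i\<bar> \<le> 1" for i
    proof -
      have "\<bar>h $ i\<bar> = 2 ^ j * \<bar>x $ i - y $ i\<bar>" by (simp add: h_def abs_mult)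
      also have "\<dots> \<le> 2 ^ j * (1 / 2 ^ j)" using xy by (intro mult_left_mono) auto
      finally show ?thesis by simp
    qed
    have \<psi>0: "(\<lambda>w. ?\<kappa> ((1/2) *\<^sub>R w + h)) \<in> test_functions" by (rule test_affine[OF \<kappa>]) simp
    have \<psi>: "\<psi> \<in> test_functions" unfolding \<psi>_def by (rule test_cmult[OF \<psi>0])
    have b: "norm b * M \<le> 1"
    proof -
      have "norm b * M = 1 / 2 ^ ?n" using M by (simp add: b_def norm_divide norm_mult norm_power del: of_real_divide of_real_mult)
      thus ?thesis by simp
    qed
    have C1: "C_norm N \<psi> \<le> 1"
    proof (rule C_norm_leI)
      fix "is" :: "'n list" and w assume len: "length is \<le> N"
      have "partial_derivs is \<psi> w = b * ((1/2) ^ length is *\<^sub>R partial_derivs is ?\<kappa> ((1/2) *\<^sub>R w + h))"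
        using partial_derivs_linear[OF test_smooth[OF \<psi>0] test_smooth[OF test_zero], of "is" b 0]
        by (simp add: \<psi>_def partial_derivs_affine[OF test_smooth[OF \<kappa>]])
      also have "norm \<dots> = norm b * ((1/2) ^ length is * norm (partial_derivs is ?\<kappa> ((1/2) *\<^sub>R w + h)))"
        by (simp add: norm_mult)
      also have "\<dots> \<le> norm b * (1 * M)"
        by (intro mult_left_mono mult_mono power_le_one order_trans[OF norm_le_C_norm[OF \<kappa> len] M(2)]) auto
      finally show "norm (partial_derivs is \<psi> w) \<le> 1" using b by simp
    qed
    have supp: "supp \<psi> \<subseteq> ball 0 (2 ^ (3 * (10 + ?n)))"
    proof -
      have "supp \<psi> \<subseteq> cball 0 (4 * real ?n)"
      proof (rule supp_subset)
        fix w assume "\<psi> w \<noteq> 0"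
        hence nz: "?\<kappa> ((1/2) *\<^sub>R w + h) \<noteq> 0" by (auto simp: \<psi>_def)
        have "\<bar>w $ i\<bar> \<le> 4" for i
        proof -
          have "\<not> \<bar>((1/2) *\<^sub>R w + h) $ i\<bar> > 1" using nz kernel_piece_0_zero[OF \<phi>0] by blast
          thus ?thesis using h[of i] by (simp add: abs_le_iff) linarith
        qed
        from norm_le_card[OF this] show "w \<in> cball 0 (4 * real ?n)" by simp
      qed simp
      moreover have "4 * real ?n < 2 ^ (3 * (10 + ?n))"
      proof -
        have "real ?n < 2 ^ ?n" by (rule of_nat_less_two_power)
        hence "4 * real ?n < 2 ^ (2 + ?n)" by (simp add: power_add)
        also have "\<dots> \<le> 2 ^ (3 * (10 + ?n))" by (intro power_increasing) auto
        finally show ?thesis .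
      qed
      ultimately show ?thesis by force
    qed
    have mem: "(t, \<psi>) \<in> {0<..<1} \<times> {\<psi> \<in> test_functions. supp \<psi> \<subseteq> ball 0 (2 ^ (3 * (10 + ?n))) \<and> C_norm N \<psi> \<le> 1}"
      using t \<psi> C1 supp by simp
    have le: "ennreal (norm (conv (dilate t \<psi>) f y)) \<le> grand_max N f y"
      unfolding grand_max_def using SUP_upper[OF mem, of "\<lambda>(t, \<psi>). ennreal (norm (conv (dilate t \<psi>) f y))"] by simp
    have dil: "dilate t \<psi> \<in> test_functions"
      using test_cmult[OF test_affine[OF \<psi>, of "inverse t" 0], of "of_real (1 / t ^ ?n)"] t
      by (simp add: dilate_def[abs_def] scaleR_conv_of_real)
    have dil_refl: "(\<lambda>z. dilate t \<psi> (y - z)) \<in> test_functions"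
      using test_affine[OF dil, of "-1" y] by simp
    have eq: "kernel_piece \<phi>\<^sub>0 \<alpha> j (x - z) = of_real (M * 2 powr (- real j * \<alpha>)) * dilate t \<psi> (y - z)" for z
    proof -
      have arg: "(1/2) *\<^sub>R ((y - z) /\<^sub>R t) + h = 2 ^ j *\<^sub>R (x - z)"
        by (simp add: t_def h_def algebra_simps)
      have c: "2 powr (real j * (real ?n - \<alpha>)) = (M * 2 powr (- real j * \<alpha>)) * ((1 / t ^ ?n) * (1 / (2 ^ ?n * M)))"
      proof -
        have "1 / t ^ ?n * (1 / 2 ^ ?n) = (2 ^ j) ^ ?n" by (simp add: t_def power_divide power_mult_distrib)
        also have "\<dots> = 2 powr (real j * real ?n)" by (simp add: powr_powr[symmetric] powr_realpow)
        finally have 1: "1 / t ^ ?n * (1 / 2 ^ ?n) = 2 powr (real j * real ?n)" .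
        have "(M * 2 powr (- real j * \<alpha>)) * ((1 / t ^ ?n) * (1 / (2 ^ ?n * M))) = 2 powr (- real j * \<alpha>) * (1 / t ^ ?n * (1 / 2 ^ ?n))"
          using M by (simp add: field_simps)
        also have "\<dots> = 2 powr (- real j * \<alpha> + real j * real ?n)" unfolding 1 powr_add ..
        finally show ?thesis by (simp add: algebra_simps)
      qed
      have "dilate t \<psi> (y - z) = of_real ((1 / t ^ ?n) * (1 / (2 ^ ?n * M))) * ?\<kappa> (2 ^ j *\<^sub>R (x - z))"
        unfolding dilate_def \<psi>_def arg by (simp only: b_def scaleR_conv_of_real of_real_mult mult.assoc)
      thus ?thesis using kernel_piece_scale[of \<phi>\<^sub>0 \<alpha> 0 j "x - z"] unfolding c
        by (simp only: of_real_mult mult.assoc add_0)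
    qed
    have "conv (kernel_piece \<phi>\<^sub>0 \<alpha> j) f x = of_real (M * 2 powr (- real j * \<alpha>)) * conv (dilate t \<psi>) f y"
      unfolding conv_def eq by (rule distribution_cmult[OF f dil_refl])
    hence "norm (conv (kernel_piece \<phi>\<^sub>0 \<alpha> j) f x) = (M * 2 powr (- real j * \<alpha>)) * norm (conv (dilate t \<psi>) f y)"
      using M by (simp add: norm_mult)
    hence "ennreal (norm (conv (kernel_piece \<phi>\<^sub>0 \<alpha> j) f x)) = ennreal (M * 2 powr (- real j * \<alpha>)) * ennreal (norm (conv (dilate t \<psi>) f y))"
      using M by (simp add: ennreal_mult)
    also have "\<dots> \<le> ennreal (M * 2 powr (- real j * \<alpha>)) * grand_max N f y" by (intro mult_left_mono le) simp
    finally show ?thesis .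
  qed
  thus ?thesis using that M(1) by blast
qed

section \<open>Local \<open>A\<^sub>1\<close> weights\<close>

lemma cube_eq_cbox: "cube x t = cbox (\<chi> i. x $ i - t / 2) (\<chi> i. x $ i + t / 2)"
proof -
  have "\<bar>y $ i - x $ i\<bar> \<le> t / 2 \<longleftrightarrow> x $ i - t / 2 \<le> y $ i \<and> y $ i \<le> x $ i + t / 2" for y i
    by (simp only: abs_le_iff) linarith
  thus ?thesis by (simp add: cube_def set_eq_iff mem_box_cart)
qed

lemma emeasure_cube:
  assumes "t > 0"
  shows "emeasure lebesgue (cube (x::real^'n) t) = ennreal (t ^ CARD('n))"
proof -
  let ?l = "\<chi> i. x $ i - t / 2" and ?u = "\<chi> i. x $ i + t / 2"
  have b: "(?u - ?l) \<bullet> b = t" "?l \<bullet> b \<le> ?u \<bullet> b" if "b \<in> Basis" for b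
    using that assms by (auto simp: Basis_vec_def inner_axis)
  have "emeasure lborel (cbox ?l ?u) = ennreal (\<Prod>b\<in>(Basis::(real^'n) set). (?u - ?l) \<bullet> b)"
    using b(2) by (subst emeasure_lborel_cbox_eq) auto
  also have "(\<Prod>b\<in>(Basis::(real^'n) set). (?u - ?l) \<bullet> b) = (\<Prod>b\<in>(Basis::(real^'n) set). t)"
    by (intro prod.cong refl b)
  finally show ?thesis by (simp add: cube_eq_cbox)
qed

lemma measure_cube: "t > 0 \<Longrightarrow> measure lebesgue (cube (x::real^'n) t) = t ^ CARD('n)"
  by (simp add: measure_def emeasure_cube)

lemma cube_small: "0 < t \<Longrightarrow> t \<le> 1 \<Longrightarrow> cube x t \<in> small_cubes"
  unfolding small_cubes_def
  by (rule CollectI, rule exI[of _ x], rule exI[of _ t]) (simp add: measure_cube power_le_one)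

lemma locally_integrable_measurable:
  fixes g :: "'a::euclidean_space \<Rightarrow> 'b::euclidean_space"
  assumes "locally_integrable g" shows "g \<in> borel_measurable lebesgue"
proof (rule borel_measurable_LIMSEQ_metric)
  fix k :: nat
  have "g absolutely_integrable_on (cball 0 (real k))" using assms by (simp add: locally_integrable_def)
  thus "(\<lambda>x. indicator (cball 0 (real k)) x *\<^sub>R g x) \<in> borel_measurable lebesgue"
    unfolding set_integrable_def by (rule borel_measurable_integrable)
next
  fix x :: 'a
  obtain K :: nat where K: "norm x \<le> real K" using real_arch_simple by blast
  have "\<forall>\<^sub>F k in sequentially. indicator (cball 0 (real k)) x *\<^sub>R g x = g x"
    using eventually_ge_at_top[of K]
  proof eventually_elim
    case (elim k)
    hence "norm x \<le> real k" using K by simp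
    thus ?case by (simp add: indicator_def)
  qed
  thus "(\<lambda>k. indicator (cball 0 (real k)) x *\<^sub>R g x) \<longlonglongrightarrow> g x"
    by (rule tendsto_eventually)
qed

lemma powr_le_one_add:
  assumes "0 \<le> t" "0 \<le> \<theta>" "\<theta> \<le> 1" shows "t powr \<theta> \<le> 1 + (t::real)"
proof (cases "t \<le> 1")
  case True
  have "t powr \<theta> \<le> 1 powr \<theta>" using assms True by (intro powr_mono2) auto
  thus ?thesis using assms by simp
next
  case False
  hence "t powr \<theta> \<le> t powr 1" using assms by (intro powr_mono) auto
  thus ?thesis using False by simp
qed

text \<open>On a small cube let \<open>V\<close> be the mean of \<open>\<omega>\<^sup>s\<close>. The condition \<open>A\<^sub>1\<close> says that \<open>V \<le> A \<omega>\<^sup>s\<close> almost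
  everywhere on the cube, which is the lower bound with \<open>m = (V/A)\<^bsup>1/s\<^esup>\<close>. For \<open>\<theta> \<le> s\<close> the mean of
  \<open>\<omega>\<^sup>\<theta>\<close> is controlled by \<open>V\<^bsup>\<theta>/s\<^esup>\<close>, a constant times \<open>m\<^sup>\<theta>\<close>, in the manner of Jensen's inequality.\<close>

lemma A1_loc_bounds:
  fixes \<omega> :: "real^'n \<Rightarrow> real"
  assumes A1: "(\<lambda>x. \<omega> x powr s) \<in> A1_loc" and s: "s > 0"
    and meas: "\<omega> \<in> borel_measurable lebesgue" and pos: "AE x in lebesgue. \<omega> x > 0"
  obtains A :: real where "A > 0"
    "\<forall>Q\<in>small_cubes. \<exists>m>0. (AE x in lebesgue. x \<in> Q \<longrightarrow> m \<le> \<omega> x) \<and>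
       (\<forall>\<theta>. 0 < \<theta> \<and> \<theta> \<le> s \<longrightarrow>
          (\<integral>\<^sup>+x\<in>Q. ennreal (\<omega> x powr \<theta>) \<partial>lebesgue) \<le> ennreal (2 * A powr (\<theta> / s) * m powr \<theta> * measure lebesgue Q))"
proof -
  let ?v = "\<lambda>x. \<omega> x powr s"
  define S where "S = (SUP Q\<in>small_cubes. ennreal (1 / measure lebesgue Q) * (\<integral>\<^sup>+x\<in>Q. ennreal (?v x) \<partial>lebesgue)
        * esssup (restrict_space lebesgue (Q::(real^'n) set)) (\<lambda>x. inverse (ennreal (?v x))))"
  have S: "S < \<infinity>" and li: "locally_integrable ?v" using A1 unfolding A1_loc_def S_def by auto
  \<comment> \<open>The summand \<open>1\<close> makes the constant positive.\<close>
  define A where "A = enn2real S + 1"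
  have "S = ennreal (enn2real S)" using S by simp
  also have "\<dots> \<le> ennreal A" unfolding A_def by (intro ennreal_leI) simp
  finally have A: "A > 0" "S \<le> ennreal A" unfolding A_def by (simp_all add: add_nonneg_pos)
  note [measurable] = meas
  have "\<exists>m>0. (AE x in lebesgue. x \<in> Q \<longrightarrow> m \<le> \<omega> x) \<and>
       (\<forall>\<theta>. 0 < \<theta> \<and> \<theta> \<le> s \<longrightarrow>
          (\<integral>\<^sup>+x\<in>Q. ennreal (\<omega> x powr \<theta>) \<partial>lebesgue) \<le> ennreal (2 * A powr (\<theta> / s) * m powr \<theta> * measure lebesgue Q))"
    if Q: "Q \<in> small_cubes" for Q
  proof -
    obtain z t where Qt: "Q = cube z t" "t > 0" using Q by (auto simp: small_cubes_def)
    define \<mu> where "\<mu> = measure lebesgue Q"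
    have \<mu>: "\<mu> > 0" and em: "emeasure lebesgue Q = ennreal \<mu>" 
      using Qt by (auto simp: \<mu>_def measure_cube emeasure_cube)
    have Qs [measurable]: "Q \<in> sets lebesgue" by (simp add: Qt cube_eq_cbox)
    define I where "I = (\<integral>\<^sup>+x\<in>Q. ennreal (?v x) \<partial>lebesgue)"
    have "?v absolutely_integrable_on Q" 
      using li by (simp add: locally_integrable_def Qt cube_eq_cbox)
    hence "integrable lebesgue (\<lambda>x. indicator Q x *\<^sub>R ?v x)" by (simp add: set_integrable_def)
    hence "(\<integral>\<^sup>+x. ennreal (norm (indicator Q x *\<^sub>R ?v x)) \<partial>lebesgue) < \<infinity>"
      unfolding integrable_iff_bounded by blast
    also have "(\<integral>\<^sup>+x. ennreal (norm (indicator Q x *\<^sub>R ?v x)) \<partial>lebesgue) = I"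
      unfolding I_def by (intro nn_integral_cong) (auto simp: indicator_def)
    finally have Ifin: "I < \<infinity>" .
    have Ipos: "I > 0"
    proof (rule ccontr)
      assume "\<not> I > 0"
      hence "I = 0" by simp
      hence "AE x in lebesgue. ennreal (?v x) * indicator Q x = 0"
        unfolding I_def by (subst (asm) nn_integral_0_iff_AE) auto
      with pos have "AE x in lebesgue. x \<notin> Q"
        by eventually_elim (auto simp: indicator_def split: if_splits)
      hence "emeasure lebesgue Q = 0"
        using Qs by (subst (asm) AE_iff_measurable[where N = Q]) auto
      thus False using em \<mu> by simp
    qed
    define i where "i = enn2real I"
    have i: "I = ennreal i" "i > 0" using Ifin Ipos by (simp_all add: i_def enn2real_positive_iff)
    define V where "V = i / \<mu>"
    have V: "V > 0" using i \<mu> by (simp add: V_def)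
    define m where "m = (V / A) powr (1 / s)"
    have m: "m > 0" using V A by (simp add: m_def)
    have ms: "m powr \<theta> = V powr (\<theta> / s) * A powr (- \<theta> / s)" for \<theta>
    proof -
      have "m powr \<theta> = (V / A) powr (\<theta> / s)" by (simp add: m_def powr_powr)
      also have "\<dots> = V powr (\<theta> / s) / A powr (\<theta> / s)" by (rule powr_divide)
      finally show ?thesis by (simp add: powr_minus divide_inverse)
    qed
    define E where "E = esssup (restrict_space lebesgue Q) (\<lambda>x. inverse (ennreal (?v x)))"
    have "ennreal (1 / \<mu>) * I * E \<le> S"
      unfolding S_def E_def I_def \<mu>_def by (rule SUP_upper[OF Q])
    also have "ennreal (1 / \<mu>) * I = ennreal V" using i \<mu> by (simp add: V_def flip: ennreal_mult)
    finally have VE: "ennreal V * E \<le> ennreal A" using A(2) by (rule order_trans)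
    have "AE x in restrict_space lebesgue Q. inverse (ennreal (?v x)) \<le> E"
      unfolding E_def by (rule esssup_AE)
    hence "AE x in lebesgue. x \<in> Q \<longrightarrow> inverse (ennreal (?v x)) \<le> E"
      by (subst (asm) AE_restrict_space_iff) auto
    with pos have lower: "AE x in lebesgue. x \<in> Q \<longrightarrow> m \<le> \<omega> x"
    proof eventually_elim
      case (elim x)
      show ?case
      proof
        assume "x \<in> Q"
        hence "ennreal V * inverse (ennreal (?v x)) \<le> ennreal A"
          using elim by (intro order_trans[OF mult_left_mono VE]) auto
        moreover have "?v x > 0" using elim by simp
        ultimately have "ennreal (V * inverse (?v x)) \<le> ennreal A"
          using V by (simp add: inverse_ennreal ennreal_mult)
        hence "V * inverse (?v x) \<le> A" using A by simp
        hence "V / A \<le> ?v x" using \<open>?v x > 0\<close> A by (simp add: field_simps)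
        hence "m \<le> (?v x) powr (1 / s)" unfolding m_def using V A s by (intro powr_mono2) auto
        thus "m \<le> \<omega> x" using elim(1) s by (simp add: powr_powr)
      qed
    qed
    have upper: "(\<integral>\<^sup>+x\<in>Q. ennreal (\<omega> x powr \<theta>) \<partial>lebesgue) \<le> ennreal (2 * A powr (\<theta> / s) * m powr \<theta> * \<mu>)"
      if \<theta>: "0 < \<theta>" "\<theta> \<le> s" for \<theta>
    proof -
      have "(\<integral>\<^sup>+x\<in>Q. ennreal (\<omega> x powr \<theta>) \<partial>lebesgue) \<le> 
         (\<integral>\<^sup>+x. ennreal (V powr (\<theta> / s)) * (indicator Q x + ennreal (1 / V) * (ennreal (?v x) * indicator Q x)) \<partial>lebesgue)"
      proof (rule nn_integral_mono_AE)
        show "AE x in lebesgue. ennreal (\<omega> x powr \<theta>) * indicator Q x \<le>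
           ennreal (V powr (\<theta> / s)) * (indicator Q x + ennreal (1 / V) * (ennreal (?v x) * indicator Q x))"
          using pos
        proof eventually_elim
          case (elim x)
          \<comment> \<open>In place of Jensen: \<open>t\<^bsup>\<theta>/s\<^esup> \<le> 1 + t\<close> for the normalized weight, whose mean is \<open>1\<close>; hence the factor \<open>2\<close>.\<close>
          have "(?v x / V) powr (\<theta> / s) \<le> 1 + ?v x / V"
            using V \<theta> by (intro powr_le_one_add) auto
          moreover have "(?v x / V) powr (\<theta> / s) = \<omega> x powr \<theta> / V powr (\<theta> / s)"
            using V elim s by (simp add: powr_divide powr_powr)
          ultimately have "\<omega> x powr \<theta> \<le> V powr (\<theta> / s) * (1 + 1 / V * ?v x)"
            using V by (simp add: field_simps)
          hence "ennreal (\<omega> x powr \<theta>) \<le> ennreal (V powr (\<theta> / s) * (1 + 1 / V * ?v x))"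
            by (rule ennreal_leI)
          also have "\<dots> = ennreal (V powr (\<theta> / s)) * (1 + ennreal (1 / V) * ennreal (?v x))"
            using V by (simp only: ennreal_mult ennreal_plus powr_ge_zero zero_le_one ennreal_1
                mult_nonneg_nonneg add_nonneg_nonneg zero_le_divide_1_iff less_imp_le)
          finally have "ennreal (\<omega> x powr \<theta>) \<le> ennreal (V powr (\<theta> / s)) * (1 + ennreal (1 / V) * ennreal (?v x))" .
          thus ?case by (auto simp: indicator_def)
        qed
      qed
      also have "\<dots> = ennreal (V powr (\<theta> / s)) * (emeasure lebesgue Q + ennreal (1 / V) * I)"
        unfolding I_def by (simp add: nn_integral_cmult nn_integral_add)
      also have "ennreal (1 / V) * I = ennreal \<mu>"
      proof -
        have "1 / V * i = \<mu>" using i \<mu> by (simp add: V_def)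
        thus ?thesis unfolding i(1) using V i(2) by (subst ennreal_mult[symmetric]) simp_all
      qed
      also have "ennreal (V powr (\<theta> / s)) * (emeasure lebesgue Q + ennreal \<mu>) = ennreal (V powr (\<theta> / s) * (\<mu> + \<mu>))"
        using \<mu> by (simp only: em ennreal_mult ennreal_plus powr_ge_zero add_nonneg_nonneg less_imp_le)
      also have "V powr (\<theta> / s) * (\<mu> + \<mu>) = 2 * A powr (\<theta> / s) * m powr \<theta> * \<mu>"
        using A by (simp add: ms powr_minus)
      finally show ?thesis .
    qed
    show ?thesis using m lower upper unfolding \<mu>_def by blast
  qed
  thus ?thesis using that A(1) by blast
qed

text \<open>Both integrals are compared with the lower bound \<open>m\<close> of \<open>\<omega>\<close> on the cube: the one of \<open>\<omega>\<^sup>q\<close> is at most a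
  multiple of \<open>m\<^sup>q |Q|\<close>, the one of \<open>\<omega>\<^sup>p\<close> at least \<open>m\<^sup>p |Q|\<close>. The set \<open>Q'\<close> of full measure in \<open>Q\<close> lets the
  statement apply to half-open dyadic cubes.\<close>

lemma A1_loc_power_comparison:
  fixes \<omega> :: "real^'n \<Rightarrow> real"
  assumes A1: "(\<lambda>x. \<omega> x powr s) \<in> A1_loc"
    and meas: "\<omega> \<in> borel_measurable lebesgue" and pos: "AE x in lebesgue. \<omega> x > 0"
    and p: "0 < p" "p \<le> s" and q: "0 < q" "q \<le> s"
  obtains C :: real where "C > 0"
    "\<forall>Q\<in>small_cubes. \<forall>Q'\<in>sets lebesgue. Q' \<subseteq> Q \<and> emeasure lebesgue Q' = emeasure lebesgue Q \<longrightarrow>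
       (\<exists>P>0. (\<integral>\<^sup>+x\<in>Q'. ennreal (\<omega> x powr p) \<partial>lebesgue) = ennreal P \<and>
          (\<integral>\<^sup>+x\<in>Q'. ennreal (\<omega> x powr q) \<partial>lebesgue)
             \<le> ennreal (C * measure lebesgue Q powr (1 - q / p) * P powr (q / p)))"
proof -
  have s: "s > 0" using p by simp
  obtain A :: real where A: "A > 0"
    "\<forall>Q\<in>small_cubes. \<exists>m>0. (AE x in lebesgue. x \<in> Q \<longrightarrow> m \<le> \<omega> x) \<and>
       (\<forall>\<theta>. 0 < \<theta> \<and> \<theta> \<le> s \<longrightarrow>
          (\<integral>\<^sup>+x\<in>Q. ennreal (\<omega> x powr \<theta>) \<partial>lebesgue) \<le> ennreal (2 * A powr (\<theta> / s) * m powr \<theta> * measure lebesgue Q))"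
    using A1_loc_bounds[OF A1 s meas pos] by blast
  note [measurable] = meas
  have "\<exists>P>0. (\<integral>\<^sup>+x\<in>Q'. ennreal (\<omega> x powr p) \<partial>lebesgue) = ennreal P \<and>
          (\<integral>\<^sup>+x\<in>Q'. ennreal (\<omega> x powr q) \<partial>lebesgue)
             \<le> ennreal (2 * A powr (q / s) * measure lebesgue Q powr (1 - q / p) * P powr (q / p))"
    if Q: "Q \<in> small_cubes" and Q' [measurable]: "Q' \<in> sets lebesgue" and sub: "Q' \<subseteq> Q" 
      and em': "emeasure lebesgue Q' = emeasure lebesgue Q" for Q Q'
  proof -
    obtain z t where Qt: "Q = cube z t" "t > 0" using Q by (auto simp: small_cubes_def)
    define \<mu> where "\<mu> = measure lebesgue Q"
    have \<mu>: "\<mu> > 0" and em: "emeasure lebesgue Q = ennreal \<mu>" 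
      using Qt by (auto simp: \<mu>_def measure_cube emeasure_cube)
    obtain m where m: "m > 0" "AE x in lebesgue. x \<in> Q \<longrightarrow> m \<le> \<omega> x"
      "\<And>\<theta>. 0 < \<theta> \<Longrightarrow> \<theta> \<le> s \<Longrightarrow>
          (\<integral>\<^sup>+x\<in>Q. ennreal (\<omega> x powr \<theta>) \<partial>lebesgue) \<le> ennreal (2 * A powr (\<theta> / s) * m powr \<theta> * \<mu>)"
      using A(2) Q unfolding \<mu>_def by blast
    have le: "(\<integral>\<^sup>+x\<in>Q'. ennreal (\<omega> x powr \<theta>) \<partial>lebesgue) \<le> ennreal (2 * A powr (\<theta> / s) * m powr \<theta> * \<mu>)"
      if "0 < \<theta>" "\<theta> \<le> s" for \<theta>
      using sub by (intro order_trans[OF nn_integral_mono m(3)[OF that]] mult_left_mono) (auto simp: indicator_def)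
    define J where "J = (\<integral>\<^sup>+x\<in>Q'. ennreal (\<omega> x powr p) \<partial>lebesgue)"
    have Jfin: "J < \<infinity>" unfolding J_def using le[OF p] by (rule order_le_less_trans) simp
    have "ennreal (m powr p * \<mu>) = (\<integral>\<^sup>+x. ennreal (m powr p) * indicator Q' x \<partial>lebesgue)"
      using \<mu> by (simp add: nn_integral_cmult em' em ennreal_mult)
    also have "\<dots> \<le> J" unfolding J_def
    proof (rule nn_integral_mono_AE)
      show "AE x in lebesgue. ennreal (m powr p) * indicator Q' x \<le> ennreal (\<omega> x powr p) * indicator Q' x"
        using m(2)
      proof eventually_elim
        case (elim x)
        show ?case using elim sub m(1) p(1)
          by (cases "x \<in> Q'") (auto intro!: ennreal_leI powr_mono2)
      qed
    qed
    finally have Jge: "ennreal (m powr p * \<mu>) \<le> J" .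
    define P where "P = enn2real J"
    have JP: "J = ennreal P" using Jfin by (simp add: P_def)
    have Pge: "m powr p * \<mu> \<le> P" using Jge unfolding JP
      by (simp add: ennreal_le_iff P_def)
    have mp: "m powr p * \<mu> > 0" using m(1) \<mu> by simp
    hence P: "P > 0" using Pge by linarith
    have "m powr q * \<mu> = \<mu> powr (1 - q / p) * (m powr p * \<mu>) powr (q / p)"
      using m(1) \<mu> p(1) by (simp add: powr_mult powr_powr powr_diff)
    also have "\<dots> \<le> \<mu> powr (1 - q / p) * P powr (q / p)"
      using Pge mp p q by (intro mult_left_mono powr_mono2) auto
    finally have "2 * A powr (q / s) * m powr q * \<mu> \<le> 2 * A powr (q / s) * \<mu> powr (1 - q / p) * P powr (q / p)"
      using A(1) by (simp add: mult.assoc)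
    hence "(\<integral>\<^sup>+x\<in>Q'. ennreal (\<omega> x powr q) \<partial>lebesgue) \<le> ennreal (2 * A powr (q / s) * \<mu> powr (1 - q / p) * P powr (q / p))"
      by (intro order_trans[OF le[OF q]] ennreal_leI)
    thus ?thesis using P JP unfolding J_def \<mu>_def by blast
  qed
  thus ?thesis using that[of "2 * A powr (q / s)"] A(1) by simp
qed

lemma A1_loc_lower_bound:
  fixes \<omega> :: "real^'n \<Rightarrow> real"
  assumes A1: "(\<lambda>x. \<omega> x powr s) \<in> A1_loc" and s: "s > 0"
    and meas: "\<omega> \<in> borel_measurable lebesgue" and pos: "AE x in lebesgue. \<omega> x > 0"
    and Q: "Q \<in> small_cubes"
  obtains m where "m > 0" "AE x in lebesgue. x \<in> Q \<longrightarrow> m \<le> \<omega> x"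
proof -
  obtain A :: real where "\<forall>Q\<in>small_cubes. \<exists>m>0. (AE x in lebesgue. x \<in> Q \<longrightarrow> m \<le> \<omega> x) \<and>
       (\<forall>\<theta>. 0 < \<theta> \<and> \<theta> \<le> s \<longrightarrow>
          (\<integral>\<^sup>+x\<in>Q. ennreal (\<omega> x powr \<theta>) \<partial>lebesgue) \<le> ennreal (2 * A powr (\<theta> / s) * m powr \<theta> * measure lebesgue Q))"
    using A1_loc_bounds[OF A1 s meas pos] by blast
  thus ?thesis using Q that by blast
qed

section \<open>Dyadic cubes\<close>

text \<open>Labelling a cube by the integer parts of the scaled coordinates makes the cubes half-open, so
  that those of one level form a partition, indexed by a countable type.\<close>

definition dyadic_index :: "nat \<Rightarrow> real^'n \<Rightarrow> int^'n" where
  "dyadic_index j x = (\<chi> i. \<lfloor>2 ^ j * x $ i\<rfloor>)"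

definition dyadic_cube :: "nat \<Rightarrow> real^'n \<Rightarrow> (real^'n) set" where
  "dyadic_cube j x = {y. dyadic_index j y = dyadic_index j x}"

lemma mem_dyadic_cube: "y \<in> dyadic_cube j x \<longleftrightarrow> (\<forall>i. \<lfloor>2 ^ j * y $ i\<rfloor> = \<lfloor>2 ^ j * x $ i\<rfloor>)"
  by (simp add: dyadic_cube_def dyadic_index_def vec_eq_iff)

lemma dyadic_cube_self: "x \<in> dyadic_cube j x"
  by (simp add: dyadic_cube_def)

lemma dyadic_cube_eq: "y \<in> dyadic_cube j x \<Longrightarrow> dyadic_cube j y = dyadic_cube j x"
  by (auto simp: dyadic_cube_def)

lemma dyadic_cube_Suc: "dyadic_cube (Suc j) x \<subseteq> dyadic_cube j x"
proof
  fix y assume y: "y \<in> dyadic_cube (Suc j) x"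
  have half: "\<lfloor>2 ^ j * z\<rfloor> = \<lfloor>2 ^ Suc j * z\<rfloor> div 2" for z :: real
  proof -
    have "\<lfloor>2 ^ Suc j * z\<rfloor> div 2 = \<lfloor>2 ^ Suc j * z / 2\<rfloor>"
      by (metis floor_divide_real_eq_div of_int_numeral zero_le_numeral)
    thus ?thesis by simp
  qed
  show "y \<in> dyadic_cube j x" using y unfolding mem_dyadic_cube half by simp
qed

lemma dyadic_cube_diff:
  assumes "y \<in> dyadic_cube j x" shows "\<bar>x $ i - y $ i\<bar> \<le> 1 / 2 ^ j"
proof -
  have "\<lfloor>2 ^ j * y $ i\<rfloor> = \<lfloor>2 ^ j * x $ i\<rfloor>" using assms by (simp add: mem_dyadic_cube)
  hence "\<bar>2 ^ j * x $ i - 2 ^ j * y $ i\<bar> \<le> 1"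
    using floor_correct[of "2 ^ j * y $ i"] floor_correct[of "2 ^ j * x $ i"] by linarith
  hence "2 ^ j * \<bar>x $ i - y $ i\<bar> \<le> 1" by (simp add: abs_mult flip: right_diff_distrib)
  thus ?thesis by (simp add: field_simps)
qed

lemma dyadic_index_measurable: "dyadic_index j \<in> measurable lebesgue (count_space UNIV)"
proof -
  have "dyadic_index j -` {a} \<in> sets borel" for a
  proof -
    have "dyadic_index j -` {a} = (\<Inter>i. {y. of_int (a $ i) \<le> 2 ^ j * y $ i \<and> 2 ^ j * y $ i < of_int (a $ i) + 1})"
      by (auto simp: dyadic_index_def vec_eq_iff floor_eq_iff)
    also have "\<dots> \<in> sets borel"
      by (intro sets.finite_INT) auto
    finally show ?thesis .
  qed
  hence "dyadic_index j \<in> measurable borel (count_space UNIV)"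
    by (subst measurable_count_space_eq_countable) auto
  thus ?thesis by (intro measurable_completion) simp
qed

lemma dyadic_cube_sets: "dyadic_cube j x \<in> sets lebesgue"
proof -
  have "dyadic_index j -` {dyadic_index j x} \<inter> space lebesgue \<in> sets lebesgue"
    by (rule measurable_sets[OF dyadic_index_measurable]) simp
  thus ?thesis by (simp add: dyadic_cube_def vimage_def)
qed

text \<open>A dyadic cube lies between an open box and a closed cube with the same side, which have the same
  measure.\<close>

lemma dyadic_cube_small:
  fixes x :: "real^'n"
  obtains Q where "Q \<in> small_cubes" "dyadic_cube j x \<subseteq> Q" "emeasure lebesgue (dyadic_cube j x) = emeasure lebesgue Q"
    "measure lebesgue Q = (1 / 2 ^ j) ^ CARD('n)"
proof -
  define c :: "real^'n" where "c = (\<chi> i. (of_int \<lfloor>2 ^ j * x $ i\<rfloor> + 1 / 2) / 2 ^ j)"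
  let ?t = "1 / 2 ^ j :: real"
  let ?Q = "cube c ?t"
  let ?l = "\<chi> i. c $ i - ?t / 2" and ?u = "\<chi> i. c $ i + ?t / 2"
  have lu: "?l $ i = of_int \<lfloor>2 ^ j * x $ i\<rfloor> / 2 ^ j" "?u $ i = (of_int \<lfloor>2 ^ j * x $ i\<rfloor> + 1) / 2 ^ j" for i
    by (simp_all add: c_def field_simps)
  have sub: "dyadic_cube j x \<subseteq> ?Q"
  proof
    fix y assume "y \<in> dyadic_cube j x"
    hence "\<lfloor>2 ^ j * y $ i\<rfloor> = \<lfloor>2 ^ j * x $ i\<rfloor>" for i by (simp add: mem_dyadic_cube)
    hence "of_int \<lfloor>2 ^ j * x $ i\<rfloor> \<le> 2 ^ j * y $ i \<and> 2 ^ j * y $ i < of_int \<lfloor>2 ^ j * x $ i\<rfloor> + 1" for i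
      using floor_correct[of "2 ^ j * y $ i"] by simp
    hence "?l $ i \<le> y $ i \<and> y $ i \<le> ?u $ i" for i
      unfolding lu by (simp add: field_simps less_imp_le)
    thus "y \<in> ?Q" by (simp add: cube_eq_cbox mem_box_cart)
  qed
  have sup: "box ?l ?u \<subseteq> dyadic_cube j x"
  proof
    fix y assume "y \<in> box ?l ?u"
    hence "?l $ i < y $ i \<and> y $ i < ?u $ i" for i by (simp add: mem_box_cart)
    hence "of_int \<lfloor>2 ^ j * x $ i\<rfloor> \<le> 2 ^ j * y $ i \<and> 2 ^ j * y $ i < of_int \<lfloor>2 ^ j * x $ i\<rfloor> + 1" for i
      unfolding lu by (simp add: field_simps less_imp_le)
    thus "y \<in> dyadic_cube j x" unfolding mem_dyadic_cube by (simp add: floor_eq_iff)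
  qed
  have "emeasure lebesgue (box ?l ?u) = emeasure lebesgue ?Q"
    unfolding cube_eq_cbox by (simp add: emeasure_lborel_box_eq emeasure_lborel_cbox_eq)
  moreover have "emeasure lebesgue (box ?l ?u) \<le> emeasure lebesgue (dyadic_cube j x)"
    by (rule emeasure_mono[OF sup dyadic_cube_sets])
  moreover have "emeasure lebesgue (dyadic_cube j x) \<le> emeasure lebesgue ?Q"
    by (rule emeasure_mono[OF sub]) (simp add: cube_eq_cbox)
  ultimately have "emeasure lebesgue (dyadic_cube j x) = emeasure lebesgue ?Q" by simp
  moreover have "?Q \<in> small_cubes" by (rule cube_small) (simp_all add: divide_le_eq_1)
  ultimately show ?thesis using that[OF _ sub] measure_cube[of ?t c] by simp
qed

lemma dyadic_constant_measurable:
  fixes F :: "real^'n \<Rightarrow> 'b::topological_space"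
  assumes "\<And>x y. y \<in> dyadic_cube j x \<Longrightarrow> F y = F x"
  shows "F \<in> borel_measurable lebesgue"
proof -
  define F' where "F' k = F (SOME x. dyadic_index j x = k)" for k
  have "F x = F' (dyadic_index j x)" for x
    unfolding F'_def
    by (rule someI2[of "\<lambda>y. dyadic_index j y = dyadic_index j x" x])
       (auto simp: dyadic_cube_def intro: assms[symmetric])
  hence "F = F' \<circ> dyadic_index j" by auto
  thus ?thesis using measurable_comp[OF dyadic_index_measurable, of F' borel] by simp
qed

text \<open>The cubes of one level are a countable measurable partition of the space.\<close>

lemma nn_integral_dyadic_mono:
  fixes F G :: "real^'n \<Rightarrow> ennreal"
  assumes F: "F \<in> borel_measurable lebesgue" and G: "G \<in> borel_measurable lebesgue"
    and le: "\<And>x. (\<integral>\<^sup>+y\<in>dyadic_cube j x. F y \<partial>lebesgue) \<le> (\<integral>\<^sup>+y\<in>dyadic_cube j x. G y \<partial>lebesgue)"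
  shows "(\<integral>\<^sup>+y. F y \<partial>lebesgue) \<le> (\<integral>\<^sup>+y. G y \<partial>lebesgue)"
proof -
  define A where "A k = {y::real^'n. to_nat (dyadic_index j y) = k}" for k
  have A_cases: "A k = {} \<or> (\<exists>x. A k = dyadic_cube j x)" for k
  proof (cases "A k = {}")
    case False
    then obtain x where "x \<in> A k" by blast
    hence "to_nat (dyadic_index j x) = k" by (simp add: A_def)
    hence "A k = dyadic_cube j x" by (auto simp: A_def dyadic_cube_def)
    thus ?thesis by blast
  qed simp
  have A_sets: "A k \<in> sets lebesgue" for k using A_cases[of k] dyadic_cube_sets by auto
  have split: "(\<integral>\<^sup>+y. F y \<partial>lebesgue) = (\<Sum>k. \<integral>\<^sup>+y\<in>A k. F y \<partial>lebesgue)" 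
    if "F \<in> borel_measurable lebesgue" for F :: "real^'n \<Rightarrow> ennreal"
  proof -
    have "(\<Sum>k. F y * indicator (A k) y) = F y" for y
    proof -
      have "(\<Sum>k. F y * indicator (A k) y) = (\<Sum>k\<in>{to_nat (dyadic_index j y)}. F y * indicator (A k) y)"
        by (rule suminf_finite) (auto simp: A_def)
      thus ?thesis by (simp add: A_def)
    qed
    hence "(\<integral>\<^sup>+y. F y \<partial>lebesgue) = (\<integral>\<^sup>+y. (\<Sum>k. F y * indicator (A k) y) \<partial>lebesgue)" by simp
    also have "\<dots> = (\<Sum>k. \<integral>\<^sup>+y\<in>A k. F y \<partial>lebesgue)"
      using that A_sets by (intro nn_integral_suminf) auto
    finally show ?thesis .
  qed
  have "(\<integral>\<^sup>+y\<in>A k. F y \<partial>lebesgue) \<le> (\<integral>\<^sup>+y\<in>A k. G y \<partial>lebesgue)" for k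
    using A_cases[of k] le by auto
  thus ?thesis unfolding split[OF F] split[OF G] by (intro suminf_le) auto
qed

section \<open>Elementary inequalities for powers\<close>

lemma powr_add_le:
  fixes a b :: real
  assumes "0 \<le> a" "0 \<le> b" "0 < p" "p \<le> 1" shows "(a + b) powr p \<le> a powr p + b powr p"
proof (cases "a + b = 0")
  case True
  thus ?thesis using assms by simp
next
  case False
  hence s: "a + b > 0" using assms by linarith
  have *: "t / (a + b) \<le> t powr p / (a + b) powr p" if "0 \<le> t" "t \<le> a + b" for t
  proof -
    have "(t / (a + b)) powr 1 \<le> (t / (a + b)) powr p"
      using that s assms by (intro powr_mono') auto
    thus ?thesis using that s by (simp add: powr_divide)
  qed
  have "1 = a / (a + b) + b / (a + b)" using s by (simp flip: add_divide_distrib)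
  also have "\<dots> \<le> a powr p / (a + b) powr p + b powr p / (a + b) powr p"
    using assms by (intro add_mono *) auto
  finally show ?thesis using s by (simp add: field_simps)
qed

lemma powr_sum_le:
  fixes x :: "'i \<Rightarrow> real"
  assumes "finite A" "\<And>i. i \<in> A \<Longrightarrow> 0 \<le> x i" "0 < p" "p \<le> 1"
  shows "(\<Sum>i\<in>A. x i) powr p \<le> (\<Sum>i\<in>A. x i powr p)"
  using assms(1,2)
proof (induction A rule: finite_induct)
  case (insert i A)
  have "(x i + sum x A) powr p \<le> x i powr p + sum x A powr p"
    using insert.prems assms by (intro powr_add_le sum_nonneg) auto
  also have "\<dots> \<le> x i powr p + (\<Sum>i\<in>A. x i powr p)" using insert by simp
  finally show ?case using insert by simp
qed simp

text \<open>Young's inequality for \<open>x\<^sup>m\<close> and \<open>1\<close> with exponents \<open>1/m\<close> and \<open>1 - 1/m\<close>.\<close>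

lemma powr_Bernoulli:
  fixes x m :: real
  assumes "x \<ge> 0" "m \<ge> 1" shows "x powr m \<ge> 1 + m * (x - 1)"
proof (cases "x = 0")
  case True thus ?thesis using assms by simp
next
  case False
  have "(x powr m) powr (1 / m) * 1 powr (1 - 1 / m) \<le> (1 / m) * x powr m + (1 - 1 / m) * 1"
    using assms False by (intro Youngs_inequality_0) auto
  hence "x \<le> x powr m / m + 1 - 1 / m" using assms False by (simp add: powr_powr)
  hence "m * x \<le> m * (x powr m / m + 1 - 1 / m)" using assms by (intro mult_left_mono) auto
  also have "\<dots> = x powr m + m - 1" using assms by (simp add: field_simps)
  finally show ?thesis by (simp add: algebra_simps)
qed

text \<open>Jensen's inequality for \<open>t \<mapsto> t\<^sup>m\<close> with weights that need not sum to \<open>1\<close>, from the tangent at the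
  weighted mean.\<close>

lemma powr_weighted_sum_le:
  fixes w t :: "'i \<Rightarrow> real"
  assumes "finite A" "\<And>i. i \<in> A \<Longrightarrow> 0 \<le> w i" "\<And>i. i \<in> A \<Longrightarrow> 0 \<le> t i" "m \<ge> 1"
  shows "(\<Sum>i\<in>A. w i * t i) powr m \<le> (\<Sum>i\<in>A. w i) powr (m - 1) * (\<Sum>i\<in>A. w i * t i powr m)"
proof -
  define W where "W = (\<Sum>i\<in>A. w i)" define S where "S = (\<Sum>i\<in>A. w i * t i)"
  have W0: "W \<ge> 0" and S0: "S \<ge> 0" unfolding W_def S_def using assms by (auto intro!: sum_nonneg)
  have R0: "(\<Sum>i\<in>A. w i * t i powr m) \<ge> 0" using assms by (auto intro!: sum_nonneg)
  show ?thesis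
  proof (cases "S = 0")
    case True thus ?thesis using R0 assms(4) unfolding S_def[symmetric] by simp
  next
    case False
    have "W \<noteq> 0"
    proof
      assume "W = 0"
      hence "\<forall>i\<in>A. w i = 0" unfolding W_def using assms by (simp add: sum_nonneg_eq_0_iff)
      thus False using False by (simp add: S_def)
    qed
    hence W: "W > 0" and S: "S > 0" using W0 S0 False by auto
    define s where "s = S / W"
    have s: "s > 0" using W S by (simp add: s_def)
    \<comment> \<open>The tangent of \<open>t\<^sup>m\<close> at the mean \<open>s\<close>; its linear part cancels in the weighted sum.\<close>
    have tl: "s powr m * (1 + m * (t i / s - 1)) \<le> t i powr m" if "i \<in> A" for i
    proof -
      have "1 + m * (t i / s - 1) \<le> (t i / s) powr m" using assms that s by (intro powr_Bernoulli) auto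
      also have "\<dots> = t i powr m / s powr m" using assms(3)[OF that] s by (simp add: powr_divide)
      finally show ?thesis using s by (simp add: field_simps)
    qed
    have "W * s powr m = s powr m * (W + m * (S / s - W))"
      using s W by (simp add: s_def)
    also have "\<dots> = (\<Sum>i\<in>A. w i * (s powr m * (1 + m * (t i / s - 1))))"
      unfolding W_def S_def
      by (simp add: sum_distrib_left sum_distrib_right sum.distrib sum_subtractf algebra_simps sum_divide_distrib)
    also have "\<dots> \<le> (\<Sum>i\<in>A. w i * t i powr m)"
      using assms tl by (intro sum_mono mult_left_mono) auto
    finally have *: "W * s powr m \<le> (\<Sum>i\<in>A. w i * t i powr m)" .
    have "S powr m = W powr (m - 1) * (W * s powr m)"
      using W S by (simp add: s_def powr_divide powr_diff)
    also have "\<dots> \<le> W powr (m - 1) * (\<Sum>i\<in>A. w i * t i powr m)"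
      using * by (intro mult_left_mono) auto
    finally show ?thesis unfolding W_def S_def .
  qed
qed

section \<open>The dyadic fractional inequality\<close>

text \<open>For \<open>0 \<le> \<rho> < 1\<close> and \<open>a \<ge> 0\<close> this bounds a geometric sum of values by a multiple of the geometric
  sum of increments.\<close>

lemma sum_by_parts_geometric:
  fixes a :: "nat \<Rightarrow> real"
  assumes e: "\<And>j. e j = (if j = 0 then a 0 else a j - a (j - 1))"
  shows "(1 - \<rho>) * (\<Sum>j\<le>J. \<rho> ^ j * a j) = (\<Sum>i\<le>J. \<rho> ^ i * e i) - \<rho> ^ Suc J * a J"
    and "(\<Sum>i\<le>J. e i) = a J"
  by (induction J) (simp_all add: e algebra_simps)

text \<open>The pointwise half of the dyadic inequality. Passing to \<open>p\<close>-th powers first makes the increments \<open>e\<close>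
  sum exactly to \<open>b\<^sub>J\<^sup>p\<close>, whereas for \<open>p < 1\<close> the \<open>p\<close>-th powers of the increments of \<open>b\<close> are not controlled
  by \<open>b\<^sub>J\<^sup>p\<close>. The weights
  \<open>e\<^sub>i W\<^sub>i\<close> in Jensen's inequality are chosen because their sum is bounded by the right-hand side of the
  final estimate.\<close>

lemma dyadic_fractional_pointwise:
  fixes b W :: "nat \<Rightarrow> real"
  assumes p: "0 < p" "p \<le> 1" and q: "p \<le> q" and \<alpha>: "\<alpha> > 0"
    and b0: "\<And>j. 0 \<le> b j" and bmono: "\<And>j. b j \<le> b (Suc j)" and W: "\<And>j. W j > 0"
    and e: "\<And>j. e j = (if j = 0 then b 0 powr p else b j powr p - b (j - 1) powr p)"
    and H: "(\<Sum>i\<le>J. e i * W i) \<le> H"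
  shows "(\<Sum>j\<le>J. 2 powr (- real j * \<alpha>) * b j) powr q \<le>
    (1 / (1 - 2 powr (- (\<alpha> * p)))) powr (q / p) * H powr (q / p - 1) *
      (\<Sum>i\<le>J. e i * W i * (2 powr (- real i * (\<alpha> * p)) / W i) powr (q / p))"
proof -
  define m where "m = q / p"
  define \<rho> :: real where "\<rho> = 2 powr (- (\<alpha> * p))"
  have m: "m \<ge> 1" using p q by (simp add: m_def)
  have \<rho>: "0 < \<rho>" "\<rho> < 1" using p \<alpha> by (simp_all add: \<rho>_def powr_less_one)
  have \<rho>j: "2 powr (- real j * (\<alpha> * p)) = \<rho> ^ j" for j
    by (simp add: \<rho>_def powr_power mult.commute)
  have e0: "e j \<ge> 0" for j
    using bmono[of "j - 1"] b0 p by (auto simp: e intro!: powr_mono2)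
  let ?T = "\<Sum>j\<le>J. 2 powr (- real j * \<alpha>) * b j"
  let ?Y = "\<Sum>i\<le>J. \<rho> ^ i * e i"
  have T0: "?T \<ge> 0" using b0 by (intro sum_nonneg) auto
  have "?T powr p \<le> (\<Sum>j\<le>J. (2 powr (- real j * \<alpha>) * b j) powr p)"
    using b0 p by (intro powr_sum_le) auto
  also have "\<dots> = (\<Sum>j\<le>J. \<rho> ^ j * b j powr p)"
    using b0 by (intro sum.cong) (auto simp: powr_mult powr_powr mult.assoc simp flip: \<rho>j)
  also have "\<dots> \<le> 1 / (1 - \<rho>) * ?Y"
  proof -
    have "(1 - \<rho>) * (\<Sum>j\<le>J. \<rho> ^ j * b j powr p) \<le> ?Y"
      using sum_by_parts_geometric(1)[of e "\<lambda>j. b j powr p" \<rho> J] e \<rho> by simp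
    thus ?thesis using \<rho> by (simp add: field_simps)
  qed
  finally have "(?T powr p) powr m \<le> (1 / (1 - \<rho>) * ?Y) powr m"
    using m by (intro powr_mono2) auto
  hence "?T powr q \<le> (1 / (1 - \<rho>)) powr m * ?Y powr m"
    unfolding powr_mult using p by (simp add: powr_powr m_def)
  also have "?Y powr m \<le> H powr (m - 1) * (\<Sum>i\<le>J. e i * W i * (\<rho> ^ i / W i) powr m)"
  proof -
    have "?Y = (\<Sum>i\<le>J. (e i * W i) * (\<rho> ^ i / W i))"
      using W by (intro sum.cong) (auto simp: less_imp_neq[symmetric])
    also have "\<dots> powr m \<le> (\<Sum>i\<le>J. e i * W i) powr (m - 1) * (\<Sum>i\<le>J. e i * W i * (\<rho> ^ i / W i) powr m)"
      using m e0 W \<rho> by (intro powr_weighted_sum_le) (auto intro!: divide_nonneg_pos simp: less_imp_le)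
    also have "\<dots> \<le> H powr (m - 1) * (\<Sum>i\<le>J. e i * W i * (\<rho> ^ i / W i) powr m)"
      using m e0 W H by (intro mult_right_mono powr_mono2 sum_nonneg) (auto simp: less_imp_le)
    finally show ?thesis .
  qed
  finally show ?thesis
    unfolding m_def[symmetric] \<rho>j \<rho>_def[symmetric] by (simp add: mult.assoc mult_left_mono)
qed

text \<open>Any increasing sequence \<open>b\<close> of functions that are constant on the dyadic cubes of their level is
  admitted; \<open>u\<close> and \<open>v\<close> stand for \<open>\<omega>\<^sup>p\<close> and \<open>\<omega>\<^sup>q\<close>. The bound \<open>H\<close> is used twice: once at a point, for the
  sum of the Jensen weights, and once after integration.\<close>

lemma dyadic_fractional_inequality:
  fixes u v :: "real^'n \<Rightarrow> real" and b :: "nat \<Rightarrow> real^'n \<Rightarrow> real"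
  assumes p: "0 < p" "p \<le> 1" and q: "p \<le> q" and \<alpha>: "\<alpha> > 0" and C: "C > 0" and H0: "H \<ge> 0"
    and meas [measurable]: "u \<in> borel_measurable lebesgue" "v \<in> borel_measurable lebesgue"
    and W: "\<And>j x. W j x > 0" "\<And>j x. (\<integral>\<^sup>+y\<in>dyadic_cube j x. ennreal (u y) \<partial>lebesgue) = ennreal (W j x)"
    and comp: "\<And>j x. (\<integral>\<^sup>+y\<in>dyadic_cube j x. ennreal (v y) \<partial>lebesgue)
                 \<le> ennreal (C * 2 powr (real j * \<alpha> * q) * W j x powr (q / p))"
    and b0: "\<And>j x. 0 \<le> b j x" and bmono: "\<And>j x. b j x \<le> b (Suc j) x"
    and bconst: "\<And>j x y. y \<in> dyadic_cube j x \<Longrightarrow> b j y = b j x"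
    and H: "\<And>J. (\<integral>\<^sup>+x. ennreal (b J x powr p) * ennreal (u x) \<partial>lebesgue) \<le> ennreal H"
  shows "(\<integral>\<^sup>+x. ennreal ((\<Sum>j\<le>J. 2 powr (- real j * \<alpha>) * b j x) powr q) * ennreal (v x) \<partial>lebesgue)
     \<le> ennreal ((1 / (1 - 2 powr (- (\<alpha> * p)))) powr (q / p) * C * H powr (q / p))"
proof -
  define m where "m = q / p"
  define c :: real where "c = 1 / (1 - 2 powr (- (\<alpha> * p)))"
  define g :: "nat \<Rightarrow> real" where "g i = 2 powr (- real i * (\<alpha> * p))" for i
  define e where "e j x = (if j = 0 then b 0 x powr p else b j x powr p - b (j - 1) x powr p)" for j x
  define k where "k i x = e i x * W i x * (g i / W i x) powr m" for i x
  have m: "m \<ge> 1" using p q by (simp add: m_def)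
  have e0: "e j x \<ge> 0" for j x
    using bmono[of "j - 1" x] b0 p by (auto simp: e_def intro!: powr_mono2)
  have k0: "k i x \<ge> 0" for i x unfolding k_def using e0 W(1) by (simp add: less_imp_le)
  have e_sum: "(\<Sum>i\<le>J. e i x) = b J x powr p" for J x
    using sum_by_parts_geometric(2)[of "\<lambda>j. e j x" "\<lambda>j. b j x powr p" J] by (simp add: e_def)
  have e_ennsum: "(\<Sum>i\<le>J. ennreal (e i x) * r) = ennreal (b J x powr p) * r" for J x r
  proof -
    have "(\<Sum>i\<le>J. ennreal (e i x)) = ennreal (b J x powr p)"
      using e0 by (subst sum_ennreal) (simp_all only: e_sum)
    thus ?thesis by (simp only: sum_distrib_right[symmetric])
  qed
  have econst: "e j y = e j x" if "y \<in> dyadic_cube j x" for j x y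
  proof (cases j)
    case 0 thus ?thesis using bconst[OF that] by (simp add: e_def)
  next
    case (Suc i)
    hence "y \<in> dyadic_cube i x" using that dyadic_cube_Suc by auto
    thus ?thesis using bconst[OF that] bconst[of y i x] Suc by (simp add: e_def)
  qed
  have Wconst: "W j y = W j x" if "y \<in> dyadic_cube j x" for j x y
  proof -
    have "ennreal (W j y) = ennreal (W j x)" using W(2)[of j y] W(2)[of j x] dyadic_cube_eq[OF that] by simp
    thus ?thesis using W(1)[of j y] W(1)[of j x] by (simp add: less_imp_le)
  qed
  have kconst: "k j y = k j x" if "y \<in> dyadic_cube j x" for j x y
    by (simp add: k_def econst[OF that] Wconst[OF that])
  have em [measurable]: "e j \<in> borel_measurable lebesgue" for j
    by (rule dyadic_constant_measurable[of j]) (rule econst)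
  have km [measurable]: "k j \<in> borel_measurable lebesgue" for j
    by (rule dyadic_constant_measurable[of j]) (rule kconst)
  note [measurable] = dyadic_cube_sets
  \<comment> \<open>For \<open>y\<close> in the \<open>i\<close>-th cube of \<open>x\<close>, \<open>e\<^sub>i(x) = e\<^sub>i(y)\<close>; so the increments at \<open>x\<close> that see \<open>y\<close> sum to at most
    \<open>b\<^sub>J(y)\<^sup>p\<close>.\<close>
  have mass: "(\<Sum>i\<le>J. e i x * W i x) \<le> H" for x
  proof -
    have "ennreal (\<Sum>i\<le>J. e i x * W i x) = (\<Sum>i\<le>J. ennreal (e i x) * (\<integral>\<^sup>+y\<in>dyadic_cube i x. ennreal (u y) \<partial>lebesgue))"
    proof -
      have "ennreal (\<Sum>i\<le>J. e i x * W i x) = (\<Sum>i\<le>J. ennreal (e i x * W i x))"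
        using e0 W(1) by (intro sum_ennreal[symmetric]) (simp add: less_imp_le)
      also have "\<dots> = (\<Sum>i\<le>J. ennreal (e i x) * ennreal (W i x))"
        by (intro sum.cong refl ennreal_mult e0 less_imp_le W(1))
      finally show ?thesis by (simp only: W(2))
    qed
    also have "\<dots> = (\<integral>\<^sup>+y. (\<Sum>i\<le>J. ennreal (e i x) * (ennreal (u y) * indicator (dyadic_cube i x) y)) \<partial>lebesgue)"
      by (simp add: nn_integral_sum nn_integral_cmult)
    also have "\<dots> \<le> (\<integral>\<^sup>+y. ennreal (b J y powr p) * ennreal (u y) \<partial>lebesgue)"
    proof (rule nn_integral_mono)
      fix y
      have "(\<Sum>i\<le>J. ennreal (e i x) * (ennreal (u y) * indicator (dyadic_cube i x) y)) \<le> (\<Sum>i\<le>J. ennreal (e i y) * ennreal (u y))"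
        by (intro sum_mono) (auto simp: indicator_def econst)
      also have "\<dots> = ennreal (b J y powr p) * ennreal (u y)"
        by (rule e_ennsum)
      finally show "(\<Sum>i\<le>J. ennreal (e i x) * (ennreal (u y) * indicator (dyadic_cube i x) y)) \<le> ennreal (b J y powr p) * ennreal (u y)" .
    qed
    also have "\<dots> \<le> ennreal H" by (rule H)
    finally show ?thesis using H0 by simp
  qed
  have level: "(\<integral>\<^sup>+x. ennreal (k i x) * ennreal (v x) \<partial>lebesgue) \<le> (\<integral>\<^sup>+x. ennreal C * (ennreal (e i x) * ennreal (u x)) \<partial>lebesgue)" for i
  proof (rule nn_integral_dyadic_mono[of _ _ i])
    fix x
    have "(\<integral>\<^sup>+y\<in>dyadic_cube i x. ennreal (k i y) * ennreal (v y) \<partial>lebesgue)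
        = (\<integral>\<^sup>+y. ennreal (k i x) * (ennreal (v y) * indicator (dyadic_cube i x) y) \<partial>lebesgue)"
      by (intro nn_integral_cong) (auto simp: indicator_def kconst)
    also have "\<dots> = ennreal (k i x) * (\<integral>\<^sup>+y\<in>dyadic_cube i x. ennreal (v y) \<partial>lebesgue)"
      by (simp add: nn_integral_cmult)
    also have "\<dots> \<le> ennreal (k i x) * ennreal (C * 2 powr (real i * \<alpha> * q) * W i x powr m)"
      unfolding m_def by (intro mult_left_mono comp) simp
    also have "\<dots> = ennreal (k i x * (C * 2 powr (real i * \<alpha> * q) * W i x powr m))"
      by (rule ennreal_mult[symmetric]) (use k0 C in auto)
    also have "k i x * (C * 2 powr (real i * \<alpha> * q) * W i x powr m) = C * (e i x * W i x)"
    proof -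
      have "g i powr m * 2 powr (real i * \<alpha> * q) = 1"
        using p by (simp add: g_def m_def powr_powr flip: powr_add)
      moreover have "(g i / W i x) powr m = g i powr m / W i x powr m" by (rule powr_divide)
      ultimately show ?thesis using W(1)[of i x] by (simp add: k_def)
    qed
    also have "ennreal (C * (e i x * W i x)) = ennreal C * (ennreal (e i x) * (\<integral>\<^sup>+y\<in>dyadic_cube i x. ennreal (u y) \<partial>lebesgue))"
      using C e0 W(1) by (simp add: W(2) ennreal_mult less_imp_le)
    also have "\<dots> = (\<integral>\<^sup>+y. ennreal C * (ennreal (e i x) * (ennreal (u y) * indicator (dyadic_cube i x) y)) \<partial>lebesgue)"
      by (simp add: nn_integral_cmult)
    also have "\<dots> = (\<integral>\<^sup>+y\<in>dyadic_cube i x. ennreal C * (ennreal (e i y) * ennreal (u y)) \<partial>lebesgue)"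
      by (intro nn_integral_cong) (auto simp: indicator_def econst)
    finally show "(\<integral>\<^sup>+y\<in>dyadic_cube i x. ennreal (k i y) * ennreal (v y) \<partial>lebesgue)
       \<le> (\<integral>\<^sup>+y\<in>dyadic_cube i x. ennreal C * (ennreal (e i y) * ennreal (u y)) \<partial>lebesgue)" .
  qed measurable
  have "(\<integral>\<^sup>+x. ennreal ((\<Sum>j\<le>J. 2 powr (- real j * \<alpha>) * b j x) powr q) * ennreal (v x) \<partial>lebesgue)
      \<le> (\<integral>\<^sup>+x. ennreal (c powr m * H powr (m - 1)) * (\<Sum>i\<le>J. ennreal (k i x) * ennreal (v x)) \<partial>lebesgue)"
  proof (rule nn_integral_mono)
    fix x
    have "(\<Sum>j\<le>J. 2 powr (- real j * \<alpha>) * b j x) powr q \<le> c powr m * H powr (m - 1) * (\<Sum>i\<le>J. k i x)"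
      unfolding c_def m_def k_def g_def
      by (rule dyadic_fractional_pointwise[OF p q \<alpha> b0 bmono W(1) e_def mass])
    hence "ennreal ((\<Sum>j\<le>J. 2 powr (- real j * \<alpha>) * b j x) powr q) \<le> ennreal (c powr m * H powr (m - 1) * (\<Sum>i\<le>J. k i x))"
      by (rule ennreal_leI)
    also have "\<dots> = ennreal (c powr m * H powr (m - 1)) * (\<Sum>i\<le>J. ennreal (k i x))"
    proof -
      have "(\<Sum>i\<le>J. ennreal (k i x)) = ennreal (\<Sum>i\<le>J. k i x)" using k0 by (intro sum_ennreal) simp
      moreover have "(\<Sum>i\<le>J. k i x) \<ge> 0" using k0 by (intro sum_nonneg) simp
      ultimately show ?thesis by (simp only:) (rule ennreal_mult, simp_all)
    qed
    finally have le: "ennreal ((\<Sum>j\<le>J. 2 powr (- real j * \<alpha>) * b j x) powr q) \<le> ennreal (c powr m * H powr (m - 1)) * (\<Sum>i\<le>J. ennreal (k i x))" .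
    have "ennreal ((\<Sum>j\<le>J. 2 powr (- real j * \<alpha>) * b j x) powr q) * ennreal (v x) \<le>
        (ennreal (c powr m * H powr (m - 1)) * (\<Sum>i\<le>J. ennreal (k i x))) * ennreal (v x)"
      by (rule mult_right_mono[OF le]) simp
    also have "\<dots> = ennreal (c powr m * H powr (m - 1)) * (\<Sum>i\<le>J. ennreal (k i x) * ennreal (v x))"
      by (simp only: sum_distrib_right mult.assoc)
    finally show "ennreal ((\<Sum>j\<le>J. 2 powr (- real j * \<alpha>) * b j x) powr q) * ennreal (v x) \<le>
        ennreal (c powr m * H powr (m - 1)) * (\<Sum>i\<le>J. ennreal (k i x) * ennreal (v x))" .
  qed
  also have "\<dots> = ennreal (c powr m * H powr (m - 1)) * (\<Sum>i\<le>J. \<integral>\<^sup>+x. ennreal (k i x) * ennreal (v x) \<partial>lebesgue)"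
    by (subst nn_integral_cmult) (simp_all add: nn_integral_sum)
  also have "\<dots> \<le> ennreal (c powr m * H powr (m - 1)) * (\<Sum>i\<le>J. \<integral>\<^sup>+x. ennreal C * (ennreal (e i x) * ennreal (u x)) \<partial>lebesgue)"
    by (intro mult_left_mono sum_mono level) simp
  also have "(\<Sum>i\<le>J. \<integral>\<^sup>+x. ennreal C * (ennreal (e i x) * ennreal (u x)) \<partial>lebesgue) =
      ennreal C * (\<integral>\<^sup>+x. (\<Sum>i\<le>J. ennreal (e i x) * ennreal (u x)) \<partial>lebesgue)"
    by (subst nn_integral_sum, measurable, subst sum_distrib_left, intro sum.cong refl nn_integral_cmult, measurable)
  also have "(\<integral>\<^sup>+x. (\<Sum>i\<le>J. ennreal (e i x) * ennreal (u x)) \<partial>lebesgue) = (\<integral>\<^sup>+x. ennreal (b J x powr p) * ennreal (u x) \<partial>lebesgue)"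
    by (simp only: e_ennsum)
  also have "ennreal (c powr m * H powr (m - 1)) * (ennreal C * \<dots>) \<le> ennreal (c powr m * H powr (m - 1)) * (ennreal C * ennreal H)"
    by (intro mult_left_mono H) auto
  also have "\<dots> = ennreal (c powr m * H powr (m - 1) * (C * H))"
    using C H0 by (simp add: ennreal_mult)
  also have "c powr m * H powr (m - 1) * (C * H) = c powr m * C * H powr m"
  proof (cases "H = 0")
    case False
    hence "H powr (m - 1) * H = H powr m" using H0 by (simp add: powr_diff)
    thus ?thesis by (simp add: mult_ac)
  qed (use m in simp)
  finally show ?thesis by (simp add: c_def m_def)
qed

section \<open>The dyadic potential of the grand maximal function\<close>

lemma epowr_mono:
  assumes "s > 0" "a \<le> b" shows "epowr a s \<le> epowr b s"
proof (cases "b = \<infinity>")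
  case False
  hence "a \<noteq> \<infinity>" using assms(2) by (auto simp: top_unique)
  moreover have "enn2real a \<le> enn2real b" using assms(2) False by (intro enn2real_mono) (auto simp: top.not_eq_extremum)
  ultimately show ?thesis using assms False
    by (auto simp: epowr_def intro!: ennreal_leI powr_mono2)
qed (use assms in \<open>auto simp: epowr_def\<close>)

lemma epowr_ennreal: "s > 0 \<Longrightarrow> r \<ge> 0 \<Longrightarrow> epowr (ennreal r) s = ennreal (r powr s)"
  by (auto simp: epowr_def)

lemma epowr_finite_iff: "s > 0 \<Longrightarrow> epowr a s < \<infinity> \<longleftrightarrow> a < \<infinity>"
  by (auto simp: epowr_def top.not_eq_extremum)

text \<open>Real-valued, for the sake of subtraction and real powers. The conversion is faithful exactly when the
  infimum is finite, which \<open>potential_sup_weighted_bound\<close> guarantees.\<close>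

definition dyadic_inf :: "(real^'n \<Rightarrow> ennreal) \<Rightarrow> nat \<Rightarrow> real^'n \<Rightarrow> real" where
  "dyadic_inf G j x = enn2real (INF y\<in>dyadic_cube j x. G y)"

definition dyadic_potential :: "real \<Rightarrow> (real^'n \<Rightarrow> ennreal) \<Rightarrow> nat \<Rightarrow> real^'n \<Rightarrow> real" where
  "dyadic_potential \<alpha> G J x = (\<Sum>j\<le>J. 2 powr (- real j * \<alpha>) * dyadic_inf G j x)"

text \<open>The \<open>q\<close>-th power of the full dyadic series, as an extended number so that it makes sense where the
  series diverges.\<close>

definition potential_sup :: "real \<Rightarrow> real \<Rightarrow> (real^'n \<Rightarrow> ennreal) \<Rightarrow> real^'n \<Rightarrow> ennreal" where
  "potential_sup \<alpha> q G x = (SUP J. ennreal (dyadic_potential \<alpha> G J x powr q))"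

lemma dyadic_inf_nonneg: "0 \<le> dyadic_inf G j x"
  by (simp add: dyadic_inf_def)

lemma dyadic_inf_const: "y \<in> dyadic_cube j x \<Longrightarrow> dyadic_inf G j y = dyadic_inf G j x"
  by (simp add: dyadic_inf_def dyadic_cube_eq)

lemma dyadic_inf_measurable: "dyadic_inf G j \<in> borel_measurable lebesgue"
  by (rule dyadic_constant_measurable[of j]) (rule dyadic_inf_const)

lemma dyadic_potential_nonneg: "0 \<le> dyadic_potential \<alpha> G J x"
  unfolding dyadic_potential_def by (intro sum_nonneg) (simp add: dyadic_inf_nonneg)

lemma dyadic_potential_measurable: "dyadic_potential \<alpha> G J \<in> borel_measurable lebesgue"
proof -
  note [measurable] = dyadic_inf_measurable
  show ?thesis unfolding dyadic_potential_def[abs_def] by measurable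
qed

lemma potential_sup_measurable: "potential_sup \<alpha> q G \<in> borel_measurable lebesgue"
proof -
  note [measurable] = dyadic_potential_measurable
  show ?thesis unfolding potential_sup_def[abs_def] by measurable
qed

lemma potential_sup_finite:
  assumes q: "q > 0" and fin: "potential_sup \<alpha> q G x < \<infinity>"
  shows "summable (\<lambda>j. 2 powr (- real j * \<alpha>) * dyadic_inf G j x)"
    and "ennreal ((\<Sum>j. 2 powr (- real j * \<alpha>) * dyadic_inf G j x) powr q) \<le> potential_sup \<alpha> q G x"
proof -
  let ?S = "potential_sup \<alpha> q G x" and ?T = "\<lambda>J. dyadic_potential \<alpha> G J x"
  have TS: "ennreal (?T J powr q) \<le> ?S" for J unfolding potential_sup_def by (rule SUP_upper) simp
  have le: "?T J \<le> enn2real ?S powr (1 / q)" for J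
  proof -
    have "?T J powr q \<le> enn2real ?S" using enn2real_mono[OF TS[of J]] fin by simp
    hence "(?T J powr q) powr (1 / q) \<le> enn2real ?S powr (1 / q)" using q by (intro powr_mono2) auto
    thus ?thesis using q by (simp add: powr_powr dyadic_potential_nonneg)
  qed
  show sum: "summable (\<lambda>j. 2 powr (- real j * \<alpha>) * dyadic_inf G j x)"
  proof (rule summableI_nonneg_bounded)
    fix j show "0 \<le> 2 powr (- real j * \<alpha>) * dyadic_inf G j x" by (simp add: dyadic_inf_nonneg)
  next
    fix J
    have "(\<Sum>j<J. 2 powr (- real j * \<alpha>) * dyadic_inf G j x) \<le> ?T J"
      unfolding dyadic_potential_def by (intro sum_mono2) (auto simp: dyadic_inf_nonneg)
    thus "(\<Sum>j<J. 2 powr (- real j * \<alpha>) * dyadic_inf G j x) \<le> enn2real ?S powr (1 / q)"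
      using le by (rule order_trans)
  qed
  have "?T \<longlonglongrightarrow> (\<Sum>j. 2 powr (- real j * \<alpha>) * dyadic_inf G j x)"
    unfolding dyadic_potential_def by (rule summable_LIMSEQ'[OF sum])
  hence "(\<lambda>J. ?T J powr q) \<longlonglongrightarrow> (\<Sum>j. 2 powr (- real j * \<alpha>) * dyadic_inf G j x) powr q"
    by (rule tendsto_powr2[OF _ tendsto_const])
       (use q in \<open>auto intro!: always_eventually simp: dyadic_potential_nonneg\<close>)
  hence "(\<lambda>J. ennreal (?T J powr q)) \<longlonglongrightarrow> ennreal ((\<Sum>j. 2 powr (- real j * \<alpha>) * dyadic_inf G j x) powr q)"
    by (rule tendsto_ennrealI)
  thus "ennreal ((\<Sum>j. 2 powr (- real j * \<alpha>) * dyadic_inf G j x) powr q) \<le> ?S"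
    by (rule LIMSEQ_le_const2) (use TS in auto)
qed

text \<open>The infimum over a dyadic cube is at most \<open>G\<close> on that cube, so the integrals of the step functions
  are bounded by the integral of \<open>G\<^sup>p \<omega>\<^sup>p\<close> by monotonicity. The infima are finite because every cube has
  positive \<open>\<omega>\<^sup>p\<close>-mass.\<close>

lemma potential_sup_weighted_bound:
  fixes \<omega> :: "real^'n \<Rightarrow> real"
  assumes A1: "(\<lambda>x. \<omega> x powr s) \<in> A1_loc"
    and meas: "\<omega> \<in> borel_measurable lebesgue" and pos: "AE x in lebesgue. \<omega> x > 0"
    and p: "0 < p" "p \<le> 1" and pq: "p \<le> q" and qs: "q \<le> s" and \<alpha>: "0 < \<alpha>"
    and pq_\<alpha>: "1 / q = 1 / p - \<alpha> / real CARD('n)"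
  obtains K :: real where "K > 0"
    "\<forall>G. (\<integral>\<^sup>+x. epowr (G x) p * ennreal (\<omega> x powr p) \<partial>lebesgue) < \<infinity> \<longrightarrow>
       (\<forall>j x. (INF y\<in>dyadic_cube j x. G y) < \<infinity>) \<and>
       (\<integral>\<^sup>+x. potential_sup \<alpha> q G x * ennreal (\<omega> x powr q) \<partial>lebesgue)
         \<le> ennreal (K * enn2real (\<integral>\<^sup>+x. epowr (G x) p * ennreal (\<omega> x powr p) \<partial>lebesgue) powr (q / p))"
proof -
  note [measurable] = meas dyadic_cube_sets
  have q: "0 < q" using p pq by simp
  have ps: "p \<le> s" using pq qs by simp
  let ?n = "real CARD('n)"
  obtain C :: real where C: "C > 0"
    "\<forall>Q\<in>small_cubes. \<forall>Q'\<in>sets lebesgue. Q' \<subseteq> Q \<and> emeasure lebesgue Q' = emeasure lebesgue Q \<longrightarrow>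
       (\<exists>P>0. (\<integral>\<^sup>+x\<in>Q'. ennreal (\<omega> x powr p) \<partial>lebesgue) = ennreal P \<and>
          (\<integral>\<^sup>+x\<in>Q'. ennreal (\<omega> x powr q) \<partial>lebesgue)
             \<le> ennreal (C * measure lebesgue Q powr (1 - q / p) * P powr (q / p)))"
    using A1_loc_power_comparison[OF A1 meas pos p(1) ps q qs] by blast
  define W where "W j x = enn2real (\<integral>\<^sup>+y\<in>dyadic_cube j x. ennreal (\<omega> y powr p) \<partial>lebesgue)" for j x
  have W_all: "W j x > 0 \<and> (\<integral>\<^sup>+y\<in>dyadic_cube j x. ennreal (\<omega> y powr p) \<partial>lebesgue) = ennreal (W j x) \<and>
      (\<integral>\<^sup>+y\<in>dyadic_cube j x. ennreal (\<omega> y powr q) \<partial>lebesgue) \<le> ennreal (C * 2 powr (real j * \<alpha> * q) * W j x powr (q / p))" for j x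
  proof -
    obtain Q where Q: "Q \<in> small_cubes" "dyadic_cube j x \<subseteq> Q" "emeasure lebesgue (dyadic_cube j x) = emeasure lebesgue Q"
      "measure lebesgue Q = (1 / 2 ^ j) ^ CARD('n)"
      by (rule dyadic_cube_small)
    obtain P where P: "P > 0" "(\<integral>\<^sup>+y\<in>dyadic_cube j x. ennreal (\<omega> y powr p) \<partial>lebesgue) = ennreal P"
      "(\<integral>\<^sup>+y\<in>dyadic_cube j x. ennreal (\<omega> y powr q) \<partial>lebesgue) \<le> ennreal (C * measure lebesgue Q powr (1 - q / p) * P powr (q / p))"
      using C(2)[rule_format, OF Q(1) dyadic_cube_sets[of j x]] Q(2,3) by blast
    have WP: "W j x = P" using P(1,2) by (simp add: W_def)
    have "(1 / 2 ^ j :: real) ^ CARD('n) = 2 powr (- (real j * ?n))"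
      by (simp add: powr_minus divide_inverse power_inverse powr_powr[symmetric] powr_realpow)
    hence "measure lebesgue Q powr (1 - q / p) = 2 powr (- (real j * ?n) * (1 - q / p))"
      unfolding Q(4) by (simp add: powr_powr)
    also have "- (real j * ?n) * (1 - q / p) = real j * \<alpha> * q"
    proof -
      have "\<alpha> * q = ?n * (q / p - 1)"
      proof -
        have "\<alpha> / ?n = 1 / p - 1 / q" using pq_\<alpha> by simp
        hence "\<alpha> = ?n * (1 / p - 1 / q)" by (simp add: field_simps)
        thus ?thesis using q p by (simp add: field_simps)
      qed
      hence "real j * \<alpha> * q = real j * (?n * (q / p - 1))" by (simp only: mult.assoc)
      thus ?thesis by (simp add: algebra_simps)
    qed
    finally show ?thesis using P WP by simp
  qed
  define c where "c = (1 / (1 - 2 powr (- (\<alpha> * p)))) powr (q / p)"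
  have c: "c > 0" unfolding c_def using p \<alpha> powr_less_one[of 2 "- (\<alpha> * p)"] by simp
  show ?thesis
  proof (rule that[of "c * C"], simp add: c C(1), intro allI impI)
    fix G :: "real^'n \<Rightarrow> ennreal"
    let ?Hn = "\<integral>\<^sup>+x. epowr (G x) p * ennreal (\<omega> x powr p) \<partial>lebesgue"
    assume fin: "?Hn < \<infinity>"
    define H where "H = enn2real ?Hn"
    have H: "?Hn = ennreal H" "H \<ge> 0" using fin by (simp_all add: H_def)
    define B where "B j x = (INF y\<in>dyadic_cube j x. G y)" for j x
    have B_le: "B j x \<le> G y" if "y \<in> dyadic_cube j x" for j x y
      unfolding B_def using that by (rule INF_lower)
    have B_fin: "B j x < \<infinity>" for j x
    proof -
      have "epowr (B j x) p * ennreal (W j x) = (\<integral>\<^sup>+y. epowr (B j x) p * (ennreal (\<omega> y powr p) * indicator (dyadic_cube j x) y) \<partial>lebesgue)"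
        using W_all by (simp add: nn_integral_cmult)
      also have "\<dots> \<le> ?Hn"
      proof (rule nn_integral_mono)
        fix y show "epowr (B j x) p * (ennreal (\<omega> y powr p) * indicator (dyadic_cube j x) y) \<le> epowr (G y) p * ennreal (\<omega> y powr p)"
          using epowr_mono[OF p(1) B_le[of y j x]] by (auto simp: indicator_def intro!: mult_right_mono)
      qed
      also have "\<dots> < \<infinity>" by (rule fin)
      finally have "epowr (B j x) p < \<infinity>"
        using W_all[of j x] by (auto simp: ennreal_mult_less_top)
      thus ?thesis using epowr_finite_iff[OF p(1)] by simp
    qed
    have bB: "ennreal (dyadic_inf G j x) = B j x" for j x
      using B_fin[of j x] by (simp add: dyadic_inf_def B_def)
    have bmono: "dyadic_inf G j x \<le> dyadic_inf G (Suc j) x" for j x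
      unfolding dyadic_inf_def B_def[symmetric]
    proof (rule enn2real_mono)
      show "B j x \<le> B (Suc j) x" unfolding B_def by (rule INF_superset_mono[OF dyadic_cube_Suc]) simp
      show "B (Suc j) x < top" using B_fin[of "Suc j" x] by simp
    qed
    have bH: "(\<integral>\<^sup>+x. ennreal (dyadic_inf G J x powr p) * ennreal (\<omega> x powr p) \<partial>lebesgue) \<le> ennreal H" for J
      unfolding H(1)[symmetric]
    proof (rule nn_integral_mono)
      fix x
      have "ennreal (dyadic_inf G J x powr p) = epowr (B J x) p" by (simp add: epowr_ennreal[OF p(1) dyadic_inf_nonneg] flip: bB)
      also have "\<dots> \<le> epowr (G x) p" by (rule epowr_mono[OF p(1) B_le[OF dyadic_cube_self]])
      finally show "ennreal (dyadic_inf G J x powr p) * ennreal (\<omega> x powr p) \<le> epowr (G x) p * ennreal (\<omega> x powr p)"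
        by (rule mult_right_mono) simp
    qed
    note [measurable] = dyadic_potential_measurable
    have Tinc: "dyadic_potential \<alpha> G J x \<le> dyadic_potential \<alpha> G (Suc J) x" for J x
      by (simp add: dyadic_potential_def dyadic_inf_nonneg)
    have bound: "(\<integral>\<^sup>+x. ennreal (dyadic_potential \<alpha> G J x powr q) * ennreal (\<omega> x powr q) \<partial>lebesgue) \<le> ennreal (c * C * H powr (q / p))" for J
      unfolding dyadic_potential_def c_def
    proof (rule dyadic_fractional_inequality[OF p pq \<alpha> C(1) H(2), where W = W and b = "dyadic_inf G" and u = "\<lambda>x. \<omega> x powr p"])
      show "(\<lambda>x. \<omega> x powr p) \<in> borel_measurable lebesgue" by measurable
      show "(\<lambda>x. \<omega> x powr q) \<in> borel_measurable lebesgue" by measurable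
      show "W j x > 0" for j x using W_all by blast
      show "(\<integral>\<^sup>+y\<in>dyadic_cube j x. ennreal (\<omega> y powr p) \<partial>lebesgue) = ennreal (W j x)" for j x using W_all by blast
      show "(\<integral>\<^sup>+y\<in>dyadic_cube j x. ennreal (\<omega> y powr q) \<partial>lebesgue) \<le> ennreal (C * 2 powr (real j * \<alpha> * q) * W j x powr (q / p))" for j x
        using W_all by blast
    qed (fact dyadic_inf_nonneg bmono dyadic_inf_const bH)+
    have "(\<integral>\<^sup>+x. potential_sup \<alpha> q G x * ennreal (\<omega> x powr q) \<partial>lebesgue) =
        (\<integral>\<^sup>+x. (SUP J. ennreal (dyadic_potential \<alpha> G J x powr q) * ennreal (\<omega> x powr q)) \<partial>lebesgue)"
      unfolding potential_sup_def by (simp add: SUP_mult_right_ennreal)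
    also have "\<dots> = (SUP J. \<integral>\<^sup>+x. ennreal (dyadic_potential \<alpha> G J x powr q) * ennreal (\<omega> x powr q) \<partial>lebesgue)"
    proof (rule nn_integral_monotone_convergence_SUP)
      show "incseq (\<lambda>J x. ennreal (dyadic_potential \<alpha> G J x powr q) * ennreal (\<omega> x powr q))"
        using dyadic_potential_nonneg Tinc q
        by (intro incseq_SucI le_funI mult_right_mono ennreal_leI powr_mono2) auto
    qed measurable
    also have "\<dots> \<le> ennreal (c * C * H powr (q / p))" by (rule SUP_least) (rule bound)
    finally show "(\<forall>j x. (INF y\<in>dyadic_cube j x. G y) < \<infinity>) \<and>
        (\<integral>\<^sup>+x. potential_sup \<alpha> q G x * ennreal (\<omega> x powr q) \<partial>lebesgue) \<le> ennreal (c * C * enn2real ?Hn powr (q / p))"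
      using B_fin unfolding B_def H_def by blast
  qed
qed

text \<open>On each small cube the weight is bounded below by a positive constant, and finitely many such cubes
  cover a compact set.\<close>

lemma weighted_integrable_imp_locally_integrable:
  fixes \<omega> :: "real^'n \<Rightarrow> real" and S :: "real^'n \<Rightarrow> ennreal"
  assumes A1: "(\<lambda>x. \<omega> x powr s) \<in> A1_loc" and s: "s > 0" and q: "q > 0"
    and meas: "\<omega> \<in> borel_measurable lebesgue" and pos: "AE x in lebesgue. \<omega> x > 0"
    and S: "S \<in> borel_measurable lebesgue" "(\<integral>\<^sup>+x. S x * ennreal (\<omega> x powr q) \<partial>lebesgue) < \<infinity>"
    and K: "compact K"
  shows "(\<integral>\<^sup>+x\<in>K. S x \<partial>lebesgue) < \<infinity>"
proof -
  note [measurable] = meas S(1)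
  have cs [measurable]: "cube x t \<in> sets lebesgue" for x :: "real^'n" and t by (simp add: cube_eq_cbox)
  have cube: "(\<integral>\<^sup>+x\<in>cube z 1. S x \<partial>lebesgue) < \<infinity>" for z
  proof -
    have "cube z 1 \<in> small_cubes" by (rule cube_small) auto
    then obtain m where m: "m > 0" "AE x in lebesgue. x \<in> cube z 1 \<longrightarrow> m \<le> \<omega> x"
      using A1_loc_lower_bound[OF A1 s meas pos] by blast
    have "(\<integral>\<^sup>+x\<in>cube z 1. S x \<partial>lebesgue) \<le> (\<integral>\<^sup>+x. ennreal (m powr (- q)) * (S x * ennreal (\<omega> x powr q)) \<partial>lebesgue)"
    proof (rule nn_integral_mono_AE)
      show "AE x in lebesgue. S x * indicator (cube z 1) x \<le> ennreal (m powr (- q)) * (S x * ennreal (\<omega> x powr q))"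
        using m(2)
      proof eventually_elim
        case (elim x)
        show ?case
        proof (cases "x \<in> cube z 1")
          case True
          have "1 = m powr (- q) * m powr q" using m(1) by (simp flip: powr_add)
          also have "\<dots> \<le> m powr (- q) * \<omega> x powr q"
            using elim True m(1) q by (intro mult_left_mono powr_mono2) auto
          finally have "ennreal 1 \<le> ennreal (m powr (- q) * \<omega> x powr q)" by (rule ennreal_leI)
          hence "S x * 1 \<le> S x * ennreal (m powr (- q) * \<omega> x powr q)" by (intro mult_left_mono) auto
          thus ?thesis using True by (simp add: ennreal_mult mult_ac)
        qed simp
      qed
    qed
    also have "\<dots> = ennreal (m powr (- q)) * (\<integral>\<^sup>+x. S x * ennreal (\<omega> x powr q) \<partial>lebesgue)"
      by (rule nn_integral_cmult) measurable
    also have "\<dots> < \<infinity>" using S(2) by (simp add: ennreal_mult_less_top)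
    finally show ?thesis .
  qed
  have "\<exists>Z \<subseteq> K. finite Z \<and> K \<subseteq> (\<Union>z\<in>Z. ball z (1 / 2))"
  proof (rule compactE_image[OF K, of K "\<lambda>z. ball z (1 / 2)"])
    show "K \<subseteq> (\<Union>z\<in>K. ball z (1 / 2))" by auto
  qed (simp_all, blast)
  then obtain Z where Z: "finite Z" "K \<subseteq> (\<Union>z\<in>Z. ball z (1 / 2))" by blast
  have sub: "ball z (1 / 2) \<subseteq> cube z 1" for z :: "real^'n"
  proof
    fix y assume "y \<in> ball z (1 / 2)"
    hence "norm (y - z) \<le> 1 / 2" by (simp add: dist_norm norm_minus_commute)
    hence "\<bar>(y - z) $ i\<bar> \<le> 1 / 2" for i using component_le_norm_cart[of "y - z" i] by linarith
    thus "y \<in> cube z 1" by (simp add: cube_def)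
  qed
  have "(\<integral>\<^sup>+x\<in>K. S x \<partial>lebesgue) \<le> (\<integral>\<^sup>+x. (\<Sum>z\<in>Z. S x * indicator (cube z 1) x) \<partial>lebesgue)"
  proof (rule nn_integral_mono)
    fix x
    show "S x * indicator K x \<le> (\<Sum>z\<in>Z. S x * indicator (cube z 1) x)"
    proof (cases "x \<in> K")
      case True
      then obtain z where "z \<in> Z" "x \<in> cube z 1" using Z(2) sub by blast
      hence "S x * indicator K x = S x * indicator (cube z 1) x" using True by simp
      also have "\<dots> \<le> (\<Sum>z\<in>Z. S x * indicator (cube z 1) x)"
        using \<open>z \<in> Z\<close> Z(1) by (intro member_le_sum) auto
      finally show ?thesis .
    qed simp
  qed
  also have "\<dots> = (\<Sum>z\<in>Z. \<integral>\<^sup>+x\<in>cube z 1. S x \<partial>lebesgue)"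
    by (rule nn_integral_sum) measurable
  also have "\<dots> < \<infinity>" using cube Z(1) by simp
  finally show ?thesis .
qed

section \<open>The boundedness theorem\<close>

text \<open>The lower bound on \<open>p\<close> amounts to \<open>q \<ge> 1\<close>, and the last exponent \<open>s\<close> satisfies
  \<open>1/s = 1 - 1/r - \<alpha>/n\<close>, below \<open>1/q\<close>.\<close>

lemma exponent_arithmetic:
  fixes n \<alpha> p q r :: real
  assumes n: "n > 0" and \<alpha>: "0 < \<alpha>" "\<alpha> < n" and p: "n / (n + \<alpha>) \<le> p" "p \<le> 1"
    and q: "1 / q = 1 / p - \<alpha> / n" and r: "n / (n - \<alpha>) < r"
  shows "0 < p" "p \<le> q" "1 \<le> q" "q \<le> n * r / (n * r - n - r * \<alpha>)"
proof -
  show p0: "0 < p" using p(1) n \<alpha> by (smt (verit) divide_pos_pos)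
  have "\<alpha> / n < 1" using n \<alpha> by simp
  moreover have p1: "1 / p \<ge> 1" using p0 p(2) by simp
  ultimately have "1 / q > 0" using q by linarith
  hence q0: "q > 0" by simp
  have "\<alpha> / n > 0" using n \<alpha> by simp
  hence "1 / q \<le> 1 / p" using q by linarith
  thus "p \<le> q" using q0 p0 by (simp add: field_simps)
  have "n / p \<le> n + \<alpha>" using p(1) n \<alpha> p0 by (simp add: field_simps)
  hence "1 / p \<le> 1 + \<alpha> / n" using n p0 by (simp add: field_simps)
  hence "1 / q \<le> 1" using q by linarith
  thus "1 \<le> q" using q0 by simp
  have r0: "r > 0" using r n \<alpha> by (smt (verit) divide_pos_pos)
  have "n < r * (n - \<alpha>)" using r \<alpha> by (simp add: field_simps)
  hence d: "n * r - n - r * \<alpha> > 0" by (simp add: algebra_simps)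
  have "(n * r - n - r * \<alpha>) / (n * r) = 1 - 1 / r - \<alpha> / n" using n r0 by (simp add: field_simps)
  also have "\<dots> \<le> 1 / q"
  proof -
    have "0 < 1 / r" using r0 by simp
    thus ?thesis using q p1 by linarith
  qed
  finally have "q * (n * r - n - r * \<alpha>) \<le> n * r" using q0 n r0 by (simp add: field_simps)
  thus "q \<le> n * r / (n * r - n - r * \<alpha>)" using d by (simp add: field_simps)
qed

theorem theorem8p10:
  fixes \<alpha> p q A\<^sub>0 :: real and n N :: nat
    and \<omega> :: "real^'n \<Rightarrow> real"
    and \<phi>\<^sub>0 \<psi>\<^sub>0 :: "real^'n \<Rightarrow> complex"
  assumes n: "n = CARD('n)"
    and phi0: "cutoff \<phi>\<^sub>0"
    and psi0: "\<psi>\<^sub>0 \<in> test_functions" "(LINT x|lebesgue. \<psi>\<^sub>0 x) \<noteq> 0"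
    and A0: "peetre_threshold \<psi>\<^sub>0 A\<^sub>0"
    and alpha: "0 < \<alpha>" "\<alpha> < n"
    and p: "n / (n + \<alpha>) \<le> p" "p \<le> 1"
    and q: "1 / q = 1 / p - \<alpha> / n"
    and weight: "weight \<omega>"
    and A1: "\<exists>r::real. n / (n - \<alpha>) < r \<and>
               (\<lambda>x. \<omega> x powr (n * r / (n * r - n - r * \<alpha>))) \<in> A1_loc"
    and infinite_mass: "(\<integral>\<^sup>+x. ennreal (\<omega> x powr p) \<partial>lebesgue) = \<infinity>"
    and N: "int N \<ge> N_index A\<^sub>0 p (\<lambda>x. \<omega> x powr p)"
  shows "\<exists>C::real. C > 0 \<and>
    (\<forall>f \<in> hardy_space N p (\<lambda>x. \<omega> x powr p).
       \<exists>g. represents g (I_loc \<phi>\<^sub>0 \<alpha> f) \<and>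
           Lw_norm q (\<lambda>x. \<omega> x powr q) (\<lambda>x. ennreal (norm (g x)))
             \<le> ennreal C * hardy_norm N p (\<lambda>x. \<omega> x powr p) f)"
proof -
  obtain r :: real where r: "n / (n - \<alpha>) < r"
    "(\<lambda>x. \<omega> x powr (n * r / (n * r - n - r * \<alpha>))) \<in> A1_loc" using A1 by blast
  define s where "s = n * r / (n * r - n - r * \<alpha>)"
  have A1s: "(\<lambda>x. \<omega> x powr s) \<in> A1_loc" using r(2) by (simp add: s_def)
  have n0: "real n > 0" using n by simp
  note ex = exponent_arithmetic[OF n0 alpha p q r(1), folded s_def]
  have q0: "q > 0" and s0: "s > 0" using ex by linarith+
  have meas: "\<omega> \<in> borel_measurable lebesgue" and pos: "AE x in lebesgue. \<omega> x > 0"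
    using weight by (auto simp: weight_def intro: locally_integrable_measurable)
  obtain K :: real where K: "K > 0" and maj:
    "\<forall>G. (\<integral>\<^sup>+x. epowr (G x) p * ennreal (\<omega> x powr p) \<partial>lebesgue) < \<infinity> \<longrightarrow>
       (\<forall>j x. (INF y\<in>dyadic_cube j x. G y) < \<infinity>) \<and>
       (\<integral>\<^sup>+x. potential_sup \<alpha> q G x * ennreal (\<omega> x powr q) \<partial>lebesgue)
         \<le> ennreal (K * enn2real (\<integral>\<^sup>+x. epowr (G x) p * ennreal (\<omega> x powr p) \<partial>lebesgue) powr (q / p))"
    by (rule potential_sup_weighted_bound[OF A1s meas pos ex(1) p(2) ex(2) ex(4) alpha(1) q[unfolded n]])
  obtain M :: real where M: "M > 0" and ptw:
    "\<forall>f\<in>distributions. \<forall>j x y. (\<forall>i. \<bar>x $ i - y $ i\<bar> \<le> 1 / 2 ^ j) \<longrightarrow>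
       ennreal (norm (conv (kernel_piece \<phi>\<^sub>0 \<alpha> j) f x)) \<le> ennreal (M * 2 powr (- real j * \<alpha>)) * grand_max N f y"
    by (rule conv_kernel_piece_le[OF phi0, of \<alpha> N])
  note [measurable] = meas
  show ?thesis
  proof (intro exI[of _ "M * K powr (1 / q)"] conjI ballI)
    show "M * K powr (1 / q) > 0" using M K by simp
    fix f assume "f \<in> hardy_space N p (\<lambda>x. \<omega> x powr p)"
    hence f: "f \<in> distributions" and hf: "hardy_norm N p (\<lambda>x. \<omega> x powr p) f < \<infinity>"
      by (auto simp: hardy_space_def)
    let ?G = "grand_max N f"
    let ?Hn = "\<integral>\<^sup>+x. epowr (?G x) p * ennreal (\<omega> x powr p) \<partial>lebesgue"
    have hn: "hardy_norm N p (\<lambda>x. \<omega> x powr p) f = epowr ?Hn (1 / p)"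
      by (simp add: hardy_norm_def Lw_norm_def)
    have fin: "?Hn < \<infinity>" using hf ex(1) unfolding hn by (subst (asm) epowr_finite_iff) auto
    define H where "H = enn2real ?Hn"
    have H: "?Hn = ennreal H" "H \<ge> 0" using fin by (simp_all add: H_def)
    define b where "b = dyadic_inf ?G"
    define S where "S = potential_sup \<alpha> q ?G"
    have b: "0 \<le> b j x" "ennreal (b j x) = (INF y\<in>dyadic_cube j x. ?G y)" "b j \<in> borel_measurable lebesgue" for j x
      using maj[rule_format, OF fin] unfolding b_def
      by (simp_all add: dyadic_inf_nonneg dyadic_inf_measurable dyadic_inf_def)
    have S: "S \<in> borel_measurable lebesgue"
      "\<And>x. S x < \<infinity> \<Longrightarrow> summable (\<lambda>j. 2 powr (- real j * \<alpha>) * b j x)"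
      "\<And>x. S x < \<infinity> \<Longrightarrow> ennreal ((\<Sum>j. 2 powr (- real j * \<alpha>) * b j x) powr q) \<le> S x"
      "(\<integral>\<^sup>+x. S x * ennreal (\<omega> x powr q) \<partial>lebesgue) \<le> ennreal (K * H powr (q / p))"
      using maj[rule_format, OF fin] potential_sup_finite[OF q0, of \<alpha> ?G] unfolding b_def S_def H_def
      by (simp_all add: potential_sup_measurable)
    note [measurable] = b(3) S(1)
    have Sfin: "(\<integral>\<^sup>+x. S x * ennreal (\<omega> x powr q) \<partial>lebesgue) < \<infinity>"
      using S(4) by (rule order_le_less_trans) simp
    have "AE x in lebesgue. S x * ennreal (\<omega> x powr q) \<noteq> \<infinity>"
      by (rule nn_integral_PInf_AE) (use Sfin in auto)
    with pos have S_AE: "AE x in lebesgue. S x < \<infinity>"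
      by eventually_elim (auto simp: ennreal_mult_eq_top_iff less_top)
    define c where "c j = conv (kernel_piece \<phi>\<^sub>0 \<alpha> j) f" for j
    have c_meas [measurable]: "c j \<in> borel_measurable lebesgue" for j
      unfolding c_def by (rule continuous_lebesgue_measurable[OF conv_continuous[OF f test_kernel_piece[OF phi0]]])
    have c_le: "norm (c j x) \<le> M * (2 powr (- real j * \<alpha>) * b j x)" for j x
    proof -
      let ?k = "M * 2 powr (- real j * \<alpha>)"
      have k: "?k > 0" using M by simp
      have "ennreal (norm (c j x) / ?k) \<le> ?G y" if "y \<in> dyadic_cube j x" for y
      proof -
        have "ennreal (norm (c j x)) \<le> ennreal ?k * ?G y"
          unfolding c_def by (rule ptw[rule_format, OF f]) (use dyadic_cube_diff[OF that] in blast)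
        hence "ennreal (1 / ?k) * ennreal (norm (c j x)) \<le> ennreal (1 / ?k) * (ennreal ?k * ?G y)"
          by (rule mult_left_mono) simp
        also have "\<dots> = ennreal (1 / ?k * ?k) * ?G y"
          using k by (subst ennreal_mult) (simp_all add: mult.assoc)
        also have "\<dots> = ?G y" using M by simp
        finally show ?thesis using k by (simp add: ennreal_mult[symmetric])
      qed
      hence "ennreal (norm (c j x) / ?k) \<le> ennreal (b j x)"
        unfolding b(2) by (rule INF_greatest)
      hence "norm (c j x) / ?k \<le> b j x" using b(1) by simp
      thus ?thesis using k by (simp add: field_simps)
    qed
    define T where "T x = (\<Sum>j. 2 powr (- real j * \<alpha>) * b j x)" for x
    define g where "g x = (\<Sum>j. c j x)" for x
    have g_meas [measurable]: "g \<in> borel_measurable lebesgue"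
      unfolding g_def by (rule borel_measurable_suminf) measurable
    have T_meas [measurable]: "T \<in> borel_measurable lebesgue"
      unfolding T_def by (rule borel_measurable_suminf) measurable
    have T0: "0 \<le> T x" if "S x < \<infinity>" for x
      unfolding T_def using S(2)[OF that] b(1) by (intro suminf_nonneg) auto
    have sumT: "summable (\<lambda>j. M * (2 powr (- real j * \<alpha>) * b j x))" if "S x < \<infinity>" for x
      by (rule summable_mult[OF S(2)[OF that]])
    have c_sum: "summable (\<lambda>j. norm (c j x))" if "S x < \<infinity>" for x
      by (rule summable_comparison_test'[OF sumT[OF that], of 0]) (use c_le in simp)
    have partial_le: "norm (\<Sum>j<J. c j x) \<le> M * T x" if "S x < \<infinity>" for J x
    proof -
      have "norm (\<Sum>j<J. c j x) \<le> (\<Sum>j<J. M * (2 powr (- real j * \<alpha>) * b j x))"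
        by (intro sum_norm_le c_le)
      also have "\<dots> \<le> (\<Sum>j. M * (2 powr (- real j * \<alpha>) * b j x))"
        using M b(1) by (intro sum_le_suminf sumT that) auto
      also have "\<dots> = M * T x" unfolding T_def by (rule suminf_mult[OF S(2)[OF that]])
      finally show ?thesis .
    qed
    have g_lim: "(\<lambda>J. \<Sum>j<J. c j x) \<longlonglongrightarrow> g x" if "S x < \<infinity>" for x
      unfolding g_def by (rule summable_LIMSEQ[OF summable_norm_cancel[OF c_sum[OF that]]])
    have g_le: "norm (g x) \<le> M * T x" if "S x < \<infinity>" for x
      by (rule LIMSEQ_le_const2[OF tendsto_norm[OF g_lim[OF that]]]) (use partial_le[OF that] in blast)
    \<comment> \<open>Where \<open>T > 1\<close>, \<open>T \<le> T\<^sup>q\<close> because \<open>q \<ge> 1\<close>; so local integrability of \<open>T\<^sup>q\<close> suffices.\<close>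
    have T_loc: "(\<integral>\<^sup>+x\<in>Q. ennreal (T x) \<partial>lebesgue) < \<infinity>" if Q: "compact Q" for Q :: "(real^'n) set"
    proof -
      have Qs [measurable]: "Q \<in> sets lebesgue" using Q by (simp add: compact_imp_closed)
      have "(\<integral>\<^sup>+x\<in>Q. ennreal (T x) \<partial>lebesgue) \<le> (\<integral>\<^sup>+x. indicator Q x + S x * indicator Q x \<partial>lebesgue)"
      proof (rule nn_integral_mono_AE)
        show "AE x in lebesgue. ennreal (T x) * indicator Q x \<le> indicator Q x + S x * indicator Q x"
          using S_AE
        proof eventually_elim
          case (elim x)
          have "T x \<le> 1 + T x powr q"
          proof (cases "T x \<le> 1")
            case False
            hence "T x powr 1 \<le> T x powr q" using ex(3) by (intro powr_mono) auto
            thus ?thesis using False by simp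
          qed (simp add: add_increasing2)
          hence "ennreal (T x) \<le> ennreal (1 + T x powr q)" by (rule ennreal_leI)
          also have "\<dots> = 1 + ennreal (T x powr q)" by simp
          also have "\<dots> \<le> 1 + S x" using S(3)[OF elim] unfolding T_def by (rule add_left_mono)
          finally show ?case by (simp add: indicator_def)
        qed
      qed
      also have "\<dots> = emeasure lebesgue Q + (\<integral>\<^sup>+x\<in>Q. S x \<partial>lebesgue)"
        by (subst nn_integral_add) simp_all
      also have "\<dots> < \<infinity>"
      proof -
        have "emeasure lebesgue Q < \<infinity>" 
          using emeasure_bounded_finite[OF compact_imp_bounded[OF Q]] Q by (simp add: compact_imp_closed)
        moreover have "(\<integral>\<^sup>+x\<in>Q. S x \<partial>lebesgue) < \<infinity>"
          by (rule weighted_integrable_imp_locally_integrable[OF A1s s0 q0 meas pos S(1) Sfin Q])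
        ultimately show ?thesis by simp
      qed
      finally show ?thesis .
    qed
    have T_int: "integrable lebesgue (\<lambda>x. indicator Q x *\<^sub>R T x)" if Q: "compact Q" for Q :: "(real^'n) set"
    proof (rule integrableI_bounded)
      have Qs [measurable]: "Q \<in> sets lebesgue" using Q by (simp add: compact_imp_closed)
      show "(\<lambda>x. indicator Q x *\<^sub>R T x) \<in> borel_measurable lebesgue" by measurable
      have "(\<integral>\<^sup>+x. ennreal (norm (indicator Q x *\<^sub>R T x)) \<partial>lebesgue) = (\<integral>\<^sup>+x\<in>Q. ennreal (T x) \<partial>lebesgue)"
      proof (rule nn_integral_cong_AE)
        show "AE x in lebesgue. ennreal (norm (indicator Q x *\<^sub>R T x)) = ennreal (T x) * indicator Q x"
          using S_AE by eventually_elim (use T0 in \<open>simp add: indicator_def\<close>)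
      qed
      thus "(\<integral>\<^sup>+x. ennreal (norm (indicator Q x *\<^sub>R T x)) \<partial>lebesgue) < \<infinity>" using T_loc[OF Q] by simp
    qed
    have g_loc: "locally_integrable g"
      unfolding locally_integrable_def set_integrable_def
    proof (intro allI impI)
      fix Q :: "(real^'n) set" assume Q: "compact Q"
      have Qs [measurable]: "Q \<in> sets lebesgue" using Q by (simp add: compact_imp_closed)
      show "integrable lebesgue (\<lambda>x. indicator Q x *\<^sub>R g x)"
      proof (rule Bochner_Integration.integrable_bound[OF integrable_mult_right[OF T_int[OF Q], of M]])
        show "(\<lambda>x. indicator Q x *\<^sub>R g x) \<in> borel_measurable lebesgue" by measurable
        show "AE x in lebesgue. norm (indicator Q x *\<^sub>R g x) \<le> norm (M * (indicator Q x *\<^sub>R T x))"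
          using S_AE by eventually_elim (use g_le T0 M in \<open>auto simp: indicator_def abs_mult\<close>)
      qed
    qed
    have dual: "I_loc \<phi>\<^sub>0 \<alpha> f \<phi> = (LINT x|lebesgue. g x * \<phi> x)" if \<phi>: "\<phi> \<in> test_functions" for \<phi>
    proof -
      obtain R where R: "R > 0" "\<And>x. norm x > R \<Longrightarrow> \<phi> x = 0" using test_support_ball[OF \<phi>] by blast
      obtain B where B: "B > 0" "\<And>x. norm (\<phi> x) \<le> B" using test_bounded[OF \<phi>] by blast
      have \<phi>m [measurable]: "\<phi> \<in> borel_measurable lebesgue" by (rule test_measurable[OF \<phi>])
      let ?w = "\<lambda>x. (M * B) * (indicator (cball 0 R) x *\<^sub>R T x)"
      have w: "integrable lebesgue ?w" by (rule integrable_mult_right[OF T_int]) simp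
      have wb: "norm (z * \<phi> x) \<le> ?w x" if "norm z \<le> M * T x" "S x < \<infinity>" for x z
      proof (cases "norm x > R")
        case True
        thus ?thesis using R(2) T0[OF that(2)] M B by simp
      next
        case False
        have "norm (z * \<phi> x) \<le> (M * T x) * B"
          unfolding norm_mult using that(1) B(2) M T0[OF that(2)] by (intro mult_mono) auto
        thus ?thesis using False by (simp add: mult_ac)
      qed
      have part: "(LINT x|lebesgue. (\<Sum>j<J. c j x) * \<phi> x) = (\<Sum>j<J. LINT x|lebesgue. c j x * \<phi> x)" for J
      proof -
        have "integrable lebesgue (\<lambda>x. c j x * \<phi> x)" for j
        proof (rule Bochner_Integration.integrable_bound[OF w])
          show "(\<lambda>x. c j x * \<phi> x) \<in> borel_measurable lebesgue" by measurable
          show "AE x in lebesgue. norm (c j x * \<phi> x) \<le> norm (?w x)"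
            using S_AE
          proof eventually_elim
            case (elim x)
            have "M * (2 powr (- real j * \<alpha>) * b j x) \<le> M * T x"
            proof -
              have "2 powr (- real j * \<alpha>) * b j x = (\<Sum>i\<in>{j}. 2 powr (- real i * \<alpha>) * b i x)" by simp
              also have "\<dots> \<le> T x" unfolding T_def using b(1) by (intro sum_le_suminf S(2) elim) auto
              finally show ?thesis using M by simp
            qed
            from wb[OF order_trans[OF c_le this] elim] show ?case by (rule order_trans) simp
          qed
        qed
        thus ?thesis by (simp add: sum_distrib_right)
      qed
      have "(\<lambda>J. LINT x|lebesgue. (\<Sum>j<J. c j x) * \<phi> x) \<longlonglongrightarrow> (LINT x|lebesgue. g x * \<phi> x)"
      proof (rule integral_dominated_convergence[where w = ?w])
        show "AE x in lebesgue. (\<lambda>J. (\<Sum>j<J. c j x) * \<phi> x) \<longlonglongrightarrow> g x * \<phi> x"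
          using S_AE by eventually_elim (intro tendsto_mult g_lim tendsto_const)
        show "AE x in lebesgue. norm ((\<Sum>j<J. c j x) * \<phi> x) \<le> ?w x" for J
          using S_AE by eventually_elim (intro wb partial_le)
      qed (use w in measurable)
      moreover have "(\<lambda>J. LINT x|lebesgue. (\<Sum>j<J. c j x) * \<phi> x) \<longlonglongrightarrow> I_loc \<phi>\<^sub>0 \<alpha> f \<phi>"
        unfolding part using I_loc_sums[OF phi0 alpha(1) f \<phi>] by (simp add: sums_def c_def)
      ultimately show ?thesis by (rule LIMSEQ_unique[symmetric])
    qed
    have rep: "represents g (I_loc \<phi>\<^sub>0 \<alpha> f)" unfolding represents_def using g_loc dual by blast
    have "(\<integral>\<^sup>+x. epowr (ennreal (norm (g x))) q * ennreal (\<omega> x powr q) \<partial>lebesgue)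
        \<le> (\<integral>\<^sup>+x. ennreal (M powr q) * (S x * ennreal (\<omega> x powr q)) \<partial>lebesgue)"
    proof (rule nn_integral_mono_AE)
      show "AE x in lebesgue. epowr (ennreal (norm (g x))) q * ennreal (\<omega> x powr q) \<le> ennreal (M powr q) * (S x * ennreal (\<omega> x powr q))"
        using S_AE
      proof eventually_elim
        case (elim x)
        have "epowr (ennreal (norm (g x))) q = ennreal (norm (g x) powr q)" by (rule epowr_ennreal[OF q0]) simp
        also have "\<dots> \<le> ennreal ((M * T x) powr q)"
          using g_le[OF elim] q0 by (intro ennreal_leI powr_mono2) auto
        also have "\<dots> = ennreal (M powr q) * ennreal (T x powr q)" by (simp add: powr_mult ennreal_mult)
        also have "\<dots> \<le> ennreal (M powr q) * S x" using S(3)[OF elim] unfolding T_def by (intro mult_left_mono) auto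
        finally show ?case by (simp add: mult_right_mono mult.assoc[symmetric])
      qed
    qed
    also have "\<dots> = ennreal (M powr q) * (\<integral>\<^sup>+x. S x * ennreal (\<omega> x powr q) \<partial>lebesgue)"
      by (rule nn_integral_cmult) measurable
    also have "\<dots> \<le> ennreal (M powr q) * ennreal (K * H powr (q / p))" by (intro mult_left_mono S(4)) simp
    also have "\<dots> = ennreal (M powr q * (K * H powr (q / p)))" using K by (simp add: ennreal_mult)
    finally have "Lw_norm q (\<lambda>x. \<omega> x powr q) (\<lambda>x. ennreal (norm (g x))) \<le> epowr (ennreal (M powr q * (K * H powr (q / p)))) (1 / q)"
      unfolding Lw_norm_def using q0 by (intro epowr_mono) auto
    also have "\<dots> = ennreal ((M powr q * (K * H powr (q / p))) powr (1 / q))"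
      using q0 K by (intro epowr_ennreal) auto
    also have "(M powr q * (K * H powr (q / p))) powr (1 / q) = M * K powr (1 / q) * H powr (1 / p)"
      unfolding powr_mult using q0 M by (simp add: powr_powr)
    also have "ennreal \<dots> = ennreal (M * K powr (1 / q)) * ennreal (H powr (1 / p))"
      using M by (intro ennreal_mult) auto
    also have "ennreal (H powr (1 / p)) = hardy_norm N p (\<lambda>x. \<omega> x powr p) f"
      unfolding hn H(1) using ex(1) H(2) by (intro epowr_ennreal[symmetric]) auto
    finally show "\<exists>g. represents g (I_loc \<phi>\<^sub>0 \<alpha> f) \<and>
           Lw_norm q (\<lambda>x. \<omega> x powr q) (\<lambda>x. ennreal (norm (g x)))
             \<le> ennreal (M * K powr (1 / q)) * hardy_norm N p (\<lambda>x. \<omega> x powr p) f"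
      using rep by blast
  qed
qed

end
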